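(* For each $L>0$, the function $t\mapsto\mathbb E(1+t)^{N_I(L)}$ is zero-free on $\Omega_I$. There exists a unique holomorphic function $D_I$ on $\Omega_I$, with $D_I(0)=0$, such that \[ \log\mathbb E(1+t)^{N_I(L)}=L\,\mathcal L_I(t)+D_I(t)+o(1),\qquad L\to\infty, \] locally uniformly for $t\in\Omega_I$, where the logarithm on the left denotes the holomorphic branch on $\Omega_I$ vanishing at $t=0$. Moreover, $D_I$ is real-valued on $(-\rho_I^{-1},\infty)$.
   Context: Let $Z_{\mathbb H}$ be the determinantal point process on $\mathbb H=\{z\in\mathbb C:\operatorname{Im}z>0\}$ with correlation kernel $K_{\mathbb H}(z,w)=-\frac{1}{\pi(z-\overline w)^2}$ with respect to planar Lebesgue measure. Fix $I=[\alpha,\beta]$ with $0<\alpha<\beta<\infty$. For $L>0$ let $N_I(L)=\#\bigl(Z_{\mathbb H}\cap([0,L]\times I)\bigr)$, where $[0,L]\times I=\{x+\mathrm iy:0\le x\le L,\ \alpha\le y\le\beta\}$. Convention: $0^0=1$, so at $t=-1$ the expectation $\mathbb E(1+t)^{N_I(L)}$ equals $\mathbb P\{N_I(L)=0\}$. For $\xi>0$ put $q_I(\xi)=e^{-2\alpha\xi}-e^{-2\beta\xi}$, $\rho_I=\sup_{\xi>0}q_I(\xi)\in(0,1)$, and $\Omega_I=\mathbb C\setminus(-\infty,-\rho_I^{-1}]$. For $t\in\Omega_I$ define \[ \mathcal L_I(t)=\frac1{2\pi}\int_0^\infty\log\bigl(1+tq_I(\xi)\bigr)\,\mathrm d\xi,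 \] where for each $\xi$ the logarithm is the branch, holomorphic in $t\in\Omega_I$, that vanishes at $t=0$. *)

theory Defs
  imports "HOL-Probability.Probability" "Jordan_Normal_Form.Determinant"
begin

(* A simple point process on the region \<Lambda>: a random locally finite subset of \<Lambda>. *)
definition point_process :: "'b::euclidean_space set \<Rightarrow> 'a measure \<Rightarrow> ('a \<Rightarrow> 'b set) \<Rightarrow> bool" where
  "point_process \<Lambda> M Z \<longleftrightarrow>
     prob_space M \<and>
     (\<forall>\<omega>\<in>space M. Z \<omega> \<subseteq> \<Lambda>) \<and>
     (\<forall>\<omega>\<in>space M. \<forall>C. compact C \<and> C \<subseteq> \<Lambda> \<longrightarrow> finite (Z \<omega> \<inter> C)) \<and>
     (\<forall>B\<in>sets borel. (\<exists>C. compact C \<and> B \<subseteq> C \<and> C \<subseteq> \<Lambda>) \<longrightarrow>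
        (\<lambda>\<omega>. card (Z \<omega> \<inter> B)) \<in> measurable M (count_space UNIV))"

(* \<rho> is the density of the n-th factorial moment measure on \<Lambda>^n with respect to Lebesgue measure:
   the expected number of n-tuples of distinct points of Z lying in B is the integral of \<rho> over B.
   Points of \<Lambda>^n are functions on {..<n}. *)
definition correlation_function ::
  "'b::euclidean_space set \<Rightarrow> 'a measure \<Rightarrow> ('a \<Rightarrow> 'b set) \<Rightarrow> nat \<Rightarrow> ((nat \<Rightarrow> 'b) \<Rightarrow> real) \<Rightarrow> bool" where
  "correlation_function \<Lambda> M Z n \<rho> \<longleftrightarrow>
     (\<forall>x\<in>{..<n} \<rightarrow>\<^sub>E \<Lambda>. 0 \<le> \<rho> x) \<and>
     (\<forall>B\<in>sets (Pi\<^sub>M {..<n} (\<lambda>_. lborel)). B \<subseteq> {..<n} \<rightarrow>\<^sub>E \<Lambda> \<longrightarrow>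
        (\<integral>\<^sup>+\<omega>. emeasure (count_space UNIV) {x\<in>B. inj_on x {..<n} \<and> x ` {..<n} \<subseteq> Z \<omega>} \<partial>M)
        = (\<integral>\<^sup>+x\<in>B. ennreal (\<rho> x) \<partial>(Pi\<^sub>M {..<n} (\<lambda>_. lborel))))"

definition determinantal_process ::
  "'b::euclidean_space set \<Rightarrow> ('b \<Rightarrow> 'b \<Rightarrow> complex) \<Rightarrow> 'a measure \<Rightarrow> ('a \<Rightarrow> 'b set) \<Rightarrow> bool" where
  "determinantal_process \<Lambda> K M Z \<longleftrightarrow>
     point_process \<Lambda> M Z \<and>
     (\<forall>n. \<exists>\<rho>. correlation_function \<Lambda> M Z n \<rho> \<and>
        (\<forall>x\<in>{..<n} \<rightarrow>\<^sub>E \<Lambda>. complex_of_real (\<rho> x) = Determinant.det (mat n n (\<lambda>(i, j). K (x i) (x j)))))"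

definition upper_half_plane :: "complex set" where
  "upper_half_plane = {z. 0 < Im z}"

definition K_H :: "complex \<Rightarrow> complex \<Rightarrow> complex" where
  "K_H z w = - 1 / (complex_of_real pi * (z - cnj w)\<^sup>2)"

definition N_I :: "('a \<Rightarrow> complex set) \<Rightarrow> real \<Rightarrow> real \<Rightarrow> real \<Rightarrow> 'a \<Rightarrow> nat" where
  "N_I Z \<alpha> \<beta> L \<omega> = card (Z \<omega> \<inter> {z. 0 \<le> Re z \<and> Re z \<le> L \<and> \<alpha> \<le> Im z \<and> Im z \<le> \<beta>})"

(* The expectation of (1+t)^(N_I(L)); HOL's 0^0 = 1 is the convention wanted at t = -1. *)
definition gen_fun :: "'a measure \<Rightarrow> ('a \<Rightarrow> complex set) \<Rightarrow> real \<Rightarrow> real \<Rightarrow> real \<Rightarrow> complex \<Rightarrow> complex" where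
  "gen_fun M Z \<alpha> \<beta> L t = (\<integral>\<omega>. (1 + t) ^ N_I Z \<alpha> \<beta> L \<omega> \<partial>M)"

definition q_I :: "real \<Rightarrow> real \<Rightarrow> real \<Rightarrow> real" where
  "q_I \<alpha> \<beta> \<xi> = exp (- 2 * \<alpha> * \<xi>) - exp (- 2 * \<beta> * \<xi>)"

definition rho_I :: "real \<Rightarrow> real \<Rightarrow> real" where
  "rho_I \<alpha> \<beta> = (SUP \<xi>\<in>{0<..}. q_I \<alpha> \<beta> \<xi>)"

definition Omega_I :: "real \<Rightarrow> real \<Rightarrow> complex set" where
  "Omega_I \<alpha> \<beta> = - (complex_of_real ` {..- (1 / rho_I \<alpha> \<beta>)})"

definition is_log_branch :: "complex set \<Rightarrow> (complex \<Rightarrow> complex) \<Rightarrow> (complex \<Rightarrow> complex) \<Rightarrow> bool" where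
  "is_log_branch S f g \<longleftrightarrow> g holomorphic_on S \<and> g 0 = 0 \<and> (\<forall>z\<in>S. exp (g z) = f z)"

(* Meaningful only if a branch exists; its values on an open connected S containing 0 are then
   determined, see is_log_branch_unique. *)
definition log_branch :: "complex set \<Rightarrow> (complex \<Rightarrow> complex) \<Rightarrow> complex \<Rightarrow> complex" where
  "log_branch S f = (SOME g. is_log_branch S f g)"

definition L_I :: "real \<Rightarrow> real \<Rightarrow> complex \<Rightarrow> complex" where
  "L_I \<alpha> \<beta> t = 1 / (2 * complex_of_real pi) *
     (LINT \<xi>:{0<..}|lborel.
        log_branch (Omega_I \<alpha> \<beta>) (\<lambda>s. 1 + s * complex_of_real (q_I \<alpha> \<beta> \<xi>)) t)"

definition asymptotic_remainder ::
  "'a measure \<Rightarrow> ('a \<Rightarrow> complex set) \<Rightarrow> real \<Rightarrow> real \<Rightarrow> (complex \<Rightarrow> complex) \<Rightarrow> bool" where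
  "asymptotic_remainder M Z \<alpha> \<beta> D \<longleftrightarrow>
     (\<forall>t\<in>Omega_I \<alpha> \<beta>. \<exists>U. open U \<and> t \<in> U \<and> U \<subseteq> Omega_I \<alpha> \<beta> \<and>
        uniform_limit U
          (\<lambda>L s. log_branch (Omega_I \<alpha> \<beta>) (gen_fun M Z \<alpha> \<beta> L) s
                   - (complex_of_real L * L_I \<alpha> \<beta> s + D s))
          (\<lambda>_. 0) at_top)"

lemma is_log_branch_unique:
  assumes "open S" "connected S" "0 \<in> S" "is_log_branch S f g" "is_log_branch S f h" "z \<in> S"
  shows "g z = h z"
proof -
  have gh: "g holomorphic_on S" "h holomorphic_on S" "g 0 = 0" "h 0 = 0"
    and e: "exp (g w) = exp (h w)" if "w \<in> S" for w
    using assms that by (auto simp: is_log_branch_def)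
  note gh = gh[OF assms(3)]
  have "((\<lambda>w. g w - h w) has_field_derivative 0) (at w)" if w: "w \<in> S" for w
  proof -
    have dg: "(g has_field_derivative deriv g w) (at w)"
      and dh: "(h has_field_derivative deriv h w) (at w)"
      using gh assms(1) w holomorphic_derivI by blast+
    have "((\<lambda>w. exp (g w)) has_field_derivative exp (g w) * deriv g w) (at w)"
      using dg by (auto intro!: derivative_eq_intros)
    moreover have "((\<lambda>w. exp (h w)) has_field_derivative exp (h w) * deriv h w) (at w)"
      using dh by (auto intro!: derivative_eq_intros)
    then have "((\<lambda>w. exp (g w)) has_field_derivative exp (h w) * deriv h w) (at w)"
      by (rule has_field_derivative_transform_within_open[OF _ assms(1) w]) (simp add: e)
    ultimately have "exp (g w) * deriv g w = exp (h w) * deriv h w"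
      by (rule DERIV_unique)
    then have "deriv g w = deriv h w" using e[OF w] by simp
    then show ?thesis using DERIV_diff[OF dg dh] by simp
  qed
  then have "(\<lambda>w. g w - h w) constant_on S"
    by (intro has_field_derivative_0_imp_constant_on) (use assms in auto)
  then obtain c where "\<And>w. w \<in> S \<Longrightarrow> g w - h w = c"
    unfolding constant_on_def by blast
  from this[OF assms(3)] this[OF assms(6)] show ?thesis using gh by simp
qed

lemma is_log_branch_Ln:
  assumes "0 < q" "q \<le> rho_I \<alpha> \<beta>"
  shows "is_log_branch (Omega_I \<alpha> \<beta>) (\<lambda>s. 1 + s * complex_of_real q) (\<lambda>s. Ln (1 + s * complex_of_real q))"
proof -
  have *: "1 + s * complex_of_real q \<notin> \<real>\<^sub>\<le>\<^sub>0" if "s \<in> Omega_I \<alpha> \<beta>" for s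
  proof
    assume "1 + s * complex_of_real q \<in> \<real>\<^sub>\<le>\<^sub>0"
    then have h: "1 + Re s * q \<le> 0" "Im s = 0"
      using assms(1) by (auto simp: complex_nonpos_Reals_iff)
    then have "Re s \<le> - (1 / q)" using assms(1) by (simp add: field_simps)
    moreover have "1 / rho_I \<alpha> \<beta> \<le> 1 / q" using assms by (intro divide_left_mono) auto
    ultimately have "Re s \<in> {..- (1 / rho_I \<alpha> \<beta>)}" by simp
    moreover have "s = complex_of_real (Re s)" using h by (simp add: complex_eq_iff)
    ultimately show False using that unfolding Omega_I_def by blast
  qed
  have "1 + s * complex_of_real q \<noteq> 0" if "s \<in> Omega_I \<alpha> \<beta>" for s
    using *[OF that] by fastforce
  then show ?thesis
    unfolding is_log_branch_def using * by (auto intro!: holomorphic_intros)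
qed

end

theory Submission
  imports
    Defs
    "Jordan_Normal_Form.Spectral_Radius"
    "HOL-Complex_Analysis.Great_Picard"
begin

text \<open>
Write $R$ for the box $[0,L]\times I$. Expanding $(1+t)^{N}$ in binomial coefficients and inserting the
correlation functions gives the Fredholm series
$\mathbb E(1+t)^{N_I(L)} = \sum_n \frac{t^n}{n!}\int_{R^n}\det K(z_i,z_j)$. The kernel is a superposition of
plane waves, $K(z,w)=\frac1\pi\int_0^\infty \xi\,e^{i\xi(z-\overline w)}\,d\xi$. Replacing this integral by a
Riemann sum with equally spaced nodes $\xi_j$ gives a kernel of finite rank, whose Fredholm series is
$\det(1+tG)$ for the Gram matrix $G$ of the plane waves on $R$ (\<open>integral_kernel_det\<close>,
\<open>product_tendsto_generating_function\<close>). All estimates are made for these matrices, uniformly in the mesh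
$\delta$; Montel's theorem carries them to the limit $\delta\to0$.

The nodes being equally spaced, all the waves have the period $2\pi/\delta$ in the horizontal direction, and
over a full period their Gram matrix is diagonal with entries $q_I(\xi_j)$. As soon as $L\le 2\pi/\delta$ this
gives $0\le G\le \mathrm{diag}(q_I(\xi_j))$ (\<open>gram_contraction\<close>), with two consequences. First, the
eigenvalues $\lambda_a$ of $G$ lie in $[0,\rho_I]$, so $\sum_a\log(1+t\lambda_a)$ is holomorphic on $\Omega_I$,
and its limit is a logarithm of the generating function; in particular the latter has no zeros. Second, each
$\lambda_a$ is a mean of the values $q_I(\xi_j)$ and $0$, with weights that add up to $s=L\delta/2\pi$ at every
node. A second-order Taylor expansion of $f(x)=\log(1+tx)$ at $\lambda_a$ then compares
$\sum_a f(\lambda_a)$ with $s\sum_j f(q_I(\xi_j))$, the Riemann sum of $L\,\mathcal L_I(t)$, up to a multiple of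
$s\sum_j q_I(\xi_j)^2-\mathrm{tr}\,G^2$ (\<open>compressed_symbol.berezin\<close>; this is Berezin's inequality with a
remainder). That last quantity has an explicit limit, which is bounded in $L$ because $|K|^2$ decays like the
inverse fourth power of the distance (\<open>variance_limit\<close>). Hence
$\log\mathbb E(1+t)^{N_I(L)}-L\,\mathcal L_I(t)$ is bounded on compact subsets of $\Omega_I$ uniformly in $L$
(\<open>finite_volume_branch\<close>).

By Vitali's theorem (\<open>vitali_at_top\<close>) it remains to find the limit $L\to\infty$ for real $t>0$. The Gram
matrix is additive in the interval $[0,L]$ and, up to conjugation by a unitary matrix, invariant under
translation of the interval; and $\det(M+A+B)\det M\le\det(M+A)\det(M+B)$ for positive matrices
(\<open>det_log_submodular\<close>). Therefore the increments of $L\mapsto\log\mathbb E(1+t)^{N_I(L)}$ over a step of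
fixed length do not increase with $L$. Subtracting the linear term $L\,\mathcal L_I(t)$ keeps this property and
leaves a bounded function, which must then be nondecreasing and so converges. The limit is $D_I$; it is real on
the real part of $\Omega_I$ because every function in the construction is.
\<close>

section \<open>The spectral theorem for Hermitian matrices\<close>

text \<open>
The sizes of the matrices below tend to infinity inside one statement, so matrices and vectors are functions on
the natural numbers of which only the entries with indices below \<open>n\<close> matter.
\<close>

definition mat_vec :: "nat \<Rightarrow> (nat \<Rightarrow> nat \<Rightarrow> complex) \<Rightarrow> (nat \<Rightarrow> complex) \<Rightarrow> nat \<Rightarrow> complex" where
  "mat_vec n A x = (\<lambda>i. \<Sum>k<n. A i k * x k)"

definition herm_ip :: "nat \<Rightarrow> (nat \<Rightarrow> complex) \<Rightarrow> (nat \<Rightarrow> complex) \<Rightarrow> complex" where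
  "herm_ip n x y = (\<Sum>k<n. x k * cnj (y k))"

definition hermitian_on :: "nat \<Rightarrow> (nat \<Rightarrow> nat \<Rightarrow> complex) \<Rightarrow> bool" where
  "hermitian_on n A \<longleftrightarrow> (\<forall>i<n. \<forall>j<n. A j i = cnj (A i j))"

definition eigenbasis ::
  "nat \<Rightarrow> (nat \<Rightarrow> nat \<Rightarrow> complex) \<Rightarrow> (nat \<Rightarrow> nat \<Rightarrow> complex) \<Rightarrow> (nat \<Rightarrow> real) \<Rightarrow> bool" where
  "eigenbasis n A u l \<longleftrightarrow>
     (\<forall>a<n. \<forall>b<n. herm_ip n (u a) (u b) = (if a = b then 1 else 0)) \<and>
     (\<forall>a<n. \<forall>i<n. mat_vec n A (u a) i = complex_of_real (l a) * u a i)"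

lemma mat_vec_cong: "(\<And>k. k < n \<Longrightarrow> x k = y k) \<Longrightarrow> mat_vec n A x = mat_vec n A y"
  unfolding mat_vec_def by (intro ext sum.cong) auto

lemma herm_ip_cong:
  "(\<And>k. k < n \<Longrightarrow> x k = x' k) \<Longrightarrow> (\<And>k. k < n \<Longrightarrow> y k = y' k) \<Longrightarrow> herm_ip n x y = herm_ip n x' y'"
  unfolding herm_ip_def by (intro sum.cong) auto

lemma herm_ip_cnj: "cnj (herm_ip n x y) = herm_ip n y x"
  unfolding herm_ip_def by (simp add: mult.commute)

lemma herm_ip_self: "herm_ip n x x = complex_of_real (\<Sum>k<n. (cmod (x k))\<^sup>2)"
  unfolding herm_ip_def of_real_sum by (intro sum.cong) (simp_all add: complex_norm_square[symmetric])

lemma herm_ip_scale_left: "herm_ip n (\<lambda>i. c * x i) y = c * herm_ip n x y"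
  unfolding herm_ip_def by (simp add: sum_distrib_left mult.assoc)

lemma herm_ip_scale_right: "herm_ip n x (\<lambda>i. c * y i) = cnj c * herm_ip n x y"
  unfolding herm_ip_def by (simp add: sum_distrib_left mult_ac)

lemma herm_ip_diff_left: "herm_ip n (\<lambda>i. x i - y i) z = herm_ip n x z - herm_ip n y z"
  unfolding herm_ip_def by (simp add: sum_subtractf algebra_simps)

lemma herm_ip_diff_right: "herm_ip n z (\<lambda>i. x i - y i) = herm_ip n z x - herm_ip n z y"
  unfolding herm_ip_def by (simp add: sum_subtractf algebra_simps)

lemma mat_vec_mat_vec: "mat_vec n A (mat_vec n B x) = mat_vec n (\<lambda>i j. \<Sum>k<n. A i k * B k j) x"
proof
  fix i
  have "mat_vec n A (mat_vec n B x) i = (\<Sum>k<n. \<Sum>j<n. A i k * B k j * x j)"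
    unfolding mat_vec_def by (simp add: sum_distrib_left mult.assoc)
  also have "\<dots> = (\<Sum>j<n. \<Sum>k<n. A i k * B k j * x j)" by (rule sum.swap)
  also have "\<dots> = mat_vec n (\<lambda>i j. \<Sum>k<n. A i k * B k j) x i"
    unfolding mat_vec_def by (simp add: sum_distrib_right)
  finally show "mat_vec n A (mat_vec n B x) i = mat_vec n (\<lambda>i j. \<Sum>k<n. A i k * B k j) x i" .
qed

lemma mat_vec_scale: "mat_vec n A (\<lambda>i. c * x i) = (\<lambda>i. c * mat_vec n A x i)"
  unfolding mat_vec_def by (simp add: sum_distrib_left mult_ac)

lemma hermitian_onD: "hermitian_on n A \<Longrightarrow> i < n \<Longrightarrow> j < n \<Longrightarrow> cnj (A i j) = A j i"
  unfolding hermitian_on_def by metis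

lemma herm_ip_mat_vec_hermitian:
  assumes "hermitian_on n A"
  shows "herm_ip n (mat_vec n A x) y = herm_ip n x (mat_vec n A y)"
proof -
  have "herm_ip n (mat_vec n A x) y = (\<Sum>i<n. \<Sum>k<n. A i k * x k * cnj (y i))"
    unfolding herm_ip_def mat_vec_def by (simp add: sum_distrib_right)
  also have "\<dots> = (\<Sum>k<n. \<Sum>i<n. A i k * x k * cnj (y i))" by (rule sum.swap)
  also have "\<dots> = (\<Sum>k<n. \<Sum>i<n. x k * cnj (A k i * y i))"
    by (intro sum.cong) (auto simp: mult_ac hermitian_onD[OF assms])
  also have "\<dots> = herm_ip n x (mat_vec n A y)"
    unfolding herm_ip_def mat_vec_def by (simp add: sum_distrib_left)
  finally show ?thesis .
qed

text \<open>
The phase of the eigenvector is normalized so that its last entry is real and not positive: this is what makes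
the reflection that maps the last unit vector to the eigenvector well defined.
\<close>

lemma hermitian_eigenvector:
  assumes H: "hermitian_on (Suc n) A"
  obtains v :: "nat \<Rightarrow> complex" and l p :: real
  where "herm_ip (Suc n) v v = 1" "v n = - complex_of_real p" "p \<ge> 0"
    "\<And>i. i < Suc n \<Longrightarrow> mat_vec (Suc n) A v i = complex_of_real l * v i"
proof -
  let ?N = "Suc n"
  define M where "M = mat ?N ?N (\<lambda>(i,j). A i j)"
  have M: "M \<in> carrier_mat ?N ?N" unfolding M_def by auto
  have "spectrum M \<noteq> {}" using spectrum_non_empty[OF M] by simp
  then obtain e x where x: "eigenvector M x e" unfolding spectrum_def eigenvalue_def by auto
  then have xc: "x \<in> carrier_vec ?N" and x0: "x \<noteq> 0\<^sub>v ?N" and xe: "M *\<^sub>v x = e \<cdot>\<^sub>v x"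
    using M unfolding eigenvector_def by auto
  define y where "y = (\<lambda>i. vec_index x i)"
  have ye: "mat_vec ?N A y i = e * y i" if "i < ?N" for i
  proof -
    have "vec_index (M *\<^sub>v x) i = (\<Sum>k<?N. A i k * y k)"
      using that xc M unfolding M_def y_def
      by (simp add: scalar_prod_def lessThan_atLeast0)
    moreover have "vec_index (M *\<^sub>v x) i = e * y i" using xe that xc by (simp add: y_def)
    ultimately show ?thesis by (simp add: mat_vec_def)
  qed
  define r where "r = (\<Sum>k<?N. (cmod (y k))\<^sup>2)"
  have "\<exists>i<?N. y i \<noteq> 0"
  proof (rule ccontr)
    assume "\<not> ?thesis"
    then have "x = 0\<^sub>v ?N" using xc by (intro eq_vecI) (auto simp: y_def)
    then show False using x0 by simp
  qed
  then obtain i where "i < ?N" "y i \<noteq> 0" by blast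
  then have r: "r > 0" unfolding r_def by (intro sum_pos2[of _ i]) auto
  have ipy: "herm_ip ?N y y = complex_of_real r" unfolding r_def by (rule herm_ip_self)
  have "e * complex_of_real r = herm_ip ?N (mat_vec ?N A y) y"
    using herm_ip_cong[of ?N "mat_vec ?N A y" "\<lambda>i. e * y i" y y] ye by (simp add: herm_ip_scale_left ipy)
  also have "\<dots> = herm_ip ?N y (mat_vec ?N A y)" by (rule herm_ip_mat_vec_hermitian[OF H])
  also have "\<dots> = cnj e * complex_of_real r"
    using herm_ip_cong[of ?N y y "mat_vec ?N A y" "\<lambda>i. e * y i"] ye by (simp add: herm_ip_scale_right ipy)
  finally have "e = cnj e" using r by simp
  then obtain l where l: "e = complex_of_real l"
    by (metis Reals_cnj_iff Reals_cases)
  \<comment> \<open>the phase that turns the last entry into minus its modulus\<close>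
  define ph where "ph = (if y n = 0 then 1 else - cnj (y n) / cmod (y n))"
  have ph: "cmod ph = 1" unfolding ph_def by (auto simp: norm_divide)
  define c where "c = ph / complex_of_real (sqrt r)"
  have cc: "c * cnj c = 1 / complex_of_real r"
  proof -
    have "c * cnj c = (ph * cnj ph) / (complex_of_real (sqrt r) * complex_of_real (sqrt r))"
      unfolding c_def by simp
    also have "ph * cnj ph = 1" using ph by (simp add: complex_norm_square[symmetric])
    also have "complex_of_real (sqrt r) * complex_of_real (sqrt r) = complex_of_real r"
      unfolding of_real_mult[symmetric] using r by simp
    finally show ?thesis .
  qed
  show ?thesis
  proof (rule that[of "\<lambda>i. c * y i" "cmod (y n) / sqrt r" l])
    have "herm_ip ?N (\<lambda>i. c * y i) (\<lambda>i. c * y i) = (c * cnj c) * herm_ip ?N y y"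
      by (simp add: herm_ip_scale_left herm_ip_scale_right)
    then show "herm_ip ?N (\<lambda>i. c * y i) (\<lambda>i. c * y i) = 1" using r by (simp add: ipy cc)
    have "y n * cnj (y n) = complex_of_real (cmod (y n)) * complex_of_real (cmod (y n))"
      using complex_norm_square[of "y n"] by (simp add: power2_eq_square)
    then show "c * y n = - complex_of_real (cmod (y n) / sqrt r)"
      unfolding c_def ph_def by (auto simp: field_simps)
    show "0 \<le> cmod (y n) / sqrt r" using r by simp
    fix i assume i: "i < ?N"
    show "mat_vec ?N A (\<lambda>i. c * y i) i = complex_of_real l * (c * y i)"
      unfolding mat_vec_scale using ye[OF i] l by simp
  qed
qed

text \<open>
Induction on the size by deflation: with \<open>v\<close> a unit eigenvector, conjugation by the Householder reflection
\<open>W\<close> that exchanges \<open>v\<close> with the last unit vector splits off the last row and column.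
\<close>

theorem hermitian_spectral:
  "hermitian_on n A \<Longrightarrow> \<exists>u l. eigenbasis n A u l"
proof (induction n arbitrary: A)
  case 0
  then show ?case by (auto simp: eigenbasis_def)
next
  case (Suc n)
  let ?N = "Suc n"
  note H = \<open>hermitian_on ?N A\<close>
  obtain v :: "nat \<Rightarrow> complex" and l p :: real
    where vv: "herm_ip ?N v v = 1" and vn: "v n = - complex_of_real p" and p: "p \<ge> 0"
      and vl: "\<And>i. i < ?N \<Longrightarrow> mat_vec ?N A v i = complex_of_real l * v i"
    using hermitian_eigenvector[OF H] by metis
  \<comment> \<open>\<open>W\<close> is the reflection along \<open>w\<close>, whose squared norm is twice \<open>d\<close>; as \<open>p\<close> is not negative, \<open>d\<close> is nonzero\<close>
  define d where "d = complex_of_real (1 + p)"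
  have d: "d \<noteq> 0" "cnj d = d" using p unfolding d_def by (auto simp del: of_real_add)
  define w where "w = (\<lambda>i. (if i = n then 1 else 0) - v i)"
  define W where "W = (\<lambda>i j. (if i = j then 1 else 0) - w i * cnj (w j) / d)"
  have ww: "herm_ip ?N w w = 2 * d"
  proof -
    have e: "herm_ip ?N (\<lambda>i. if i = n then 1 else 0) x = cnj (x n)" for x :: "nat \<Rightarrow> complex"
      unfolding herm_ip_def by (simp add: if_distrib[of "\<lambda>x. x * _"] cong: if_cong)
    have e': "herm_ip ?N x (\<lambda>i. if i = n then 1 else 0) = x n" for x :: "nat \<Rightarrow> complex"
      using e[of x] herm_ip_cnj[of ?N x "\<lambda>i. if i = n then 1 else 0"] by (metis complex_cnj_cnj)
    show ?thesis unfolding w_def herm_ip_diff_left herm_ip_diff_right e e' vv vn d_def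
      by simp
  qed
  have mvW: "mat_vec ?N W x i = x i - w i * herm_ip ?N x w / d" if "i < ?N" for x i
  proof -
    have "mat_vec ?N W x i = (\<Sum>k<?N. (if i = k then x k else 0)) - (\<Sum>k<?N. w i * (x k * cnj (w k)) / d)"
      unfolding mat_vec_def W_def sum_subtractf[symmetric]
      by (intro sum.cong) (auto simp: algebra_simps)
    moreover have "(\<Sum>k<?N. (if i = k then x k else 0)) = x i"
      using that by (simp del: sum.lessThan_Suc)
    ultimately show ?thesis unfolding herm_ip_def
      by (simp add: sum_distrib_left sum_divide_distrib del: sum.lessThan_Suc)
  qed
  have HW: "hermitian_on ?N W" unfolding hermitian_on_def W_def using d(2) by (auto simp: mult_ac)
  have WW: "mat_vec ?N W (mat_vec ?N W x) i = x i" if i: "i < ?N" for x i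
  proof -
    have "herm_ip ?N (mat_vec ?N W x) w = herm_ip ?N (\<lambda>i. x i - (herm_ip ?N x w / d) * w i) w"
      by (intro herm_ip_cong) (auto simp: mvW)
    also have "\<dots> = - herm_ip ?N x w"
      unfolding herm_ip_diff_left herm_ip_scale_left ww using d by simp
    finally show ?thesis using i by (simp add: mvW)
  qed
  have Wn: "W i n = v i" if "i < ?N" for i
  proof -
    have "cnj (w n) = d" unfolding w_def d_def vn by simp
    then show ?thesis using d unfolding W_def by (simp add: w_def)
  qed
  define B where "B = (\<lambda>i j. \<Sum>k<?N. W i k * (\<Sum>l<?N. A k l * W l j))"
  have Bmv: "mat_vec ?N W (mat_vec ?N A (mat_vec ?N W x)) = mat_vec ?N B x" for x
    unfolding mat_vec_mat_vec B_def ..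
  have HB: "hermitian_on ?N B"
    unfolding hermitian_on_def
  proof safe
    fix i j assume ij: "i < ?N" "j < ?N"
    have cW: "cnj (W k l) = W l k" and cA: "cnj (A k l) = A l k" if "k < ?N" "l < ?N" for k l
      using hermitian_onD[OF HW] hermitian_onD[OF H] that by auto
    have "cnj (B i j) = (\<Sum>k<?N. \<Sum>l<?N. cnj (W i k) * cnj (A k l) * cnj (W l j))"
      unfolding B_def by (simp add: sum_distrib_left mult.assoc del: sum.lessThan_Suc)
    also have "\<dots> = (\<Sum>k<?N. \<Sum>l<?N. W j l * (A l k * W k i))"
    proof (intro sum.cong refl)
      fix k l assume "k \<in> {..<?N}" "l \<in> {..<?N}"
      then have "k < ?N" "l < ?N" by auto
      then show "cnj (W i k) * cnj (A k l) * cnj (W l j) = W j l * (A l k * W k i)"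
        using cW[OF ij(1), of k] cA[of k l] cW[of l j] ij(2) by (simp only: mult_ac)
    qed
    also have "\<dots> = (\<Sum>l<?N. \<Sum>k<?N. W j l * (A l k * W k i))" by (rule sum.swap)
    also have "\<dots> = B j i" unfolding B_def by (simp add: sum_distrib_left del: sum.lessThan_Suc)
    finally show "B j i = cnj (B i j)" ..
  qed
  then have "hermitian_on n B" unfolding hermitian_on_def by (blast intro: less_SucI)
  from Suc.IH[OF this] obtain u' l' where "eigenbasis n B u' l'" by blast
  then have uo: "\<And>a b. a < n \<Longrightarrow> b < n \<Longrightarrow> herm_ip n (u' a) (u' b) = (if a = b then 1 else 0)" and
    ue: "\<And>a i. a < n \<Longrightarrow> i < n \<Longrightarrow> mat_vec n B (u' a) i = complex_of_real (l' a) * u' a i"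
    unfolding eigenbasis_def by blast+
  define x where "x = (\<lambda>a i. if i < n then u' a i else 0 :: complex)"
  define en where "en = (\<lambda>i. if i = n then 1 else 0 :: complex)"
  have v_en: "mat_vec ?N W en i = v i" if "i < ?N" for i
    unfolding mat_vec_def en_def using Wn[OF that]
    by (simp add: if_distrib[of "\<lambda>x. _ * x"] cong: if_cong)
  define u where "u = (\<lambda>a. if a < n then mat_vec ?N W (x a) else v)"
  define y where "y = (\<lambda>a. if a < n then x a else en)"
  have u_y: "u a i = mat_vec ?N W (y a) i" if "i < ?N" for a i
    unfolding u_def y_def using v_en[OF that] by auto
  have x_herm_ip: "herm_ip ?N (x a) (x b) = herm_ip n (u' a) (u' b)" for a b
    unfolding herm_ip_def x_def by (auto intro!: sum.cong)
  have y_o: "herm_ip ?N (y a) (y b) = (if a = b then 1 else 0)" if "a < ?N" "b < ?N" for a b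
  proof -
    have "herm_ip ?N (x a) en = 0" "herm_ip ?N en (x b) = 0" "herm_ip ?N en en = 1" for a b
      unfolding herm_ip_def x_def en_def by (auto intro!: sum.neutral)
    then show ?thesis using that x_herm_ip uo unfolding y_def by (auto simp: less_Suc_eq)
  qed
  have u_o: "herm_ip ?N (u a) (u b) = (if a = b then 1 else 0)" if "a < ?N" "b < ?N" for a b
  proof -
    have "herm_ip ?N (u a) (u b) = herm_ip ?N (mat_vec ?N W (y a)) (mat_vec ?N W (y b))"
      by (intro herm_ip_cong) (auto simp: u_y)
    also have "\<dots> = herm_ip ?N (y a) (mat_vec ?N W (mat_vec ?N W (y b)))" by (rule herm_ip_mat_vec_hermitian[OF HW])
    also have "\<dots> = herm_ip ?N (y a) (y b)" by (intro herm_ip_cong) (auto simp: WW)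
    finally show ?thesis using y_o[OF that] by simp
  qed
  have Ben: "mat_vec ?N B en i = complex_of_real l * en i" if "i < ?N" for i
  proof -
    have "mat_vec ?N B en i = mat_vec ?N W (mat_vec ?N A (mat_vec ?N W en)) i" unfolding Bmv ..
    also have "mat_vec ?N A (mat_vec ?N W en) = mat_vec ?N A v" by (intro mat_vec_cong) (simp add: v_en)
    also have "mat_vec ?N W (mat_vec ?N A v) = mat_vec ?N W (\<lambda>i. complex_of_real l * v i)"
      by (intro mat_vec_cong) (simp add: vl)
    also have "\<dots> = (\<lambda>i. complex_of_real l * mat_vec ?N W v i)" by (rule mat_vec_scale)
    also have "mat_vec ?N W v = mat_vec ?N W (mat_vec ?N W en)" by (intro mat_vec_cong) (simp add: v_en)
    finally show ?thesis using WW[OF that] by simp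
  qed
  define lam where "lam = (\<lambda>a. if a < n then l' a else l)"
  have By: "mat_vec ?N B (y a) i = complex_of_real (lam a) * y a i" if a: "a < ?N" and i: "i < ?N" for a i
  proof (cases "a < n")
    case False
    then show ?thesis using Ben[OF i] by (simp add: y_def lam_def)
  next
    case True
    have Bx: "mat_vec ?N B (x a) i = mat_vec n B (u' a) i"
      unfolding mat_vec_def x_def by (auto intro!: sum.cong)
    show ?thesis
    proof (cases "i < n")
      case True
      then show ?thesis using \<open>a < n\<close> ue Bx by (simp add: y_def lam_def x_def)
    next
      case False
      then have [simp]: "i = n" using i by simp
      \<comment> \<open>the last unit vector is an eigenvector of \<open>B\<close>, so the last column and row vanish off the diagonal\<close>
      have bn: "B n k = 0" if "k < n" for k
      proof -
        have "mat_vec ?N B en k = B k n"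
          unfolding mat_vec_def en_def by (simp add: if_distrib[of "\<lambda>x. _ * x"] cong: if_cong)
        then have "B k n = 0" using Ben[of k] that by (simp add: en_def)
        moreover have "B n k = cnj (B k n)"
          using HB that less_SucI[OF that] lessI[of n] unfolding hermitian_on_def by blast
        ultimately show ?thesis by simp
      qed
      have "mat_vec n B (u' a) n = 0" unfolding mat_vec_def using bn by (intro sum.neutral) auto
      then show ?thesis using \<open>a < n\<close> Bx by (simp add: y_def lam_def x_def)
    qed
  qed
  have "mat_vec ?N A (u a) i = complex_of_real (lam a) * u a i" if a: "a < ?N" and i: "i < ?N" for a i
  proof -
    have e: "mat_vec ?N A (u a) = mat_vec ?N A (mat_vec ?N W (y a))" by (intro mat_vec_cong) (simp add: u_y)
    have "mat_vec ?N A (mat_vec ?N W (y a)) i = mat_vec ?N W (mat_vec ?N W (mat_vec ?N A (mat_vec ?N W (y a)))) i"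
      using WW[OF i] by simp
    also have "mat_vec ?N W (mat_vec ?N A (mat_vec ?N W (y a))) = mat_vec ?N B (y a)" by (rule Bmv)
    also have "mat_vec ?N W (mat_vec ?N B (y a)) = mat_vec ?N W (\<lambda>i. complex_of_real (lam a) * y a i)"
      by (intro mat_vec_cong) (simp add: By[OF a])
    finally show ?thesis unfolding e u_y[OF i] mat_vec_scale .
  qed
  then have "eigenbasis ?N A u lam" unfolding eigenbasis_def using u_o by blast
  then show ?case by blast
qed

text \<open>
A square matrix with orthonormal rows has orthonormal columns, since a left inverse is a right inverse.
\<close>

lemma eigenbasis_columns:
  assumes "eigenbasis n A u l" "i < n" "j < n"
  shows "(\<Sum>a<n. u a i * cnj (u a j)) = (if i = j then 1 else 0)"
proof -
  define U where "U = mat n n (\<lambda>(a,k). u a k)"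
  define V where "V = mat n n (\<lambda>(k,a). cnj (u a k))"
  have c: "U \<in> carrier_mat n n" "V \<in> carrier_mat n n" unfolding U_def V_def by auto
  have "U * V = 1\<^sub>m n"
  proof (rule eq_matI)
    fix a b assume "a < dim_row (1\<^sub>m n)" "b < dim_col (1\<^sub>m n)"
    then have ab: "a < n" "b < n" by auto
    then have "(U * V) $$ (a,b) = herm_ip n (u a) (u b)"
      unfolding U_def V_def herm_ip_def by (simp add: scalar_prod_def lessThan_atLeast0)
    then show "(U * V) $$ (a,b) = 1\<^sub>m n $$ (a,b)"
      using assms(1) ab unfolding eigenbasis_def by simp
  qed (use c in auto)
  then have "V * U = 1\<^sub>m n" using mat_mult_left_right_inverse[OF c] by blast
  moreover have "(V * U) $$ (j,i) = (\<Sum>a<n. u a i * cnj (u a j))"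
    using assms unfolding U_def V_def by (simp add: scalar_prod_def lessThan_atLeast0 mult.commute)
  ultimately show ?thesis using assms by auto
qed

lemma eigenbasis_expansion:
  assumes "eigenbasis n A u l" "i < n" "j < n"
  shows "A i j = (\<Sum>a<n. complex_of_real (l a) * u a i * cnj (u a j))"
proof -
  have "A i j = (\<Sum>k<n. A i k * (\<Sum>a<n. u a k * cnj (u a j)))"
  proof -
    have "(\<Sum>k<n. A i k * (\<Sum>a<n. u a k * cnj (u a j))) = (\<Sum>k<n. if k = j then A i k else 0)"
      using eigenbasis_columns[OF assms(1) _ assms(3)] by (intro sum.cong) auto
    then show ?thesis using assms by simp
  qed
  also have "\<dots> = (\<Sum>k<n. \<Sum>a<n. A i k * u a k * cnj (u a j))"
    by (simp add: sum_distrib_left mult.assoc)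
  also have "\<dots> = (\<Sum>a<n. \<Sum>k<n. A i k * u a k * cnj (u a j))" by (rule sum.swap)
  also have "\<dots> = (\<Sum>a<n. mat_vec n A (u a) i * cnj (u a j))"
    unfolding mat_vec_def by (simp add: sum_distrib_right)
  also have "\<dots> = (\<Sum>a<n. complex_of_real (l a) * u a i * cnj (u a j))"
    using assms unfolding eigenbasis_def by (intro sum.cong) auto
  finally show ?thesis .
qed

lemma eigenbasis_mat_vec:
  assumes "eigenbasis n A u l" "a < n"
  shows "herm_ip n (mat_vec n A (u a)) x = complex_of_real (l a) * herm_ip n (u a) x"
proof -
  have "herm_ip n (mat_vec n A (u a)) x = herm_ip n (\<lambda>i. complex_of_real (l a) * u a i) x"
    using assms unfolding eigenbasis_def by (intro herm_ip_cong) auto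
  then show ?thesis by (simp add: herm_ip_scale_left)
qed

lemma eigenbasis_herm_ip: "eigenbasis n A u l \<Longrightarrow> a < n \<Longrightarrow> b < n \<Longrightarrow> herm_ip n (u a) (u b) = (if a = b then 1 else 0)"
  unfolding eigenbasis_def by blast

lemma eigenbasis_norm:
  assumes "eigenbasis n A u l" "a < n"
  shows "(\<Sum>k<n. (cmod (u a k))\<^sup>2) = 1"
  using eigenbasis_herm_ip[OF assms(1,2,2)] herm_ip_self[of n "u a"] by (simp flip: of_real_sum of_real_power)

lemma sum_eigenvalues_squared:
  assumes eb: "eigenbasis n G u l"
  shows "(\<Sum>k<n. \<Sum>j<n. (cmod (G k j))\<^sup>2) = (\<Sum>a<n. (l a)\<^sup>2)"
proof -
  have mvG: "mat_vec n G x i = (\<Sum>a<n. complex_of_real (l a) * u a i * herm_ip n x (u a))" if "i < n" for x i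
  proof -
    have "mat_vec n G x i = (\<Sum>k<n. \<Sum>a<n. complex_of_real (l a) * u a i * (x k * cnj (u a k)))"
      unfolding mat_vec_def using that
      by (intro sum.cong refl) (simp add: eigenbasis_expansion[OF eb that] sum_distrib_left sum_distrib_right mult_ac)
    also have "\<dots> = (\<Sum>a<n. \<Sum>k<n. complex_of_real (l a) * u a i * (x k * cnj (u a k)))"
      by (rule sum.swap)
    finally show ?thesis by (simp add: herm_ip_def sum_distrib_left)
  qed
  have "complex_of_real (\<Sum>k<n. \<Sum>j<n. (cmod (G k j))\<^sup>2) = (\<Sum>k<n. \<Sum>j<n. G k j * cnj (G k j))"
    by (simp add: complex_norm_square flip: of_real_power)
  also have "\<dots> = (\<Sum>k<n. mat_vec n G (\<lambda>j. cnj (G k j)) k)" by (simp add: mat_vec_def)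
  also have "\<dots> = (\<Sum>k<n. \<Sum>a<n. complex_of_real (l a) * u a k * cnj (mat_vec n G (u a) k))"
  proof (intro sum.cong refl)
    fix k assume "k \<in> {..<n}"
    moreover have "herm_ip n (\<lambda>j. cnj (G k j)) (u a) = cnj (mat_vec n G (u a) k)" for a
      by (simp add: herm_ip_def mat_vec_def)
    ultimately show "mat_vec n G (\<lambda>j. cnj (G k j)) k
        = (\<Sum>a<n. complex_of_real (l a) * u a k * cnj (mat_vec n G (u a) k))"
      using mvG[of k "\<lambda>j. cnj (G k j)"] by simp
  qed
  also have "\<dots> = (\<Sum>a<n. \<Sum>k<n. complex_of_real (l a) * u a k * cnj (mat_vec n G (u a) k))"
    by (rule sum.swap)
  also have "\<dots> = (\<Sum>a<n. complex_of_real ((l a)\<^sup>2))"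
  proof (intro sum.cong refl)
    fix a assume "a \<in> {..<n}"
    then have a: "a < n" by simp
    have "(\<Sum>k<n. complex_of_real (l a) * u a k * cnj (mat_vec n G (u a) k))
       = complex_of_real (l a) * cnj (herm_ip n (mat_vec n G (u a)) (u a))"
      by (simp add: herm_ip_def sum_distrib_left mult_ac)
    then show "(\<Sum>k<n. complex_of_real (l a) * u a k * cnj (mat_vec n G (u a) k)) = complex_of_real ((l a)\<^sup>2)"
      using eigenbasis_mat_vec[OF eb a, of "u a"] eigenbasis_herm_ip[OF eb a a] by (simp add: power2_eq_square)
  qed
  finally show ?thesis by (metis of_real_eq_iff of_real_sum)
qed

section \<open>Comparing a compression with its symbol\<close>

text \<open>
This axiomatizes the compression of a multiplication operator. If $G=\mathrm{diag}(\sqrt q)\,S\,\mathrm{diag}(\sqrt q)$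
with $0\le S\le 1$ and constant diagonal $s$ of $S$, then \<open>psd\<close> and \<open>contr\<close> are the two bounds on $S$ and
\<open>diag\<close> is its diagonal.
\<close>

locale compressed_symbol =
  fixes n :: nat and G :: "nat \<Rightarrow> nat \<Rightarrow> complex" and u :: "nat \<Rightarrow> nat \<Rightarrow> complex" and l q :: "nat \<Rightarrow> real"
    and s \<rho> :: real
  assumes H: "hermitian_on n G" and eb: "eigenbasis n G u l"
    and q: "\<And>k. k < n \<Longrightarrow> 0 < q k" "\<And>k. k < n \<Longrightarrow> q k \<le> \<rho>" and rho: "0 \<le> \<rho>"
    and diag: "\<And>k. k < n \<Longrightarrow> G k k = complex_of_real (s * q k)"
    and psd: "\<And>x. 0 \<le> Re (herm_ip n (mat_vec n G x) x)"
    and contr: "\<And>x. Re (herm_ip n (mat_vec n G x) x) \<le> (\<Sum>k<n. q k * (cmod (x k))\<^sup>2)"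
begin

text \<open>
The spectral measure, away from $0$, of the \<open>a\<close>-th eigenvector with respect to the uncompressed operator, which
acts as multiplication by \<open>q\<close>. Its mean is the eigenvalue (\<open>weight_mean\<close>).
\<close>

definition weight :: "nat \<Rightarrow> nat \<Rightarrow> real" where
  "weight a k = l a * (cmod (u a k))\<^sup>2 / q k"

lemma eigenvalue_nonneg: "a < n \<Longrightarrow> 0 \<le> l a"
  using psd[of "u a"] eigenbasis_mat_vec[OF eb, of a "u a"] eigenbasis_herm_ip[OF eb, of a a] by simp

lemma weight_nonneg: "a < n \<Longrightarrow> k < n \<Longrightarrow> 0 \<le> weight a k"
  unfolding weight_def using eigenvalue_nonneg[of a] q(1)[of k] by simp

lemma weight_mean:
  assumes "a < n" shows "(\<Sum>k<n. weight a k * q k) = l a"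
proof -
  have "(\<Sum>k<n. weight a k * q k) = (\<Sum>k<n. l a * (cmod (u a k))\<^sup>2)"
    using q(1) unfolding weight_def by (intro sum.cong) (auto simp: less_imp_neq[symmetric])
  then show ?thesis using eigenbasis_norm[OF eb assms] by (simp flip: sum_distrib_left)
qed

text \<open>
With $S$ as above and $y=\sqrt q\,u_a$, the total weight times the eigenvalue is $\|Sy\|^2$, and the eigenvalue is
$\langle Sy,y\rangle$; so the claim is $S^2\le S$. It follows from $0\le\langle S(y-Sy),y-Sy\rangle$ together with
$\langle S\,Sy,Sy\rangle\le\|Sy\|^2$. In the proof \<open>z\<close> is $Sy/\sqrt q$.
\<close>

lemma weight_mass_le_1:
  assumes a: "a < n" shows "(\<Sum>k<n. weight a k) \<le> 1"
proof (cases "l a = 0")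
  case True
  then show ?thesis by (simp add: weight_def)
next
  case False
  then have la: "l a > 0" using eigenvalue_nonneg[OF a] by simp
  define z where "z = (\<lambda>k. complex_of_real (l a / q k) * u a k)"
  define Z where "Z = (\<Sum>k<n. (l a)\<^sup>2 * (cmod (u a k))\<^sup>2 / q k)"
  have uz: "herm_ip n (u a) z = complex_of_real (\<Sum>k<n. l a * (cmod (u a k))\<^sup>2 / q k)"
    unfolding herm_ip_def z_def of_real_sum
    by (intro sum.cong refl) (simp add: complex_norm_square mult_ac flip: of_real_power)
  have 1: "herm_ip n (mat_vec n G (u a)) z = complex_of_real Z"
    unfolding eigenbasis_mat_vec[OF eb a] uz Z_def
    by (simp add: sum_distrib_left power2_eq_square mult_ac)
  have 2: "herm_ip n (mat_vec n G z) (u a) = complex_of_real Z"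
    using 1 herm_ip_mat_vec_hermitian[OF H, of z "u a"] herm_ip_cnj[of n "mat_vec n G (u a)" z] by simp
  have 3: "Re (herm_ip n (mat_vec n G z) z) \<le> Z"
  proof -
    have "(\<Sum>k<n. q k * (cmod (z k))\<^sup>2) = Z"
      unfolding Z_def z_def
    proof (intro sum.cong refl)
      fix k assume "k \<in> {..<n}"
      then have "q k > 0" using q(1) by simp
      then show "q k * (cmod (complex_of_real (l a / q k) * u a k))\<^sup>2 = (l a)\<^sup>2 * (cmod (u a k))\<^sup>2 / q k"
        by (simp add: norm_mult norm_divide power_mult_distrib power_divide power2_eq_square)
    qed
    then show ?thesis using contr[of z] by simp
  qed
  have mvd: "mat_vec n G (\<lambda>i. u a i - z i) = (\<lambda>i. mat_vec n G (u a) i - mat_vec n G z i)"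
    unfolding mat_vec_def by (simp add: sum_subtractf algebra_simps)
  have "herm_ip n (mat_vec n G (\<lambda>i. u a i - z i)) (\<lambda>i. u a i - z i)
      = complex_of_real (l a) - 2 * complex_of_real Z + herm_ip n (mat_vec n G z) z"
    unfolding mvd herm_ip_diff_left herm_ip_diff_right 1 2 using eigenbasis_mat_vec[OF eb a, of "u a"] eigenbasis_herm_ip[OF eb a a]
    by simp
  then have "0 \<le> l a - 2 * Z + Re (herm_ip n (mat_vec n G z) z)"
    using psd[of "\<lambda>i. u a i - z i"] by simp
  then have "Z \<le> l a" using 3 by simp
  moreover have "Z = l a * (\<Sum>k<n. weight a k)"
    unfolding Z_def weight_def by (simp add: sum_distrib_left power2_eq_square mult_ac)
  ultimately show ?thesis using la by simp
qed

lemma eigenvalue_le: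
  assumes a: "a < n" shows "l a \<le> \<rho>"
proof -
  have "l a \<le> (\<Sum>k<n. weight a k * \<rho>)"
    unfolding weight_mean[OF a, symmetric] using q weight_nonneg[OF a] by (intro sum_mono mult_left_mono) auto
  also have "\<dots> \<le> 1 * \<rho>" unfolding sum_distrib_right[symmetric] using weight_mass_le_1[OF a] rho by (rule mult_right_mono)
  finally show ?thesis by simp
qed

text \<open>
Completeness of the eigenvectors: summing over them recovers the constant diagonal \<open>s\<close>.
\<close>

lemma weight_total:
  assumes k: "k < n" shows "(\<Sum>a<n. weight a k) = s"
proof -
  have "complex_of_real (\<Sum>a<n. l a * (cmod (u a k))\<^sup>2) = G k k"
    unfolding eigenbasis_expansion[OF eb k k] of_real_sum
    by (intro sum.cong refl) (simp add: complex_norm_square mult_ac flip: of_real_power)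
  then have "(\<Sum>a<n. l a * (cmod (u a k))\<^sup>2) = s * q k" unfolding diag[OF k] by (metis of_real_eq_iff)
  then show ?thesis unfolding weight_def using q(1)[OF k] by (simp flip: sum_divide_distrib)
qed

lemma trace: "(\<Sum>a<n. l a) = s * (\<Sum>k<n. q k)"
proof -
  have "(\<Sum>a<n. l a) = (\<Sum>a<n. \<Sum>k<n. weight a k * q k)" by (simp add: weight_mean)
  also have "\<dots> = (\<Sum>k<n. \<Sum>a<n. weight a k * q k)" by (rule sum.swap)
  also have "\<dots> = (\<Sum>k<n. s * q k)" by (simp add: weight_total flip: sum_distrib_right)
  finally show ?thesis by (simp add: sum_distrib_left)
qed

text \<open>
Expand \<open>f\<close> at each eigenvalue $\lambda$ and average against its weights, the missing mass being placed at $0$,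
where \<open>f\<close> vanishes. The mean is $\lambda$, so the linear term drops out, and the quadratic term averages to the
second moment minus $\lambda^2$. Summing over the eigenvalues turns the second moments into $s\sum_k q_k^2$.
\<close>

lemma berezin:
  fixes f f' :: "real \<Rightarrow> complex"
  assumes f0: "f 0 = 0"
    and T: "\<And>x y. 0 \<le> x \<Longrightarrow> x \<le> \<rho> \<Longrightarrow> 0 \<le> y \<Longrightarrow> y \<le> \<rho> \<Longrightarrow>
              cmod (f x - f y - f' y * complex_of_real (x - y)) \<le> B * (x - y)\<^sup>2"
  shows "cmod ((\<Sum>a<n. f (l a)) - complex_of_real s * (\<Sum>k<n. f (q k)))
           \<le> B * (s * (\<Sum>k<n. (q k)\<^sup>2) - (\<Sum>a<n. (l a)\<^sup>2))"
proof -
  have each: "cmod (f (l a) - (\<Sum>k<n. complex_of_real (weight a k) * f (q k))) \<le> B * ((\<Sum>k<n. weight a k * (q k)\<^sup>2) - (l a)\<^sup>2)"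
    if a: "a < n" for a
  proof -
    define m where "m = (\<Sum>k<n. weight a k)"
    have m: "m \<le> 1" unfolding m_def by (rule weight_mass_le_1[OF a])
    have la: "0 \<le> l a" "l a \<le> \<rho>" using eigenvalue_nonneg eigenvalue_le a by auto
    define R where "R = (\<lambda>x. f x - f (l a) - f' (l a) * complex_of_real (x - l a))"
    have RB: "cmod (R x) \<le> B * (x - l a)\<^sup>2" if "0 \<le> x" "x \<le> \<rho>" for x
      unfolding R_def using T that la by auto
    have mean: "(\<Sum>k<n. complex_of_real (weight a k) * complex_of_real (q k)) = complex_of_real (l a)"
      using weight_mean[OF a] by (simp flip: of_real_mult of_real_sum)
    have mc: "(\<Sum>k<n. complex_of_real (weight a k)) = complex_of_real m" by (simp add: m_def)
    have "(\<Sum>k<n. complex_of_real (weight a k) * R (q k))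
      = (\<Sum>k<n. complex_of_real (weight a k) * f (q k)) - complex_of_real m * f (l a)
        - f' (l a) * (complex_of_real (l a) - complex_of_real m * complex_of_real (l a))"
    proof -
      have "(\<Sum>k<n. complex_of_real (weight a k) * R (q k))
        = (\<Sum>k<n. complex_of_real (weight a k) * f (q k) - complex_of_real (weight a k) * f (l a)
            - f' (l a) * (complex_of_real (weight a k) * complex_of_real (q k)
              - complex_of_real (weight a k) * complex_of_real (l a)))"
        unfolding R_def by (intro sum.cong) (auto simp: algebra_simps)
      then show ?thesis
        by (simp only: sum_subtractf sum_distrib_left[symmetric] sum_distrib_right[symmetric] mean mc)
    qed
    then have eq: "f (l a) - (\<Sum>k<n. complex_of_real (weight a k) * f (q k))
        = - ((\<Sum>k<n. complex_of_real (weight a k) * R (q k)) + complex_of_real (1 - m) * R 0)"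
      unfolding R_def f0 by (simp add: algebra_simps)
    have "cmod (f (l a) - (\<Sum>k<n. complex_of_real (weight a k) * f (q k)))
        \<le> cmod (\<Sum>k<n. complex_of_real (weight a k) * R (q k)) + cmod (complex_of_real (1 - m) * R 0)"
      unfolding eq norm_minus_cancel by (rule norm_triangle_ineq)
    also have "\<dots> \<le> (\<Sum>k<n. weight a k * (B * (q k - l a)\<^sup>2)) + (1 - m) * (B * (0 - l a)\<^sup>2)"
    proof (intro add_mono)
      show "cmod (\<Sum>k<n. complex_of_real (weight a k) * R (q k)) \<le> (\<Sum>k<n. weight a k * (B * (q k - l a)\<^sup>2))"
      proof (rule sum_norm_le)
        fix k assume "k \<in> {..<n}"
        then have k: "k < n" by simp
        show "cmod (complex_of_real (weight a k) * R (q k)) \<le> weight a k * (B * (q k - l a)\<^sup>2)"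
          using weight_nonneg[OF a k] RB[of "q k"] q[OF k] by (simp add: norm_mult mult_left_mono)
      qed
      show "cmod (complex_of_real (1 - m) * R 0) \<le> (1 - m) * (B * (0 - l a)\<^sup>2)"
        using RB[of 0] m rho unfolding norm_mult norm_of_real by (intro mult_mono) auto
    qed
    also have "\<dots> = B * ((\<Sum>k<n. weight a k * (q k)\<^sup>2) - 2 * l a * (\<Sum>k<n. weight a k * q k) + m * (l a)\<^sup>2 + (1 - m) * (l a)\<^sup>2)"
      unfolding m_def
      by (simp add: power2_diff algebra_simps sum.distrib sum_subtractf sum_distrib_left sum_distrib_right)
    also have "\<dots> = B * ((\<Sum>k<n. weight a k * (q k)\<^sup>2) - (l a)\<^sup>2)"
      unfolding weight_mean[OF a] by (simp add: algebra_simps power2_eq_square)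
    finally show ?thesis .
  qed
  have sw: "(\<Sum>a<n. \<Sum>k<n. complex_of_real (weight a k) * f (q k)) = complex_of_real s * (\<Sum>k<n. f (q k))"
  proof -
    have "(\<Sum>a<n. \<Sum>k<n. complex_of_real (weight a k) * f (q k)) = (\<Sum>k<n. \<Sum>a<n. complex_of_real (weight a k) * f (q k))"
      by (rule sum.swap)
    also have "\<dots> = (\<Sum>k<n. complex_of_real s * f (q k))"
      by (simp add: weight_total flip: sum_distrib_right of_real_sum)
    finally show ?thesis by (simp add: sum_distrib_left)
  qed
  have sw2: "(\<Sum>a<n. \<Sum>k<n. weight a k * (q k)\<^sup>2) = s * (\<Sum>k<n. (q k)\<^sup>2)"
  proof -
    have "(\<Sum>a<n. \<Sum>k<n. weight a k * (q k)\<^sup>2) = (\<Sum>k<n. \<Sum>a<n. weight a k * (q k)\<^sup>2)"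
      by (rule sum.swap)
    also have "\<dots> = (\<Sum>k<n. s * (q k)\<^sup>2)"
      by (simp add: weight_total flip: sum_distrib_right)
    finally show ?thesis by (simp add: sum_distrib_left)
  qed
  have "cmod ((\<Sum>a<n. f (l a)) - complex_of_real s * (\<Sum>k<n. f (q k)))
      = cmod (\<Sum>a<n. f (l a) - (\<Sum>k<n. complex_of_real (weight a k) * f (q k)))"
    unfolding sw[symmetric] by (simp add: sum_subtractf)
  also have "\<dots> \<le> (\<Sum>a<n. B * ((\<Sum>k<n. weight a k * (q k)\<^sup>2) - (l a)\<^sup>2))"
    by (rule sum_norm_le) (simp add: each)
  also have "\<dots> = B * (s * (\<Sum>k<n. (q k)\<^sup>2) - (\<Sum>a<n. (l a)\<^sup>2))"
    unfolding sw2[symmetric] by (simp add: sum_subtractf flip: sum_distrib_left)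
  finally show ?thesis .
qed

end

section \<open>Log-submodularity of determinants\<close>

definition to_mat :: "nat \<Rightarrow> (nat \<Rightarrow> nat \<Rightarrow> complex) \<Rightarrow> complex mat" where
  "to_mat n A = mat n n (\<lambda>(i,j). A i j)"

abbreviation fdet :: "nat \<Rightarrow> (nat \<Rightarrow> nat \<Rightarrow> complex) \<Rightarrow> complex" where
  "fdet n A \<equiv> Determinant.det (to_mat n A)"

text \<open>
The matrix $W^*AW$ whose columns of $W$ are the vectors \<open>w b\<close>.
\<close>

definition congruence :: "nat \<Rightarrow> (nat \<Rightarrow> nat \<Rightarrow> complex) \<Rightarrow> (nat \<Rightarrow> nat \<Rightarrow> complex) \<Rightarrow> nat \<Rightarrow> nat \<Rightarrow> complex" where
  "congruence n w A = (\<lambda>a b. herm_ip n (mat_vec n A (w b)) (w a))"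

definition lin_comb :: "nat \<Rightarrow> (nat \<Rightarrow> nat \<Rightarrow> complex) \<Rightarrow> (nat \<Rightarrow> complex) \<Rightarrow> nat \<Rightarrow> complex" where
  "lin_comb n w x = (\<lambda>k. \<Sum>b<n. x b * w b k)"

lemma to_mat_carrier [simp]: "to_mat n A \<in> carrier_mat n n"
  unfolding to_mat_def by simp

lemma to_mat_index: "i < n \<Longrightarrow> j < n \<Longrightarrow> to_mat n A $$ (i, j) = A i j"
  unfolding to_mat_def by simp

lemma to_mat_cong: "(\<And>i j. i < n \<Longrightarrow> j < n \<Longrightarrow> A i j = B i j) \<Longrightarrow> to_mat n A = to_mat n B"
  unfolding to_mat_def by (intro eq_matI) auto

lemma to_mat_mult: "to_mat n A * to_mat n B = to_mat n (\<lambda>i j. \<Sum>k<n. A i k * B k j)"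
  unfolding to_mat_def by (intro eq_matI) (auto simp: scalar_prod_def lessThan_atLeast0)

lemma mat_vec_add: "mat_vec n (\<lambda>i j. A i j + B i j) x = (\<lambda>i. mat_vec n A x i + mat_vec n B x i)"
  unfolding mat_vec_def by (simp add: algebra_simps sum.distrib)

lemma herm_ip_add_left: "herm_ip n (\<lambda>i. x i + y i) z = herm_ip n x z + herm_ip n y z"
  unfolding herm_ip_def by (simp add: sum.distrib algebra_simps)

lemma herm_ip_mat_vec_lin_comb:
  "herm_ip n (mat_vec n A (lin_comb n w x)) (lin_comb n w y) = herm_ip n (mat_vec n (congruence n w A) x) y"
proof -
  have mvlc: "mat_vec n A (lin_comb n w x) i = (\<Sum>b<n. x b * mat_vec n A (w b) i)" for i
  proof -
    have "mat_vec n A (lin_comb n w x) i = (\<Sum>k<n. \<Sum>b<n. x b * (A i k * w b k))"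
      unfolding mat_vec_def lin_comb_def by (simp add: sum_distrib_left mult_ac)
    also have "\<dots> = (\<Sum>b<n. \<Sum>k<n. x b * (A i k * w b k))" by (rule sum.swap)
    finally show ?thesis by (simp add: mat_vec_def sum_distrib_left)
  qed
  have ipl: "herm_ip n z (lin_comb n w y) = (\<Sum>a<n. cnj (y a) * herm_ip n z (w a))" for z
  proof -
    have "herm_ip n z (lin_comb n w y) = (\<Sum>k<n. \<Sum>a<n. cnj (y a) * (z k * cnj (w a k)))"
      unfolding herm_ip_def lin_comb_def by (simp add: sum_distrib_left mult_ac)
    also have "\<dots> = (\<Sum>a<n. \<Sum>k<n. cnj (y a) * (z k * cnj (w a k)))" by (rule sum.swap)
    finally show ?thesis by (simp add: herm_ip_def sum_distrib_left)
  qed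
  have ipl': "herm_ip n (mat_vec n A (lin_comb n w x)) z = (\<Sum>b<n. x b * herm_ip n (mat_vec n A (w b)) z)" for z
  proof -
    have "herm_ip n (mat_vec n A (lin_comb n w x)) z = (\<Sum>k<n. \<Sum>b<n. x b * (mat_vec n A (w b) k * cnj (z k)))"
      unfolding herm_ip_def mvlc by (simp add: sum_distrib_left sum_distrib_right mult_ac)
    also have "\<dots> = (\<Sum>b<n. \<Sum>k<n. x b * (mat_vec n A (w b) k * cnj (z k)))" by (rule sum.swap)
    finally show ?thesis by (simp add: herm_ip_def sum_distrib_left)
  qed
  have "herm_ip n (mat_vec n (congruence n w A) x) y = (\<Sum>a<n. (\<Sum>b<n. congruence n w A a b * x b) * cnj (y a))"
    by (subst herm_ip_def, subst mat_vec_def) (rule refl)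
  then show ?thesis unfolding ipl ipl' congruence_def
    by (simp add: sum_distrib_left sum_distrib_right mult_ac)
qed

lemma congruence_lin_comb: "congruence n (\<lambda>a. lin_comb n w (v a)) A = congruence n v (congruence n w A)"
  unfolding congruence_def[of n "\<lambda>a. lin_comb n w (v a)"] congruence_def[of n v] by (simp add: herm_ip_mat_vec_lin_comb)

lemma congruence_add: "congruence n w (\<lambda>i j. A i j + B i j) = (\<lambda>a b. congruence n w A a b + congruence n w B a b)"
  unfolding congruence_def by (simp add: mat_vec_add herm_ip_add_left)

lemma hermitian_congruence: 
  assumes "hermitian_on n A" shows "hermitian_on n (congruence n w A)"
  unfolding hermitian_on_def congruence_def
  using herm_ip_mat_vec_hermitian[OF assms] herm_ip_cnj by metis

lemma hermitian_add: "hermitian_on n A \<Longrightarrow> hermitian_on n B \<Longrightarrow> hermitian_on n (\<lambda>i j. A i j + B i j)"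
  unfolding hermitian_on_def by (metis complex_cnj_add)

lemma fdet_congruence: 
  "fdet n (congruence n w A) = fdet n (\<lambda>a k. cnj (w a k)) * fdet n (\<lambda>k b. w b k) * fdet n A"
proof -
  have "to_mat n (congruence n w A) = to_mat n (\<lambda>a k. cnj (w a k)) * (to_mat n A * to_mat n (\<lambda>k b. w b k))"
    unfolding to_mat_mult
    by (intro to_mat_cong) (simp add: congruence_def herm_ip_def mat_vec_def mult.commute)
  also have "Determinant.det \<dots> = fdet n (\<lambda>a k. cnj (w a k)) * (fdet n A * fdet n (\<lambda>k b. w b k))"
    by (simp add: det_mult[of _ n] mult_carrier_mat[of _ n n _ n])
  finally show ?thesis by (simp add: mult_ac)
qed

lemma fdet_diagonal: "fdet n (\<lambda>i j. if i = j then d i else 0) = (\<Prod>i<n. d i)"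
proof -
  have "fdet n (\<lambda>i j. if i = j then d i else 0) = prod_list (diag_mat (to_mat n (\<lambda>i j. if i = j then d i else 0)))"
    by (rule det_upper_triangular[of _ n]) (auto simp: to_mat_def upper_triangular_def)
  also have "\<dots> = (\<Prod>i<n. d i)"
    unfolding diag_mat_def to_mat_def
    by (simp add: prod.list_conv_set_nth lessThan_atLeast0)
  finally show ?thesis .
qed

lemma congruence_eigenbasis:
  assumes "eigenbasis n A u l" "a < n" "b < n"
  shows "congruence n u A a b = (if a = b then complex_of_real (l a) else 0)"
  unfolding congruence_def using eigenbasis_mat_vec[OF assms(1,3), of "u a"] eigenbasis_herm_ip[OF assms(1,3,2)] by auto

lemma fdet_eigenbasis:
  assumes eb: "eigenbasis n A u l"
  shows "fdet n A = (\<Prod>a<n. complex_of_real (l a))"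
proof -
  define I where "I = (\<lambda>i j::nat. if i = j then 1 else 0 :: complex)"
  have I: "fdet n I = 1" unfolding I_def fdet_diagonal by simp
  have "mat_vec n I x i = x i" if "i < n" for x i
    unfolding mat_vec_def I_def using that by (simp add: if_distrib[of "\<lambda>x. x * _"] cong: if_cong)
  then have "congruence n u I a b = I a b" if "a < n" "b < n" for a b
    using eigenbasis_herm_ip[OF eb that(2,1)] herm_ip_cong[of n "mat_vec n I (u b)" "u b" "u a" "u a"]
    by (simp add: congruence_def I_def)
  then have "fdet n (congruence n u I) = fdet n I" by (metis to_mat_cong)
  then have k: "fdet n (\<lambda>a k. cnj (u a k)) * fdet n (\<lambda>k b. u b k) = 1"
    unfolding fdet_congruence I by simp
  have "fdet n (congruence n u A) = fdet n (\<lambda>i j. if i = j then complex_of_real (l i) else 0)"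
    by (intro arg_cong[of _ _ Determinant.det] to_mat_cong) (simp add: congruence_eigenbasis[OF eb])
  then show ?thesis unfolding fdet_congruence k fdet_diagonal by simp
qed

definition ge_id :: "nat \<Rightarrow> (nat \<Rightarrow> nat \<Rightarrow> complex) \<Rightarrow> bool" where
  "ge_id n A \<longleftrightarrow> hermitian_on n A \<and> (\<forall>x. (\<Sum>k<n. (cmod (x k))\<^sup>2) \<le> Re (herm_ip n (mat_vec n A x) x))"

definition psd_on :: "nat \<Rightarrow> (nat \<Rightarrow> nat \<Rightarrow> complex) \<Rightarrow> bool" where
  "psd_on n A \<longleftrightarrow> hermitian_on n A \<and> (\<forall>x. 0 \<le> Re (herm_ip n (mat_vec n A x) x))"

lemma ge_id_identity: "ge_id n (\<lambda>i j. if i = j then 1 else 0)"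
proof -
  have "mat_vec n (\<lambda>i j. if i = j then 1 else 0) x i = x i" if "i < n" for x i
    unfolding mat_vec_def using that by (simp add: if_distrib[of "\<lambda>x. x * _"] cong: if_cong)
  then have "herm_ip n (mat_vec n (\<lambda>i j. if i = j then 1 else 0) x) x = herm_ip n x x" for x
    by (intro herm_ip_cong) auto
  then show ?thesis unfolding ge_id_def hermitian_on_def by (auto simp: herm_ip_self)
qed

lemma ge_id_add: "ge_id n A \<Longrightarrow> psd_on n B \<Longrightarrow> ge_id n (\<lambda>i j. A i j + B i j)"
  unfolding ge_id_def psd_on_def
  by (auto intro: hermitian_add simp: mat_vec_add herm_ip_add_left add_increasing2)

lemma psd_congruence: "psd_on n A \<Longrightarrow> psd_on n (congruence n w A)"
  unfolding psd_on_def using hermitian_congruence by (auto simp flip: herm_ip_mat_vec_lin_comb)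

lemma ge_id_eigenvalue:
  assumes "ge_id n A" and eb: "eigenbasis n A u l" and a: "a < n"
  shows "1 \<le> l a"
proof -
  have "(\<Sum>k<n. (cmod (u a k))\<^sup>2) \<le> Re (herm_ip n (mat_vec n A (u a)) (u a))"
    using assms(1) unfolding ge_id_def by blast
  then show ?thesis
    using eigenbasis_norm[OF eb a] eigenbasis_mat_vec[OF eb a, of "u a"] eigenbasis_herm_ip[OF eb a a] by simp
qed

lemma fdet_ge_id:
  assumes "ge_id n A"
  obtains D where "fdet n A = complex_of_real D" "D \<ge> 1"
proof -
  obtain u l where eb: "eigenbasis n A u l" using hermitian_spectral assms unfolding ge_id_def by blast
  have "1 \<le> l a" if "a < n" for a by (rule ge_id_eigenvalue[OF assms eb that])
  then have "1 \<le> (\<Prod>a<n. l a)" by (intro prod_ge_1) auto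
  then show ?thesis using that[of "\<Prod>a<n. l a"] fdet_eigenbasis[OF eb] by simp
qed

lemma psd_diag_entry: "0 \<le> d \<Longrightarrow> psd_on n (\<lambda>i j. if i = m \<and> j = m then complex_of_real d else 0)"
proof -
  assume d: "0 \<le> d"
  have "mat_vec n (\<lambda>i j. if i = m \<and> j = m then complex_of_real d else 0) x
      = (\<lambda>i. if i = m \<and> m < n then complex_of_real d * x m else 0)" for x
  proof (rule ext)
    fix i
    show "mat_vec n (\<lambda>i j. if i = m \<and> j = m then complex_of_real d else 0) x i
      = (if i = m \<and> m < n then complex_of_real d * x m else 0)"
      unfolding mat_vec_def by (cases "i = m") (auto simp: if_distrib[of "\<lambda>x. x * _"] cong: if_cong)
  qed
  then have "herm_ip n (mat_vec n (\<lambda>i j. if i = m \<and> j = m then complex_of_real d else 0) x) x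
     = (if m < n then complex_of_real d * x m * cnj (x m) else 0)" for x
    unfolding herm_ip_def by (auto simp: if_distrib[of "\<lambda>x. x * _"] cong: if_cong)
  then show ?thesis using d unfolding psd_on_def hermitian_on_def
    by (auto simp: mult.assoc complex_norm_square[symmetric] simp flip: of_real_power)
qed

text \<open>
The determinant is affine in a diagonal entry, with the complementary minor as slope. The minor divided by the
determinant is a diagonal entry of $N^{-1}$, which is at most $1$ because $N\ge1$. In the proof \<open>x\<close> is the
corresponding column of the adjugate.
\<close>

lemma det_diag_update_le:
  assumes N: "ge_id n N" and i: "m < n" and d: "0 \<le> d"
  shows "Re (fdet n (\<lambda>i j. N i j + (if i = m \<and> j = m then complex_of_real d else 0))) \<le> (1 + d) * Re (fdet n N)"
proof -
  obtain D where D: "fdet n N = complex_of_real D" "D \<ge> 1" using fdet_ge_id[OF N] .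
  let ?N' = "\<lambda>i j. N i j + (if i = m \<and> j = m then complex_of_real d else 0)"
  define x where "x = (\<lambda>k. cofactor (to_mat n N) m k)"
  have adj: "to_mat n N * adj_mat (to_mat n N) = Determinant.det (to_mat n N) \<cdot>\<^sub>m 1\<^sub>m n"
    using adj_mat[of "to_mat n N" n] by simp
  have mvx: "mat_vec n N x k = (if k = m then complex_of_real D else 0)" if "k < n" for k
  proof -
    have "(to_mat n N * adj_mat (to_mat n N)) $$ (k,m) = mat_vec n N x k"
      using that i adj_mat(1)[of "to_mat n N" n] unfolding mat_vec_def x_def
      by (simp add: scalar_prod_def lessThan_atLeast0 adj_mat_def to_mat_def)
    then show ?thesis unfolding adj D using that i by (cases "k = m") auto
  qed
  have "herm_ip n (mat_vec n N x) x = herm_ip n (\<lambda>k. if k = m then complex_of_real D else 0) x"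
    by (intro herm_ip_cong) (auto simp: mvx)
  also have "\<dots> = complex_of_real D * cnj (x m)"
    unfolding herm_ip_def using i by (simp add: if_distrib[of "\<lambda>x. x * _"] cong: if_cong)
  finally have "Re (herm_ip n (mat_vec n N x) x) = D * Re (x m)" by simp
  then have "(\<Sum>k<n. (cmod (x k))\<^sup>2) \<le> D * Re (x m)"
    using N unfolding ge_id_def by metis
  moreover have "(cmod (x m))\<^sup>2 \<le> (\<Sum>k<n. (cmod (x k))\<^sup>2)"
    using i by (intro member_le_sum) auto
  moreover have "(Re (x m))\<^sup>2 \<le> (cmod (x m))\<^sup>2"
    by (simp add: cmod_power2)
  ultimately have "Re (x m) * Re (x m) \<le> D * Re (x m)" by (simp add: power2_eq_square)
  then have xm: "Re (x m) \<le> D" using D(2) by (metis mult_le_cancel_right not_less order.trans zero_le_one)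
  have cof: "cofactor (to_mat n ?N') m j = cofactor (to_mat n N) m j" if "j < n" for j
  proof -
    have "mat_delete (to_mat n ?N') m j = mat_delete (to_mat n N) m j"
      unfolding mat_delete_def to_mat_def by (intro eq_matI) auto
    then show ?thesis unfolding cofactor_def by simp
  qed
  have "fdet n ?N' = (\<Sum>j<n. to_mat n ?N' $$ (m,j) * cofactor (to_mat n ?N') m j)"
    by (rule laplace_expansion_row) (use i in auto)
  also have "\<dots> = (\<Sum>j<n. to_mat n N $$ (m,j) * cofactor (to_mat n N) m j + (if j = m then complex_of_real d * x m else 0))"
    using i by (intro sum.cong refl) (auto simp: cof to_mat_index x_def algebra_simps)
  also have "\<dots> = fdet n N + complex_of_real d * x m"
    using i laplace_expansion_row[of "to_mat n N" n m] by (simp add: sum.distrib)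
  finally have "Re (fdet n ?N') = D + d * Re (x m)" using D by simp
  also have "\<dots> \<le> D + d * D" using xm d by (simp add: mult_left_mono)
  finally show ?thesis using D by (simp add: algebra_simps)
qed

lemma det_diag_add_le:
  assumes N: "ge_id n N" and d: "\<And>a. a < n \<Longrightarrow> 0 \<le> d a" and "m \<le> n"
  shows "ge_id n (\<lambda>i j. N i j + (if i = j \<and> i < m then complex_of_real (d i) else 0)) \<and>
    Re (fdet n (\<lambda>i j. N i j + (if i = j \<and> i < m then complex_of_real (d i) else 0)))
      \<le> (\<Prod>a<m. 1 + d a) * Re (fdet n N)"
  using \<open>m \<le> n\<close>
proof (induction m)
  case 0
  then show ?case using N by simp
next
  case (Suc m)
  let ?N = "\<lambda>i j. N i j + (if i = j \<and> i < m then complex_of_real (d i) else 0)"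
  have IH: "ge_id n ?N" "Re (fdet n ?N) \<le> (\<Prod>a<m. 1 + d a) * Re (fdet n N)" and m: "m < n"
    using Suc by auto
  have eq: "(\<lambda>i j. N i j + (if i = j \<and> i < Suc m then complex_of_real (d i) else 0))
     = (\<lambda>i j. ?N i j + (if i = m \<and> j = m then complex_of_real (d m) else 0))"
    by (intro ext) (auto simp: less_Suc_eq)
  have "Re (fdet n (\<lambda>i j. ?N i j + (if i = m \<and> j = m then complex_of_real (d m) else 0)))
      \<le> (1 + d m) * Re (fdet n ?N)"
    by (rule det_diag_update_le[OF IH(1) m d[OF m]])
  also have "\<dots> \<le> (1 + d m) * ((\<Prod>a<m. 1 + d a) * Re (fdet n N))"
    using IH(2) d[OF m] by (intro mult_left_mono) auto
  finally show ?case unfolding eq using ge_id_add[OF IH(1) psd_diag_entry[OF d[OF m]]]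
    by (simp add: mult_ac)
qed

text \<open>
Rescaled eigenvectors of \<open>M\<close> form a basis in which \<open>M\<close> is the identity; a further unitary change of basis
diagonalizes \<open>A\<close> and leaves the identity alone.
\<close>

lemma simultaneous_diagonalization:
  assumes M: "ge_id n M" and A: "hermitian_on n A"
  obtains w d where
    "\<And>a b. a < n \<Longrightarrow> b < n \<Longrightarrow> congruence n w M a b = (if a = b then 1 else 0)"
    "\<And>a b. a < n \<Longrightarrow> b < n \<Longrightarrow> congruence n w A a b = (if a = b then complex_of_real (d a) else 0)"
proof -
  obtain u l where eb: "eigenbasis n M u l" using hermitian_spectral M unfolding ge_id_def by blast
  have l1: "1 \<le> l a" if "a < n" for a by (rule ge_id_eigenvalue[OF M eb that])
  define v where "v = (\<lambda>a k. complex_of_real (1 / sqrt (l a)) * u a k)"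
  have vM: "congruence n v M a b = (if a = b then 1 else 0)" if ab: "a < n" "b < n" for a b
  proof -
    have "congruence n v M a b = complex_of_real (1 / sqrt (l b)) * complex_of_real (1 / sqrt (l a)) * congruence n u M a b"
      unfolding congruence_def v_def mat_vec_scale herm_ip_scale_left herm_ip_scale_right by simp
    then show ?thesis unfolding congruence_eigenbasis[OF eb ab] using l1[OF ab(1)]
      by (auto simp flip: of_real_mult)
  qed
  obtain u' d where eb': "eigenbasis n (congruence n v A) u' d"
    using hermitian_spectral hermitian_congruence[OF A] by blast
  show ?thesis
  proof (rule that[of "\<lambda>a. lin_comb n v (u' a)" d])
    fix a b assume ab: "a < n" "b < n"
    have "mat_vec n (congruence n v M) x i = x i" if "i < n" for x i
    proof -
      have "mat_vec n (congruence n v M) x i = (\<Sum>k<n. if i = k then x k else 0)"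
        unfolding mat_vec_def using that by (intro sum.cong) (auto simp: vM)
      then show ?thesis using that by simp
    qed
    then have "congruence n u' (congruence n v M) a b = herm_ip n (u' b) (u' a)"
      unfolding congruence_def[of n u'] by (intro herm_ip_cong) auto
    then show "congruence n (\<lambda>a. lin_comb n v (u' a)) M a b = (if a = b then 1 else 0)"
      unfolding congruence_lin_comb using eigenbasis_herm_ip[OF eb' ab(2,1)] by auto
    show "congruence n (\<lambda>a. lin_comb n v (u' a)) A a b = (if a = b then complex_of_real (d a) else 0)"
      unfolding congruence_lin_comb by (rule congruence_eigenbasis[OF eb' ab])
  qed
qed

text \<open>
A congruence reduces \<open>M\<close> to the identity and \<open>A\<close> to a diagonal matrix and multiplies every determinant by the
same factor; then the diagonal entries are added one at a time.
\<close>

theorem det_log_submodular: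
  assumes M: "ge_id n M" and A: "psd_on n A" and C: "psd_on n C"
  shows "Re (fdet n (\<lambda>i j. M i j + A i j + C i j)) * Re (fdet n M)
    \<le> Re (fdet n (\<lambda>i j. M i j + A i j)) * Re (fdet n (\<lambda>i j. M i j + C i j))"
proof -
  obtain w d where wM: "\<And>a b. a < n \<Longrightarrow> b < n \<Longrightarrow> congruence n w M a b = (if a = b then 1 else 0)"
    and wA: "\<And>a b. a < n \<Longrightarrow> b < n \<Longrightarrow> congruence n w A a b = (if a = b then complex_of_real (d a) else 0)"
    using simultaneous_diagonalization[OF M, of A] A unfolding psd_on_def by metis
  have d: "0 \<le> d a" if "a < n" for a
  proof -
    have "0 \<le> Re (congruence n w A a a)" using A unfolding psd_on_def congruence_def by blast
    then show ?thesis using wA[OF that that] by simp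
  qed
  \<comment> \<open>the common factor of all determinants under the congruence is the inverse of \<open>D\<close>\<close>
  define \<kappa> where "\<kappa> = fdet n (\<lambda>a k. cnj (w a k)) * fdet n (\<lambda>k b. w b k)"
  obtain D where D: "fdet n M = complex_of_real D" "D \<ge> 1" using fdet_ge_id[OF M] .
  have "fdet n (congruence n w M) = fdet n (\<lambda>i j. if i = j then 1 else 0)"
    by (intro arg_cong[of _ _ Determinant.det] to_mat_cong) (simp add: wM)
  then have kD: "\<kappa> * complex_of_real D = 1" unfolding fdet_congruence \<kappa>_def D fdet_diagonal by simp
  have ex: "fdet n X = complex_of_real D * fdet n (congruence n w X)" for X
  proof -
    have "complex_of_real D * fdet n (congruence n w X) = (\<kappa> * complex_of_real D) * fdet n X"
      unfolding fdet_congruence \<kappa>_def by (simp add: mult_ac)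
    then show ?thesis using kD by simp
  qed
  define N where "N = (\<lambda>i j. (if i = j then 1 else 0) + congruence n w C i j)"
  have N: "ge_id n N" unfolding N_def by (rule ge_id_add[OF ge_id_identity psd_congruence[OF C]])
  have eMA: "fdet n (congruence n w (\<lambda>i j. M i j + A i j)) = complex_of_real (\<Prod>a<n. 1 + d a)"
  proof -
    have "fdet n (congruence n w (\<lambda>i j. M i j + A i j)) = fdet n (\<lambda>i j. if i = j then complex_of_real (1 + d i) else 0)"
      by (intro arg_cong[of _ _ Determinant.det] to_mat_cong) (simp add: congruence_add wM wA)
    then show ?thesis unfolding fdet_diagonal by simp
  qed
  have eMC: "fdet n (congruence n w (\<lambda>i j. M i j + C i j)) = fdet n N"
    by (intro arg_cong[of _ _ Determinant.det] to_mat_cong) (simp add: congruence_add wM N_def)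
  have eMAC: "fdet n (congruence n w (\<lambda>i j. M i j + A i j + C i j))
     = fdet n (\<lambda>i j. N i j + (if i = j \<and> i < n then complex_of_real (d i) else 0))"
    by (intro arg_cong[of _ _ Determinant.det] to_mat_cong) (auto simp: congruence_add wM wA N_def)
  have "Re (fdet n (congruence n w (\<lambda>i j. M i j + A i j + C i j))) \<le> (\<Prod>a<n. 1 + d a) * Re (fdet n N)"
    unfolding eMAC using det_diag_add_le[OF N, of d n] d by blast
  then have "D * Re (fdet n (congruence n w (\<lambda>i j. M i j + A i j + C i j))) * D \<le> D * (\<Prod>a<n. 1 + d a) * (D * Re (fdet n N))"
    using D(2) by (simp add: mult_ac mult_left_mono)
  then show ?thesis unfolding ex[of "\<lambda>i j. M i j + A i j + C i j"] ex[of "\<lambda>i j. M i j + A i j"] ex[of "\<lambda>i j. M i j + C i j"] D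
    unfolding eMA eMC by (simp del: of_real_prod of_real_add)
qed

section \<open>Integrals of determinants of finite-rank kernels\<close>

definition kernel_det :: "nat \<Rightarrow> ('b \<Rightarrow> 'b \<Rightarrow> complex) \<Rightarrow> (nat \<Rightarrow> 'b) \<Rightarrow> complex" where
  "kernel_det n K x = Determinant.det (mat n n (\<lambda>(i, j). K (x i) (x j)))"

lemma kernel_det_leibniz:
  "kernel_det n K x = (\<Sum>p | p permutes {0..<n}. of_int (sign p) * (\<Prod>i<n. K (x i) (x (p i))))"
  unfolding kernel_det_def det_def'[OF mat_carrier]
  by (intro sum.cong refl arg_cong2[of _ _ _ _ "(*)"]) (auto simp: lessThan_atLeast0 permutes_in_image intro!: prod.cong)

lemma card_injections:
  assumes "finite C"
  shows "card {f \<in> {..<n} \<rightarrow>\<^sub>E C. inj_on f {..<n}} = fact n * (card C choose n)"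
proof -
  have "card {f \<in> {..<n} \<rightarrow>\<^sub>E C. inj_on f {..<n}} = prod ((-) (card C)) {0..<n}"
    using card_inj_on_subset_funcset[of "{..<n}" C "{..<n}"] assms by simp
  also have "\<dots> = fact n * (card C choose n)"
  proof (cases "n \<le> card C")
    case True
    then have "card C choose n = fact (card C) div (fact n * fact (card C - n))" by (simp add: binomial_fact')
    have "prod ((-) (card C)) {0..<n} * fact (card C - n) = fact (card C)"
      using True
    proof (induction n)
      case (Suc n)
      then have "card C - n = Suc (card C - Suc n)" by simp
      then have "fact (card C - n) = (card C - n) * fact (card C - Suc n)" by (metis fact_Suc of_nat_id)
      then show ?case using Suc by (simp add: mult_ac)
    qed simp
    moreover have "fact n * (card C choose n) * fact (card C - n) = fact (card C)"
      using binomial_fact_lemma[OF True] by (simp add: mult_ac)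
    ultimately show ?thesis by (metis fact_nonzero mult_right_cancel)
  next
    case False
    then have "prod ((-) (card C)) {0..<n} = 0" by (intro prod_zero) (auto intro!: bexI[of _ "card C"])
    then show ?thesis using False by (simp add: binomial_eq_0)
  qed
  finally show ?thesis .
qed

text \<open>
The elementary symmetric polynomial of degree \<open>n\<close> in the first \<open>m\<close> values of \<open>l\<close>.
\<close>

definition esym :: "nat \<Rightarrow> nat \<Rightarrow> (nat \<Rightarrow> real) \<Rightarrow> real" where
  "esym n m l = (\<Sum>S | S \<subseteq> {..<m} \<and> card S = n. \<Prod>a\<in>S. l a)"

lemma sum_injections_esym:
  fixes l :: "nat \<Rightarrow> real"
  shows "(\<Sum>c \<in> {c \<in> {..<n} \<rightarrow>\<^sub>E {..<m}. inj_on c {..<n}}. \<Prod>i<n. l (c i)) = fact n * esym n m l"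
proof -
  let ?I = "{c \<in> {..<n} \<rightarrow>\<^sub>E {..<m}. inj_on c {..<n}}"
  let ?T = "{S. S \<subseteq> {..<m} \<and> card S = n}"
  have finI: "finite ?I" by (simp add: finite_PiE)
  have finT: "finite ?T" by (rule finite_subset[of _ "Pow {..<m}"]) auto
  have "(\<Sum>c\<in>?I. \<Prod>i<n. l (c i)) = (\<Sum>S\<in>?T. \<Sum>c\<in>{c\<in>?I. c ` {..<n} = S}. \<Prod>i<n. l (c i))"
  proof (rule sum.group[where g = "\<lambda>c. c ` {..<n}", symmetric, OF finI finT])
    show "(\<lambda>c. c ` {..<n}) ` ?I \<subseteq> ?T"
    proof (rule image_subsetI)
      fix c assume "c \<in> ?I"
      then show "c ` {..<n} \<in> ?T" by (simp add: card_image PiE_iff image_subset_iff)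
    qed
  qed
  also have "\<dots> = (\<Sum>S\<in>?T. fact n * (\<Prod>a\<in>S. l a))"
  proof (intro sum.cong refl)
    fix S assume S: "S \<in> ?T"
    then have fS: "finite S" using finite_subset by blast
    have eq: "{c\<in>?I. c ` {..<n} = S} = {c \<in> {..<n} \<rightarrow>\<^sub>E S. inj_on c {..<n}}"
    proof (intro equalityI subsetI)
      fix c assume "c \<in> {c \<in> {..<n} \<rightarrow>\<^sub>E S. inj_on c {..<n}}"
      then have c: "c \<in> {..<n} \<rightarrow>\<^sub>E S" "inj_on c {..<n}" by auto
      then have "c ` {..<n} \<subseteq> S" by auto
      moreover have "card (c ` {..<n}) = card S" using c S by (simp add: card_image)
      ultimately have "c ` {..<n} = S" using fS by (metis card_subset_eq)
      moreover have "c \<in> {..<n} \<rightarrow>\<^sub>E {..<m}" using c S by (auto simp: PiE_iff)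
      ultimately show "c \<in> {c\<in>?I. c ` {..<n} = S}" using c by auto
    qed (auto simp: PiE_iff)
    have "(\<Sum>c\<in>{c\<in>?I. c ` {..<n} = S}. \<Prod>i<n. l (c i)) = (\<Sum>c\<in>{c\<in>?I. c ` {..<n} = S}. \<Prod>a\<in>S. l a)"
    proof (intro sum.cong refl)
      fix c assume "c \<in> {c\<in>?I. c ` {..<n} = S}"
      then have "inj_on c {..<n}" "S = c ` {..<n}" by auto
      then show "(\<Prod>i<n. l (c i)) = (\<Prod>a\<in>S. l a)" by (simp add: prod.reindex)
    qed
    also have "\<dots> = fact n * (\<Prod>a\<in>S. l a)"
      using card_injections[OF fS, of n] S unfolding eq by simp
    finally show "(\<Sum>c\<in>{c\<in>?I. c ` {..<n} = S}. \<Prod>i<n. l (c i)) = fact n * (\<Prod>a\<in>S. l a)" .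
  qed
  finally show ?thesis unfolding esym_def by (simp add: sum_distrib_left)
qed

lemma prod_eq_sum_esym:
  fixes t :: complex
  shows "(\<Prod>a<m. 1 + t * complex_of_real (l a)) = (\<Sum>n\<le>m. complex_of_real (esym n m l) * t ^ n)"
proof -
  have "(\<Prod>a<m. 1 + t * complex_of_real (l a)) = (\<Prod>a<m. t * complex_of_real (l a) + 1)"
    by (simp add: add.commute)
  also have "\<dots> = (\<Sum>S\<in>Pow {..<m}. \<Prod>a\<in>S. t * complex_of_real (l a))"
    by (subst prod_add) auto
  also have "\<dots> = (\<Sum>S\<in>Pow {..<m}. t ^ card S * complex_of_real (\<Prod>a\<in>S. l a))"
    by (simp add: prod.distrib)
  also have "\<dots> = (\<Sum>n\<le>m. \<Sum>S\<in>{S \<in> Pow {..<m}. card S = n}. t ^ card S * complex_of_real (\<Prod>a\<in>S. l a))"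
    by (rule sum.group[where g = card, symmetric]) (use card_mono[of "{..<m}"] in auto)
  also have "\<dots> = (\<Sum>n\<le>m. complex_of_real (esym n m l) * t ^ n)"
    unfolding esym_def of_real_sum sum_distrib_right
    by (intro sum.cong refl) (auto simp: mult.commute)
  finally show ?thesis .
qed

lemma esym_nonneg: "(\<And>a. a < m \<Longrightarrow> 0 \<le> l a) \<Longrightarrow> 0 \<le> esym n m l"
  unfolding esym_def by (intro sum_nonneg prod_nonneg) auto

text \<open>
This factorial decay is what makes the Fredholm series converge for every \<open>t\<close>; it replaces Hadamard's inequality.
\<close>

lemma esym_le:
  assumes "\<And>a. a < m \<Longrightarrow> 0 \<le> l a"
  shows "esym n m l \<le> (\<Sum>a<m. l a) ^ n / fact n"
proof -
  have "fact n * esym n m l \<le> (\<Sum>c\<in>{..<n} \<rightarrow>\<^sub>E {..<m}. \<Prod>i<n. l (c i))"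
    unfolding sum_injections_esym[symmetric]
    by (intro sum_mono2) (auto intro!: finite_PiE prod_nonneg assms)
  also have "\<dots> = (\<Prod>i<n. \<Sum>a<m. l a)" by (subst prod_sum_PiE) auto
  also have "\<dots> = (\<Sum>a<m. l a) ^ n" by simp
  finally show ?thesis by (simp add: field_simps)
qed

text \<open>
The sum is the Leibniz expansion of the matrix with entry $1$ where $c_i=c_j$ and $0$ elsewhere. It is the
identity when \<open>c\<close> is injective and has two equal rows otherwise.
\<close>

lemma det_coincidence:
  fixes c :: "nat \<Rightarrow> nat"
  shows "(\<Sum>p | p permutes {0..<n}. of_int (sign p) * (\<Prod>i<n. if c i = c (p i) then 1 else 0 :: complex))
    = (if inj_on c {..<n} then 1 else 0)"
proof -
  define A :: "complex mat" where "A = mat n n (\<lambda>(i,j). if c i = c j then 1 else 0)"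
  have A: "A \<in> carrier_mat n n" unfolding A_def by simp
  have "(\<Sum>p | p permutes {0..<n}. of_int (sign p) * (\<Prod>i<n. if c i = c (p i) then 1 else 0 :: complex))
     = Determinant.det A"
    using kernel_det_leibniz[of n "\<lambda>a b. if a = b then 1 else 0" c] unfolding kernel_det_def A_def by simp
  also have "\<dots> = (if inj_on c {..<n} then 1 else 0)"
  proof (cases "inj_on c {..<n}")
    case True
    then have "A = 1\<^sub>m n" unfolding A_def by (intro eq_matI) (auto simp: inj_on_def)
    then show ?thesis using True by simp
  next
    case False
    then obtain i j where ij: "i < n" "j < n" "i \<noteq> j" "c i = c j" by (auto simp: inj_on_def)
    have "row A i = row A j" using ij unfolding A_def by (intro eq_vecI) auto
    then show ?thesis using det_identical_rows[OF A ij(3,1,2)] False by simp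
  qed
  finally show ?thesis .
qed

text \<open>
The functions need not be normalized: \<open>l a\<close> is the squared norm of the \<open>a\<close>-th one, hence an eigenvalue of the
kernel $\sum_a\psi_a(z)\overline{\psi_a(w)}$.
\<close>

locale orthogonal_kernel = sigma_finite_measure \<mu> for \<mu> :: "'b measure" +
  fixes m :: nat and \<psi> :: "nat \<Rightarrow> 'b \<Rightarrow> complex" and l :: "nat \<Rightarrow> real"
  assumes int: "\<And>a b. a < m \<Longrightarrow> b < m \<Longrightarrow> integrable \<mu> (\<lambda>z. \<psi> a z * cnj (\<psi> b z))"
    and orth: "\<And>a b. a < m \<Longrightarrow> b < m \<Longrightarrow> (\<integral>z. \<psi> a z * cnj (\<psi> b z) \<partial>\<mu>) = (if a = b then complex_of_real (l a) else 0)"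
begin

lemma kernel_det_expansion:
  "kernel_det n (\<lambda>z w. \<Sum>a<m. \<psi> a z * cnj (\<psi> a w)) x =
   (\<Sum>p | p permutes {0..<n}. \<Sum>c \<in> {..<n} \<rightarrow>\<^sub>E {..<m}.
      of_int (sign p) * (\<Prod>i<n. \<psi> (c i) (x i) * cnj (\<psi> (c (inv_into UNIV p i)) (x i))))"
  unfolding kernel_det_leibniz
proof (intro sum.cong refl)
  fix p assume "p \<in> {p. p permutes {0..<n}}"
  then have p: "p permutes {..<n}" by (simp add: lessThan_atLeast0)
  have "(\<Prod>i<n. \<Sum>a<m. \<psi> a (x i) * cnj (\<psi> a (x (p i))))
     = (\<Sum>c \<in> {..<n} \<rightarrow>\<^sub>E {..<m}. \<Prod>i<n. \<psi> (c i) (x i) * cnj (\<psi> (c i) (x (p i))))"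
    by (subst prod_sum_PiE) auto
  also have "\<dots> = (\<Sum>c \<in> {..<n} \<rightarrow>\<^sub>E {..<m}. \<Prod>i<n. \<psi> (c i) (x i) * cnj (\<psi> (c (inv_into UNIV p i)) (x i)))"
  proof (intro sum.cong refl)
    fix c
    have "(\<Prod>i<n. cnj (\<psi> (c (inv_into UNIV p i)) (x i))) = (\<Prod>i<n. cnj (\<psi> (c i) (x (p i))))"
      using prod.permute[OF p, of "\<lambda>i. cnj (\<psi> (c (inv_into UNIV p i)) (x i))"] permutes_inverses(2)[OF p]
      by (simp add: o_def)
    then show "(\<Prod>i<n. \<psi> (c i) (x i) * cnj (\<psi> (c i) (x (p i)))) = (\<Prod>i<n. \<psi> (c i) (x i) * cnj (\<psi> (c (inv_into UNIV p i)) (x i)))"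
      by (simp add: prod.distrib)
  qed
  finally show "of_int (sign p) * (\<Prod>i<n. \<Sum>a<m. \<psi> a (x i) * cnj (\<psi> a (x (p i)))) =
     (\<Sum>c \<in> {..<n} \<rightarrow>\<^sub>E {..<m}. of_int (sign p) * (\<Prod>i<n. \<psi> (c i) (x i) * cnj (\<psi> (c (inv_into UNIV p i)) (x i))))"
    by (simp add: sum_distrib_left)
qed

text \<open>
An instance of Andreief's identity. In the Leibniz expansion every term factors over the variables, and
orthogonality leaves only the terms whose index function \<open>c\<close> satisfies $c\circ p=c$. The signs of these
permutations cancel unless \<open>c\<close> is injective.
\<close>

theorem integral_kernel_det:
  "integrable (Pi\<^sub>M {..<n} (\<lambda>_. \<mu>)) (kernel_det n (\<lambda>z w. \<Sum>a<m. \<psi> a z * cnj (\<psi> a w)))" (is ?int)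
  "(\<integral>x. kernel_det n (\<lambda>z w. \<Sum>a<m. \<psi> a z * cnj (\<psi> a w)) x \<partial>Pi\<^sub>M {..<n} (\<lambda>_. \<mu>))
     = complex_of_real (fact n * esym n m l)" (is ?eq)
proof -
  interpret P: product_sigma_finite "\<lambda>_::nat. \<mu>" by standard
  let ?g = "\<lambda>p c x. of_int (sign p) * (\<Prod>i<n. \<psi> (c i) (x i) * cnj (\<psi> (c (inv_into UNIV p i)) (x i)))"
  let ?C = "{..<n} \<rightarrow>\<^sub>E {..<m}"
  have pinv: "inv_into UNIV p i < n" if "p permutes {0..<n}" "i < n" for p i
    using permutes_in_image[OF permutes_inv[OF that(1)], of i] that(2) by simp
  have gi: "integrable (Pi\<^sub>M {..<n} (\<lambda>_. \<mu>)) (?g p c)"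
    and ge: "integral\<^sup>L (Pi\<^sub>M {..<n} (\<lambda>_. \<mu>)) (?g p c) = of_int (sign p) *
         (\<Prod>i<n. (if c i = c (inv_into UNIV p i) then complex_of_real (l (c i)) else 0))"
    if p: "p permutes {0..<n}" and c: "c \<in> ?C" for p c
  proof -
    have cm: "c i < m" "c (inv_into UNIV p i) < m" if "i < n" for i
      using c pinv[OF p that] that by (auto simp: PiE_iff)
    have pi: "integrable (Pi\<^sub>M {..<n} (\<lambda>_. \<mu>)) (\<lambda>x. \<Prod>i<n. \<psi> (c i) (x i) * cnj (\<psi> (c (inv_into UNIV p i)) (x i)))"
      by (rule P.product_integrable_prod) (auto intro!: int cm)
    then show "integrable (Pi\<^sub>M {..<n} (\<lambda>_. \<mu>)) (?g p c)" by simp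
    have "integral\<^sup>L (Pi\<^sub>M {..<n} (\<lambda>_. \<mu>)) (\<lambda>x. \<Prod>i<n. \<psi> (c i) (x i) * cnj (\<psi> (c (inv_into UNIV p i)) (x i)))
      = (\<Prod>i<n. \<integral>z. \<psi> (c i) z * cnj (\<psi> (c (inv_into UNIV p i)) z) \<partial>\<mu>)"
      by (rule P.product_integral_prod) (auto intro!: int cm)
    also have "\<dots> = (\<Prod>i<n. (if c i = c (inv_into UNIV p i) then complex_of_real (l (c i)) else 0))"
      by (intro prod.cong refl) (auto simp: orth cm)
    finally show "integral\<^sup>L (Pi\<^sub>M {..<n} (\<lambda>_. \<mu>)) (?g p c) = of_int (sign p) *
         (\<Prod>i<n. (if c i = c (inv_into UNIV p i) then complex_of_real (l (c i)) else 0))" using pi by simp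
  qed
  have kf: "kernel_det n (\<lambda>z w. \<Sum>a<m. \<psi> a z * cnj (\<psi> a w)) = (\<lambda>x. \<Sum>p | p permutes {0..<n}. \<Sum>c \<in> ?C. ?g p c x)"
    by (rule ext) (rule kernel_det_expansion)
  show ?int unfolding kf by (intro Bochner_Integration.integrable_sum gi) auto
  have "(\<integral>x. kernel_det n (\<lambda>z w. \<Sum>a<m. \<psi> a z * cnj (\<psi> a w)) x \<partial>Pi\<^sub>M {..<n} (\<lambda>_. \<mu>))
     = (\<Sum>p | p permutes {0..<n}. \<Sum>c \<in> ?C. integral\<^sup>L (Pi\<^sub>M {..<n} (\<lambda>_. \<mu>)) (?g p c))"
  proof -
    have "(\<integral>x. (\<Sum>p | p permutes {0..<n}. \<Sum>c \<in> ?C. ?g p c x) \<partial>Pi\<^sub>M {..<n} (\<lambda>_. \<mu>))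
       = (\<Sum>p | p permutes {0..<n}. \<integral>x. (\<Sum>c \<in> ?C. ?g p c x) \<partial>Pi\<^sub>M {..<n} (\<lambda>_. \<mu>))"
      by (rule Bochner_Integration.integral_sum, rule Bochner_Integration.integrable_sum, rule gi) auto
    also have "\<dots> = (\<Sum>p | p permutes {0..<n}. \<Sum>c \<in> ?C. integral\<^sup>L (Pi\<^sub>M {..<n} (\<lambda>_. \<mu>)) (?g p c))"
      by (rule sum.cong, rule refl, rule Bochner_Integration.integral_sum, rule gi) auto
    finally show ?thesis unfolding kf .
  qed
  also have "\<dots> = (\<Sum>p | p permutes {0..<n}. \<Sum>c \<in> ?C. of_int (sign p) *
         (\<Prod>i<n. (if c i = c (inv_into UNIV p i) then complex_of_real (l (c i)) else 0)))"
    by (rule sum.cong[OF refl], rule sum.cong[OF refl], rule ge) auto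
  also have "\<dots> = (\<Sum>p | p permutes {0..<n}. \<Sum>c \<in> ?C. of_int (sign p) *
         (\<Prod>i<n. (if c i = c (p i) then complex_of_real (l (c i)) else 0)))"
  proof -
    let ?F = "\<lambda>p. \<Sum>c \<in> ?C. of_int (sign p) *
         (\<Prod>i<n. (if c i = c (p i) then complex_of_real (l (c i)) else 0))"
    have "sum ?F {p. p permutes {0..<n}} = sum (\<lambda>p. ?F (inv_into UNIV p)) {p. p permutes {0..<n}}"
      by (rule sum_permutations_inverse)
    also have "\<dots> = (\<Sum>p | p permutes {0..<n}. \<Sum>c \<in> ?C. of_int (sign p) *
         (\<Prod>i<n. (if c i = c (inv_into UNIV p i) then complex_of_real (l (c i)) else 0)))"
    proof (rule sum.cong[OF refl])
      fix p assume "p \<in> {p. p permutes {0..<n}}"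
      then have "permutation p" using permutes_imp_permutation[of "{0..<n}" p] by simp
      then show "?F (inv_into UNIV p) = (\<Sum>c \<in> ?C. of_int (sign p) *
         (\<Prod>i<n. (if c i = c (inv_into UNIV p i) then complex_of_real (l (c i)) else 0)))"
        by (simp only: sign_inverse)
    qed
    finally show ?thesis by (rule sym)
  qed
  also have "\<dots> = (\<Sum>c \<in> ?C. \<Sum>p | p permutes {0..<n}. of_int (sign p) *
         (\<Prod>i<n. (if c i = c (p i) then complex_of_real (l (c i)) else 0)))"
    by (rule sum.swap)
  also have "\<dots> = (\<Sum>c \<in> ?C. (\<Sum>p | p permutes {0..<n}. of_int (sign p) *
         (\<Prod>i<n. (if c i = c (p i) then 1 else 0))) * (\<Prod>i<n. complex_of_real (l (c i))))"
    unfolding sum_distrib_right mult.assoc prod.distrib[symmetric]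
    by (rule sum.cong[OF refl], rule sum.cong[OF refl], rule arg_cong[where f = "(*) _"], rule prod.cong[OF refl]) simp
  also have "\<dots> = (\<Sum>c \<in> ?C. if inj_on c {..<n} then (\<Prod>i<n. complex_of_real (l (c i))) else 0)"
    unfolding det_coincidence by (rule sum.cong[OF refl]) simp
  also have "\<dots> = (\<Sum>c \<in> {c \<in> ?C. inj_on c {..<n}}. \<Prod>i<n. complex_of_real (l (c i)))"
    by (rule sum.inter_filter[symmetric]) (auto intro: finite_PiE)
  also have "\<dots> = complex_of_real (fact n * esym n m l)"
    unfolding sum_injections_esym[symmetric] by simp
  finally show ?eq .
qed

end

section \<open>Generating functions of determinantal processes\<close>

definition restrict_kernel :: "'b set \<Rightarrow> ('b \<Rightarrow> 'b \<Rightarrow> complex) \<Rightarrow> 'b \<Rightarrow> 'b \<Rightarrow> complex" where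
  "restrict_kernel R K z w = (if z \<in> R \<and> w \<in> R then K z w else 0)"

lemma kernel_det_restrict_kernel:
  assumes "x \<in> extensional {..<n}"
  shows "kernel_det n (restrict_kernel R K) x = (if x \<in> {..<n} \<rightarrow>\<^sub>E R then kernel_det n K x else 0)"
proof (cases "x \<in> {..<n} \<rightarrow>\<^sub>E R")
  case True
  then have "x i \<in> R" if "i < n" for i using that by auto
  then show ?thesis using True unfolding kernel_det_leibniz restrict_kernel_def
    by (auto intro!: sum.cong prod.cong arg_cong2[where f = "(*)"] simp: permutes_in_image)
next
  case False
  then obtain i where i: "i < n" "x i \<notin> R" using assms by (auto simp: PiE_iff)
  have "kernel_det n (restrict_kernel R K) x = 0"
    unfolding kernel_det_leibniz
  proof (rule sum.neutral, safe)
    fix p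
    have "(\<Prod>i<n. restrict_kernel R K (x i) (x (p i))) = 0"
      using i by (intro prod_zero) (auto simp: restrict_kernel_def intro!: bexI[of _ i])
    then show "of_int (sign p) * (\<Prod>i<n. restrict_kernel R K (x i) (x (p i))) = 0" by simp
  qed
  then show ?thesis using False by simp
qed

lemma kernel_det_bound:
  assumes "\<And>z w. cmod (K z w) \<le> B"
  shows "cmod (kernel_det n K x) \<le> fact n * B ^ n"
proof -
  have "cmod (kernel_det n K x) \<le> (\<Sum>p | p permutes {0..<n}. B ^ n)"
    unfolding kernel_det_leibniz
  proof (rule sum_norm_le)
    fix p
    have "cmod (of_int (sign p) * (\<Prod>i<n. K (x i) (x (p i)))) = (\<Prod>i<n. cmod (K (x i) (x (p i))))"
      by (simp add: norm_mult prod_norm sign_def)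
    also have "\<dots> \<le> (\<Prod>i<n. B)" using assms by (intro prod_mono) auto
    finally show "cmod (of_int (sign p) * (\<Prod>i<n. K (x i) (x (p i)))) \<le> B ^ n" by simp
  qed
  also have "\<dots> = fact n * B ^ n" by (simp add: card_permutations[of "{0..<n}" n])
  finally show ?thesis .
qed

lemma kernel_det_restrict_kernel_bound:
  assumes "x \<in> extensional {..<n}" and B: "0 \<le> B" "\<And>z w. z \<in> R \<Longrightarrow> w \<in> R \<Longrightarrow> cmod (K z w) \<le> B"
  shows "cmod (kernel_det n (restrict_kernel R K) x) \<le> fact n * B ^ n * indicator ({..<n} \<rightarrow>\<^sub>E R) x"
proof -
  have "cmod (kernel_det n (restrict_kernel R K) x) \<le> fact n * B ^ n"
    by (rule kernel_det_bound) (auto simp: restrict_kernel_def B)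
  then show ?thesis using kernel_det_restrict_kernel[OF assms(1), of R K] by (cases "x \<in> {..<n} \<rightarrow>\<^sub>E R") simp_all
qed

text \<open>
Pointwise convergence of kernels that stay bounded on a set of finite measure passes to the integrals of their
determinants, by dominated convergence.
\<close>

lemma (in sigma_finite_measure) kernel_det_restrict_kernel_limit:
  fixes Km :: "nat \<Rightarrow> 'a \<Rightarrow> 'a \<Rightarrow> complex"
  assumes R: "R \<in> sets M" "emeasure M R < \<infinity>"
    and B: "0 \<le> B" "\<And>k z w. z \<in> R \<Longrightarrow> w \<in> R \<Longrightarrow> cmod (Km k z w) \<le> B"
    and lim: "\<And>z w. z \<in> R \<Longrightarrow> w \<in> R \<Longrightarrow> (\<lambda>k. Km k z w) \<longlonglongrightarrow> K z w"
    and int: "\<And>k. integrable (Pi\<^sub>M {..<n} (\<lambda>_. M)) (kernel_det n (restrict_kernel R (Km k)))"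
  shows "integrable (Pi\<^sub>M {..<n} (\<lambda>_. M)) (kernel_det n (restrict_kernel R K))"
    "(\<lambda>k. \<integral>x. kernel_det n (restrict_kernel R (Km k)) x \<partial>Pi\<^sub>M {..<n} (\<lambda>_. M)) \<longlonglongrightarrow> (\<integral>x. kernel_det n (restrict_kernel R K) x \<partial>Pi\<^sub>M {..<n} (\<lambda>_. M))"
proof -
  interpret P: product_sigma_finite "\<lambda>_::nat. M" by standard
  let ?P = "Pi\<^sub>M {..<n} (\<lambda>_. M)"
  have "emeasure ?P ({..<n} \<rightarrow>\<^sub>E R) = (\<Prod>i<n. emeasure M R)"
    using R by (subst P.emeasure_PiM) auto
  also have "\<dots> < \<infinity>" using R(2) by (simp add: power_eq_top_ennreal less_top[symmetric])
  finally have w: "integrable ?P (\<lambda>x. fact n * B ^ n * indicator ({..<n} \<rightarrow>\<^sub>E R) x)"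
    using R by (auto simp: sets_PiM_I_finite)
  have l: "(\<lambda>k. kernel_det n (restrict_kernel R (Km k)) x) \<longlonglongrightarrow> kernel_det n (restrict_kernel R K) x" for x
    unfolding kernel_det_leibniz restrict_kernel_def by (intro tendsto_intros) (auto simp: lim)
  have m: "kernel_det n (restrict_kernel R K) \<in> borel_measurable ?P"
    by (rule borel_measurable_LIMSEQ_metric[OF borel_measurable_integrable[OF int] l])
  have b: "AE x in ?P. norm (kernel_det n (restrict_kernel R (Km k)) x) \<le> fact n * B ^ n * indicator ({..<n} \<rightarrow>\<^sub>E R) x" for k
    using kernel_det_restrict_kernel_bound[OF _ B(1), of _ n R "Km k"] B(2) by (intro AE_I2) (auto simp: space_PiM PiE_def)
  show "integrable ?P (kernel_det n (restrict_kernel R K))"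
    by (rule integrable_dominated_convergence[OF m borel_measurable_integrable[OF int] w _ b]) (auto intro: l)
  show "(\<lambda>k. \<integral>x. kernel_det n (restrict_kernel R (Km k)) x \<partial>?P) \<longlonglongrightarrow> (\<integral>x. kernel_det n (restrict_kernel R K) x \<partial>?P)"
    by (rule integral_dominated_convergence[OF m borel_measurable_integrable[OF int] w _ b]) (auto intro: l)
qed

text \<open>
The injective maps from \<open>n\<close> indices into the $N$ points of a configuration in $R$ number $n!\binom Nn$, so the
\<open>n\<close>-th correlation function integrates over $R^n$ to $n!\,\mathbb E\binom Nn$.
\<close>

lemma determinantal_binomial_moment:
  fixes \<Lambda> :: "'b::euclidean_space set"
  assumes D: "determinantal_process \<Lambda> K M Z" and R: "compact R" "R \<subseteq> \<Lambda>"
    and int: "integrable (Pi\<^sub>M {..<n} (\<lambda>_. lborel)) (kernel_det n (restrict_kernel R K))"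
    and I: "(\<integral>x. kernel_det n (restrict_kernel R K) x \<partial>Pi\<^sub>M {..<n} (\<lambda>_. lborel)) = complex_of_real (fact n * c)"
  shows "has_bochner_integral M (\<lambda>\<omega>. real (card (Z \<omega> \<inter> R) choose n)) c" "0 \<le> c"
proof -
  let ?P = "Pi\<^sub>M {..<n} (\<lambda>_. lborel :: 'b measure)" and ?B = "{..<n} \<rightarrow>\<^sub>E R"
  have pp: "point_process \<Lambda> M Z" using D unfolding determinantal_process_def by blast
  obtain \<rho> where cf: "correlation_function \<Lambda> M Z n \<rho>"
    and rho: "\<And>x. x \<in> {..<n} \<rightarrow>\<^sub>E \<Lambda> \<Longrightarrow> complex_of_real (\<rho> x) = kernel_det n K x"
    using D unfolding determinantal_process_def kernel_det_def by blast
  have BL: "?B \<subseteq> {..<n} \<rightarrow>\<^sub>E \<Lambda>" using R(2) by (rule PiE_mono)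
  have Rb: "R \<in> sets lborel" using borel_compact[OF R(1)] by simp
  have Bs: "?B \<in> sets ?P" using Rb by (intro sets_PiM_I_finite) auto
  have fin: "finite (Z \<omega> \<inter> R)" if "\<omega> \<in> space M" for \<omega>
    using pp that R unfolding point_process_def by blast
  have meas: "(\<lambda>\<omega>. card (Z \<omega> \<inter> R)) \<in> measurable M (count_space UNIV)"
    using pp borel_compact[OF R(1)] R unfolding point_process_def by blast
  have Re: "Re (kernel_det n (restrict_kernel R K) x) = indicator ?B x * \<rho> x" if "x \<in> space ?P" for x
  proof -
    have "x \<in> extensional {..<n}" using that by (simp add: space_PiM PiE_def)
    moreover have "\<rho> x = Re (kernel_det n K x)" if "x \<in> ?B"
      using rho[of x] BL that by (metis Re_complex_of_real subsetD)
    ultimately show ?thesis using kernel_det_restrict_kernel[of x n R K] by (auto split: split_indicator)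
  qed
  have nn: "0 \<le> Re (kernel_det n (restrict_kernel R K) x)" if "x \<in> space ?P" for x
    using cf BL unfolding Re[OF that] correlation_function_def by (auto split: split_indicator)
  have "(\<integral>\<^sup>+x\<in>?B. ennreal (\<rho> x) \<partial>?P) = (\<integral>\<^sup>+x. ennreal (Re (kernel_det n (restrict_kernel R K) x)) \<partial>?P)"
    by (intro nn_integral_cong) (auto simp: Re split: split_indicator)
  also have "\<dots> = ennreal (\<integral>x. Re (kernel_det n (restrict_kernel R K) x) \<partial>?P)"
    by (rule nn_integral_eq_integral) (use int nn in \<open>auto intro!: AE_I2\<close>)
  also have "(\<integral>x. Re (kernel_det n (restrict_kernel R K) x) \<partial>?P) = fact n * c"
    using int I by (simp add: integral_Re del: of_real_mult)
  finally have rhs: "(\<integral>\<^sup>+x\<in>?B. ennreal (\<rho> x) \<partial>?P) = ennreal (fact n * c)" .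
  have "0 \<le> (\<integral>x. Re (kernel_det n (restrict_kernel R K) x) \<partial>?P)" using nn by (intro integral_nonneg_AE AE_I2)
  then have "0 \<le> fact n * c" using int I by (simp add: integral_Re del: of_real_mult)
  then show c: "0 \<le> c" by (metis fact_gt_zero mult_pos_neg not_le)
  have cnt: "emeasure (count_space UNIV) {x \<in> ?B. inj_on x {..<n} \<and> x ` {..<n} \<subseteq> Z \<omega>}
     = ennreal (fact n) * ennreal (real (card (Z \<omega> \<inter> R) choose n))" if w: "\<omega> \<in> space M" for \<omega>
  proof -
    have eq: "{x \<in> ?B. inj_on x {..<n} \<and> x ` {..<n} \<subseteq> Z \<omega>} = {x \<in> {..<n} \<rightarrow>\<^sub>E (Z \<omega> \<inter> R). inj_on x {..<n}}"
      by (auto simp: PiE_iff)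
    have "finite {x \<in> {..<n} \<rightarrow>\<^sub>E (Z \<omega> \<inter> R). inj_on x {..<n}}" using fin[OF w] by (simp add: finite_PiE)
    then show ?thesis unfolding eq
      by (simp add: emeasure_count_space card_injections[OF fin[OF w]] ennreal_mult[symmetric]
          ennreal_of_nat_eq_real_of_nat)
  qed
  have "ennreal (fact n) * (\<integral>\<^sup>+\<omega>. ennreal (real (card (Z \<omega> \<inter> R) choose n)) \<partial>M)
    = (\<integral>\<^sup>+\<omega>. ennreal (fact n) * ennreal (real (card (Z \<omega> \<inter> R) choose n)) \<partial>M)"
    using meas by (intro nn_integral_cmult[symmetric]) measurable
  also have "\<dots> = (\<integral>\<^sup>+\<omega>. emeasure (count_space UNIV) {x \<in> ?B. inj_on x {..<n} \<and> x ` {..<n} \<subseteq> Z \<omega>} \<partial>M)"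
    by (intro nn_integral_cong) (simp add: cnt)
  also have "\<dots> = ennreal (fact n * c)"
    using cf Bs BL unfolding correlation_function_def rhs[symmetric] by blast
  also have "\<dots> = ennreal (fact n) * ennreal c" using c by (simp add: ennreal_mult)
  finally have "(\<integral>\<^sup>+\<omega>. ennreal (real (card (Z \<omega> \<inter> R) choose n)) \<partial>M) = ennreal c"
    by (simp add: ennreal_mult_cancel_left)
  then show "has_bochner_integral M (\<lambda>\<omega>. real (card (Z \<omega> \<inter> R) choose n)) c"
    using meas c by (intro has_bochner_integral_nn_integral) (auto intro!: AE_I2, measurable)
qed

lemma binomial_sums_power:
  fixes t :: complex
  shows "(\<lambda>n. of_nat (N choose n) * t ^ n) sums (1 + t) ^ N"
proof -
  have "(\<lambda>n. of_nat (N choose n) * t ^ n) sums (\<Sum>n\<le>N. of_nat (N choose n) * t ^ n)"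
    by (rule sums_finite) (auto simp: binomial_eq_0)
  moreover have "(t + 1) ^ N = (\<Sum>n\<le>N. of_nat (N choose n) * t ^ n)"
    by (subst binomial_ring) simp
  ultimately show ?thesis by (simp add: add.commute)
qed

text \<open>
Interchange of the expectation with the binomial series of $(1+t)^N$, justified by the factorial decay of the
moments.
\<close>

theorem determinantal_generating_function:
  fixes \<Lambda> :: "'b::euclidean_space set" and t :: complex
  assumes D: "determinantal_process \<Lambda> K M Z" and R: "compact R" "R \<subseteq> \<Lambda>"
    and int: "\<And>n. integrable (Pi\<^sub>M {..<n} (\<lambda>_. lborel)) (kernel_det n (restrict_kernel R K))"
    and I: "\<And>n. (\<integral>x. kernel_det n (restrict_kernel R K) x \<partial>Pi\<^sub>M {..<n} (\<lambda>_. lborel)) = complex_of_real (fact n * c n)"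
    and c: "\<And>n. c n \<le> T ^ n / fact n"
  shows "(\<lambda>n. complex_of_real (c n) * t ^ n) sums (\<integral>\<omega>. (1 + t) ^ card (Z \<omega> \<inter> R) \<partial>M)"
proof -
  note mom = determinantal_binomial_moment[OF D R int I]
  let ?f = "\<lambda>n \<omega>. of_nat (card (Z \<omega> \<inter> R) choose n) * t ^ n"
  have fint: "integrable M (?f n)" "(\<integral>\<omega>. ?f n \<omega> \<partial>M) = complex_of_real (c n) * t ^ n" for n
  proof -
    have "has_bochner_integral M (\<lambda>\<omega>. complex_of_real (real (card (Z \<omega> \<inter> R) choose n)) * t ^ n) (complex_of_real (c n) * t ^ n)"
      by (intro has_bochner_integral_mult_left has_bochner_integral_of_real mom(1))
    then show "integrable M (?f n)" "(\<integral>\<omega>. ?f n \<omega> \<partial>M) = complex_of_real (c n) * t ^ n"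
      by (auto simp: has_bochner_integral_iff)
  qed
  have ni: "(\<integral>\<omega>. norm (?f n \<omega>) \<partial>M) = c n * norm t ^ n" for n
    using mom(1)[of n] by (simp add: norm_mult norm_power has_bochner_integral_iff)
  have "summable (\<lambda>n. c n * norm t ^ n)"
  proof (rule summable_comparison_test)
    show "summable (\<lambda>n. (T * norm t) ^ n / fact n)"
      using summable_exp[of "T * norm t"] by (simp add: field_simps)
    have "norm (c n * norm t ^ n) \<le> (T * norm t) ^ n / fact n" for n
      using mult_right_mono[OF c, of "norm t ^ n" n] mom(2)[of n]
      by (simp add: abs_mult power_mult_distrib)
    then show "\<exists>N. \<forall>n\<ge>N. norm (c n * norm t ^ n) \<le> (T * norm t) ^ n / fact n" by blast
  qed
  moreover have "summable (\<lambda>n. norm (?f n \<omega>))" for \<omega>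
    by (rule summable_finite[of "{..card (Z \<omega> \<inter> R)}"]) (auto simp: binomial_eq_0)
  ultimately have "(\<lambda>n. integral\<^sup>L M (?f n)) sums (\<integral>\<omega>. (\<Sum>n. ?f n \<omega>) \<partial>M)"
    by (intro sums_integral fint AE_I2) (auto simp: ni)
  then show ?thesis unfolding fint sums_unique[OF binomial_sums_power, symmetric] .
qed

text \<open>
For the approximating kernels the Fredholm series is the product of the factors $1+tl_a$. Its coefficients
converge and obey a common bound $T^n/n!$, so the products converge by Tannery's theorem; the limiting coefficients
inherit the bound, which is what the generating function of the process requires.
\<close>

theorem product_tendsto_generating_function:
  fixes \<Lambda> :: "'b::euclidean_space set" and t :: complex
    and Km :: "nat \<Rightarrow> 'b \<Rightarrow> 'b \<Rightarrow> complex"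
  assumes D: "determinantal_process \<Lambda> K M Z" and R: "compact R" "R \<subseteq> \<Lambda>"
    and B: "0 \<le> B" "\<And>k z w. z \<in> R \<Longrightarrow> w \<in> R \<Longrightarrow> cmod (Km k z w) \<le> B"
    and lim: "\<And>z w. z \<in> R \<Longrightarrow> w \<in> R \<Longrightarrow> (\<lambda>k. Km k z w) \<longlonglongrightarrow> K z w"
    and ok: "\<And>k. orthogonal_kernel lborel (m k) (\<psi> k) (l k)"
    and Km: "\<And>k z w. (\<Sum>a<m k. \<psi> k a z * cnj (\<psi> k a w)) = restrict_kernel R (Km k) z w"
    and l: "\<And>k a. a < m k \<Longrightarrow> 0 \<le> l k a" and T: "\<And>k. (\<Sum>a<m k. l k a) \<le> T"
  shows "(\<lambda>k. \<Prod>a<m k. 1 + t * complex_of_real (l k a)) \<longlonglongrightarrow> (\<integral>\<omega>. (1 + t) ^ card (Z \<omega> \<inter> R) \<partial>M)"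
proof -
  have eq: "(\<lambda>z w. \<Sum>a<m k. \<psi> k a z * cnj (\<psi> k a w)) = restrict_kernel R (Km k)" for k
    using Km by (intro ext) auto
  note ik = orthogonal_kernel.integral_kernel_det[OF ok, unfolded eq]
  have Rf: "R \<in> sets lborel" "emeasure lborel R < \<infinity>"
    using borel_compact[OF R(1)] emeasure_compact_finite[OF R(1)] by auto
  note lk = lborel.kernel_det_restrict_kernel_limit[OF Rf B lim ik(1)]
  define c where "c = (\<lambda>n. Re (\<integral>x. kernel_det n (restrict_kernel R K) x \<partial>Pi\<^sub>M {..<n} (\<lambda>_. lborel)) / fact n)"
  have lim1: "(\<lambda>k. complex_of_real (fact n * esym n (m k) (l k))) \<longlonglongrightarrow> (\<integral>x. kernel_det n (restrict_kernel R K) x \<partial>Pi\<^sub>M {..<n} (\<lambda>_. lborel))" for n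
    using lk(2)[of n] unfolding ik(2) .
  have I: "(\<integral>x. kernel_det n (restrict_kernel R K) x \<partial>Pi\<^sub>M {..<n} (\<lambda>_. lborel)) = complex_of_real (fact n * c n)" for n
  proof -
    have "(\<integral>x. kernel_det n (restrict_kernel R K) x \<partial>Pi\<^sub>M {..<n} (\<lambda>_. lborel)) \<in> \<real>"
      by (rule closed_sequentially[OF closed_complex_Reals _ lim1]) (rule Reals_of_real)
    then show ?thesis unfolding c_def by (simp add: of_real_Re flip: of_real_mult)
  qed
  have lim2: "(\<lambda>k. esym n (m k) (l k)) \<longlonglongrightarrow> c n" for n
  proof -
    have "(\<lambda>k. fact n * esym n (m k) (l k)) \<longlonglongrightarrow> fact n * c n"
      using tendsto_Re[OF lim1[of n]] unfolding I Re_complex_of_real .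
    from tendsto_divide[OF this tendsto_const[of "fact n"]] show ?thesis by simp
  qed
  have T0: "0 \<le> T" using T[of 0] sum_nonneg[of "{..<m 0}" "l 0"] l by fastforce
  have es: "esym n (m k) (l k) \<le> T ^ n / fact n" for n k
    using esym_le[OF l] T[of k] by (meson divide_right_mono fact_ge_zero l lessThan_iff order_trans power_mono sum_nonneg)
  have es0: "0 \<le> esym n (m k) (l k)" for n k by (rule esym_nonneg) (rule l)
  have c: "c n \<le> T ^ n / fact n" for n
    by (rule LIMSEQ_le_const2[OF lim2]) (use es in auto)
  have gen: "(\<lambda>n. complex_of_real (c n) * t ^ n) sums (\<integral>\<omega>. (1 + t) ^ card (Z \<omega> \<inter> R) \<partial>M)"
    by (rule determinantal_generating_function[OF D R lk(1) I c])
  have zero: "esym n (m k) (l k) = 0" if "n > m k" for n k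
    unfolding esym_def using that card_mono[of "{..<m k}"] by (intro sum.neutral) (fastforce dest: card_mono[rotated])
  have fin: "(\<Prod>a<m k. 1 + t * complex_of_real (l k a)) = (\<Sum>n. complex_of_real (esym n (m k) (l k)) * t ^ n)" for k
    unfolding prod_eq_sum_esym by (rule suminf_finite[symmetric]) (auto simp: zero)
  have "(\<lambda>k. \<Sum>n. complex_of_real (esym n (m k) (l k)) * t ^ n) \<longlonglongrightarrow> (\<Sum>n. complex_of_real (c n) * t ^ n)"
  proof (rule tannerys_theorem[where M = "\<lambda>n. (T * norm t) ^ n / fact n", THEN conjunct2, THEN conjunct2])
    show "(\<lambda>k. complex_of_real (esym n (m k) (l k)) * t ^ n) \<longlonglongrightarrow> complex_of_real (c n) * t ^ n" for n
      by (intro tendsto_intros lim2)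
    have "norm (complex_of_real (esym n (m k) (l k)) * t ^ n) \<le> (T * norm t) ^ n / fact n" for n k
      using mult_right_mono[OF es, of "norm t ^ n" n k] es0[of n k]
      by (simp add: norm_mult norm_power power_mult_distrib)
    then show "\<forall>\<^sub>F (n, k) in at_top \<times>\<^sub>F sequentially. norm (complex_of_real (esym n (m k) (l k)) * t ^ n) \<le> (T * norm t) ^ n / fact n"
      by (intro always_eventually) auto
    show "summable (\<lambda>n. (T * norm t) ^ n / fact n)"
      using summable_exp[of "T * norm t"] by (simp add: field_simps)
  qed simp
  then show ?thesis unfolding fin sums_unique[OF gen] .
qed

section \<open>Vitali's theorem\<close>

definition locally_bounded_family :: "'i set \<Rightarrow> complex set \<Rightarrow> ('i \<Rightarrow> complex \<Rightarrow> complex) \<Rightarrow> bool" where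
  "locally_bounded_family I S f \<longleftrightarrow>
     (\<forall>i\<in>I. f i holomorphic_on S) \<and> (\<forall>K. compact K \<and> K \<subseteq> S \<longrightarrow> (\<exists>B. \<forall>i\<in>I. \<forall>z\<in>K. cmod (f i z) \<le> B))"

lemma montel_sequence:
  fixes f :: "nat \<Rightarrow> complex \<Rightarrow> complex"
  assumes "open S" "locally_bounded_family UNIV S f"
  obtains g r where "g holomorphic_on S" "strict_mono (r :: nat \<Rightarrow> nat)"
    "\<And>z. z \<in> S \<Longrightarrow> (\<lambda>n. f (r n) z) \<longlonglongrightarrow> g z"
    "\<And>K. compact K \<Longrightarrow> K \<subseteq> S \<Longrightarrow> uniform_limit K (f \<circ> r) g sequentially"
proof (rule Montel[of S "range f" f])
  show "open S" by fact
  show "h holomorphic_on S" if "h \<in> range f" for h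
    using assms(2) that unfolding locally_bounded_family_def by auto
  show "\<exists>B. \<forall>h\<in>range f. \<forall>z\<in>K. cmod (h z) \<le> B" if "compact K" "K \<subseteq> S" for K
    using assms(2) that unfolding locally_bounded_family_def by auto
qed (auto intro: that)

lemma holomorphic_pointwise_limit:
  assumes "open S" "locally_bounded_family UNIV S f" and lim: "\<And>z. z \<in> S \<Longrightarrow> (\<lambda>n. f n z) \<longlonglongrightarrow> g z"
  shows "g holomorphic_on S"
proof -
  obtain h and r :: "nat \<Rightarrow> nat" where h: "h holomorphic_on S" "strict_mono r" "\<And>z. z \<in> S \<Longrightarrow> (\<lambda>n. f (r n) z) \<longlonglongrightarrow> h z"
    using montel_sequence[OF assms(1,2)] by metis
  have "h z = g z" if "z \<in> S" for z
    using LIMSEQ_unique[OF h(3)[OF that]] LIMSEQ_subseq_LIMSEQ[OF lim[OF that] h(2)] by (simp add: o_def)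
  then show ?thesis using h(1) holomorphic_transform by metis
qed

text \<open>
By Montel's theorem every sequence $L_n\to\infty$ has a subsequence along which \<open>f\<close> converges locally uniformly, and
the identity theorem forces all these limits to agree, because they agree on the set \<open>E\<close>.
\<close>

theorem vitali_at_top:
  fixes f :: "real \<Rightarrow> complex \<Rightarrow> complex"
  assumes S: "open S" "connected S" and lb: "locally_bounded_family {0<..} S f"
    and E: "E \<subseteq> S" "\<zeta> \<in> S" "\<zeta> islimpt E" and lim: "\<And>z. z \<in> E \<Longrightarrow> \<exists>l. ((\<lambda>L. f L z) \<longlongrightarrow> l) at_top"
  obtains D where "D holomorphic_on S" "\<And>K. compact K \<Longrightarrow> K \<subseteq> S \<Longrightarrow> uniform_limit K f D at_top"
proof -
  have sub: "locally_bounded_family UNIV S (\<lambda>n. f (X n))" if "\<And>n. 0 < X n" for X :: "nat \<Rightarrow> real"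
    unfolding locally_bounded_family_def
  proof (intro conjI ballI allI impI)
    show "f (X i) holomorphic_on S" for i
      using lb that unfolding locally_bounded_family_def by auto
    fix K assume "compact K \<and> K \<subseteq> S"
    then obtain B where "\<forall>i\<in>{0<..}. \<forall>z\<in>K. cmod (f i z) \<le> B"
      using lb unfolding locally_bounded_family_def by blast
    then show "\<exists>B. \<forall>i\<in>UNIV. \<forall>z\<in>K. cmod (f (X i) z) \<le> B" using that by (intro exI[of _ B]) auto
  qed
  have sub1: "locally_bounded_family UNIV S (\<lambda>n. f (real (Suc n)))" by (rule sub) simp
  obtain D r0 where D: "D holomorphic_on S" and r0: "strict_mono (r0 :: nat \<Rightarrow> nat)"
    and limD: "\<And>z. z \<in> S \<Longrightarrow> (\<lambda>n. f (real (Suc (r0 n))) z) \<longlonglongrightarrow> D z"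
    by (rule montel_sequence[OF S(1) sub1], rule that)
  have top: "filterlim (\<lambda>n. X (r n)) at_top sequentially"
    if "filterlim X at_top sequentially" "strict_mono (r :: nat \<Rightarrow> nat)" for X :: "nat \<Rightarrow> real" and r
    using filterlim_compose[OF that(1) filterlim_subseq[OF that(2)]] .
  have limE: "((\<lambda>L. f L z) \<longlongrightarrow> D z) at_top" if z: "z \<in> E" for z
  proof -
    obtain l where l: "((\<lambda>L. f L z) \<longlongrightarrow> l) at_top" using lim[OF z] by blast
    have "filterlim (\<lambda>n. real (Suc n)) at_top sequentially"
      using filterlim_compose[OF filterlim_real_sequentially filterlim_Suc] .
    from filterlim_compose[OF l top[OF this r0]] have "l = D z"
      using limD[of z] z E(1) LIMSEQ_unique by blast
    then show ?thesis using l by simp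
  qed
  have "uniform_limit K f D at_top" if K: "compact K" "K \<subseteq> S" for K
  proof (rule ccontr)
    assume "\<not> ?thesis"
    then obtain e where e: "e > 0" and "\<not> (\<forall>\<^sub>F L in at_top. \<forall>z\<in>K. dist (f L z) (D z) < e)"
      unfolding uniform_limit_iff by blast
    then have "\<exists>L>real (Suc n). \<exists>z\<in>K. e \<le> dist (f L z) (D z)" for n
      unfolding eventually_at_top_dense by (metis not_less)
    then obtain X where X: "\<And>n. X n > real (Suc n)" "\<And>n. \<exists>z\<in>K. e \<le> dist (f (X n) z) (D z)" by metis
    have Xp: "0 < X n" for n using X(1)[of n] by (meson less_trans of_nat_0_less_iff zero_less_Suc)
    have Xtop: "filterlim X at_top sequentially"
      by (rule filterlim_at_top_mono[OF filterlim_real_sequentially])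
         (intro always_eventually allI, smt (verit) X(1) of_nat_Suc)
    obtain g r where g: "g holomorphic_on S" and r: "strict_mono (r :: nat \<Rightarrow> nat)"
      and limg: "\<And>z. z \<in> S \<Longrightarrow> (\<lambda>n. f (X (r n)) z) \<longlonglongrightarrow> g z"
      and ug: "\<And>K. compact K \<Longrightarrow> K \<subseteq> S \<Longrightarrow> uniform_limit K ((\<lambda>n. f (X n)) \<circ> r) g sequentially"
      by (rule montel_sequence[OF S(1) sub[OF Xp]], rule that)
    have gE: "g z - D z = 0" if "z \<in> E" for z
      using LIMSEQ_unique[OF limg filterlim_compose[OF limE[OF that] top[OF Xtop r]]] that E(1) by auto
    have gD: "g z = D z" if "z \<in> S" for z
      using analytic_continuation[of "\<lambda>z. g z - D z" S E \<zeta> z] g D S E gE that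
      by (auto intro!: holomorphic_intros)
    have ev: "\<forall>\<^sub>F n in sequentially. \<forall>z\<in>K. dist (f (X (r n)) z) (g z) < e"
      using uniform_limitD[OF ug[OF K] e] by (simp add: o_def)
    have "\<exists>n. \<forall>z\<in>K. dist (f (X (r n)) z) (g z) < e"
      by (rule eventually_happens'[OF _ ev]) simp
    then obtain n where n: "\<forall>z\<in>K. dist (f (X (r n)) z) (g z) < e" ..
    obtain z where z: "z \<in> K" "e \<le> dist (f (X (r n)) z) (D z)" using X(2) by blast
    then show False using n gD[of z] K(2) by fastforce
  qed
  then show ?thesis using that D by blast
qed

section \<open>Logarithms on the slit plane\<close>

lemma q_I_pos: "\<alpha> < \<beta> \<Longrightarrow> 0 < \<xi> \<Longrightarrow> 0 < q_I \<alpha> \<beta> \<xi>"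
  unfolding q_I_def by simp

lemma q_I_le_exp: "q_I \<alpha> \<beta> \<xi> \<le> exp (- 2 * \<alpha> * \<xi>)"
  unfolding q_I_def by simp

lemma q_I_le_rho:
  assumes "0 < \<alpha>" "0 < \<xi>" shows "q_I \<alpha> \<beta> \<xi> \<le> rho_I \<alpha> \<beta>"
  unfolding rho_I_def
proof (rule cSUP_upper)
  have "q_I \<alpha> \<beta> x \<le> 1" if "0 < x" for x
    using q_I_le_exp[of \<alpha> \<beta> x] that assms(1) by (smt (verit) exp_le_one_iff mult_nonneg_nonneg mult_minus_left)
  then show "bdd_above (q_I \<alpha> \<beta> ` {0<..})" by (intro bdd_aboveI[of _ 1]) auto
qed (use assms in auto)

lemma rho_I_pos: "0 < \<alpha> \<Longrightarrow> \<alpha> < \<beta> \<Longrightarrow> 0 < rho_I \<alpha> \<beta>"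
  using q_I_pos[of \<alpha> \<beta> 1] q_I_le_rho[of \<alpha> 1 \<beta>] by simp

text \<open>
The set of \<open>t\<close> for which $1+tx$ avoids the closed negative half-line for all $x\in[0,\rho]$. With
$\rho=\rho_I$ this is $\Omega_I$.
\<close>

definition slit :: "real \<Rightarrow> complex set" where
  "slit \<rho> = - (complex_of_real ` {..- (1 / \<rho>)})"

lemma Omega_slit: "Omega_I \<alpha> \<beta> = slit (rho_I \<alpha> \<beta>)"
  unfolding Omega_I_def slit_def ..

lemma open_slit: "open (slit \<rho>)"
proof -
  have "complex_of_real ` {..- (1 / \<rho>)} = {z. Im z = 0} \<inter> {z. Re z \<le> - (1 / \<rho>)}"
    by (auto simp: complex_eq_iff image_iff)
  moreover have "closed \<dots>" by (intro closed_Int closed_halfspace_Re_le closed_Collect_eq continuous_intros)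
  ultimately have "closed (complex_of_real ` {..- (1 / \<rho>)})" by simp
  then show ?thesis unfolding slit_def by (rule open_Compl)
qed

lemma slit_iff: "z \<in> slit \<rho> \<longleftrightarrow> Im z \<noteq> 0 \<or> Re z > - (1 / \<rho>)"
  unfolding slit_def by (auto simp: complex_eq_iff image_iff not_le)

lemma connected_slit: 
  assumes "0 < \<rho>" shows "connected (slit \<rho>)"
proof (rule starlike_imp_connected)
  have "closed_segment 0 z \<subseteq> slit \<rho>" if z: "z \<in> slit \<rho>" for z
  proof
    fix w assume "w \<in> closed_segment 0 z"
    then obtain u where u: "0 \<le> u" "u \<le> 1" "w = of_real u * z"
      by (auto simp: closed_segment_def scaleR_conv_of_real)
    show "w \<in> slit \<rho>"
    proof (cases "u = 0 \<or> Im z \<noteq> 0")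
      case True
      then show ?thesis using u assms by (cases "u = 0") (auto simp: slit_iff)
    next
      case False
      then have "Re z > - (1 / \<rho>)" using z slit_iff by blast
      then have "u * Re z > - (1 / \<rho>)"
      proof (cases "Re z \<ge> 0")
        case True
        then have "u * Re z \<ge> 0" using u by simp
        then show ?thesis using assms by (smt (verit) divide_pos_pos)
      next
        case False
        then have "u * Re z \<ge> 1 * Re z" using u by (intro mult_right_mono_neg) auto
        then show ?thesis using \<open>Re z > - (1 / \<rho>)\<close> by simp
      qed
      then show ?thesis using u by (simp add: slit_iff)
    qed
  qed
  moreover have "0 \<in> slit \<rho>" using assms by (simp add: slit_iff)
  ultimately show "starlike (slit \<rho>)" unfolding starlike_def by blast
qed

lemma zero_in_slit: "0 < \<rho> \<Longrightarrow> 0 \<in> slit \<rho>"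
  by (simp add: slit_iff)

lemma slit_Ln_domain:
  assumes "0 < \<rho>" "t \<in> slit \<rho>" "0 \<le> x" "x \<le> \<rho>"
  shows "1 + t * complex_of_real x \<notin> \<real>\<^sub>\<le>\<^sub>0"
proof
  assume "1 + t * complex_of_real x \<in> \<real>\<^sub>\<le>\<^sub>0"
  then have h: "1 + Re t * x \<le> 0" "Im t * x = 0" by (auto simp: complex_nonpos_Reals_iff)
  then have x: "x > 0" using assms(3) by (cases "x = 0") auto
  then have "Re t \<le> - (1 / x)" using h by (simp add: field_simps)
  moreover have "1 / \<rho> \<le> 1 / x" using x assms by (intro divide_left_mono) auto
  ultimately have "Re t \<le> - (1 / \<rho>)" by simp
  moreover have "Im t = 0" using h x by simp
  ultimately show False using assms(2) slit_iff by auto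
qed

definition bounded_away :: "real \<Rightarrow> complex \<Rightarrow> real \<Rightarrow> bool" where
  "bounded_away \<rho> t c \<longleftrightarrow> 0 < c \<and> (\<forall>x\<in>{0..\<rho>}. c \<le> cmod (1 + t * complex_of_real x))"

lemma slit_uniform_lower_bound:
  assumes "0 < \<rho>" "compact K" "K \<subseteq> slit \<rho>"
  obtains c where "0 < c" "\<And>t. t \<in> K \<Longrightarrow> bounded_away \<rho> t c"
proof (cases "K = {}")
  case True
  then show ?thesis using that[of 1] by auto
next
  case False
  let ?g = "\<lambda>(t, x). cmod (1 + t * complex_of_real x)"
  have cpt: "compact (K \<times> {0..\<rho>})" using assms by (intro compact_Times) auto
  have cont: "continuous_on (K \<times> {0..\<rho>}) ?g"
    unfolding case_prod_unfold by (intro continuous_intros)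
  obtain p where p: "p \<in> K \<times> {0..\<rho>}" "\<forall>y\<in>K \<times> {0..\<rho>}. ?g p \<le> ?g y"
    using continuous_attains_inf[OF cpt _ cont] False assms(1) by auto
  have "?g p > 0"
    using slit_Ln_domain[OF assms(1), of "fst p" "snd p"] p(1) assms(3)
    by (auto simp: case_prod_unfold)
  then show ?thesis using p(2) by (intro that[of "?g p"]) (auto simp: bounded_away_def)
qed

text \<open>
The first two derivatives of $x\mapsto\log(1+tx)$ on $[0,\rho]$ are bounded by $|t|/c$ and $(|t|/c)^2$.
\<close>

lemma Ln_taylor_bounds:
  assumes "0 < \<rho>" "t \<in> slit \<rho>" and away: "bounded_away \<rho> t c"
    and xy: "0 \<le> x" "x \<le> \<rho>" "0 \<le> y" "y \<le> \<rho>"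
  shows "cmod (Ln (1 + t * complex_of_real x)) \<le> cmod t / c * x"
    "cmod (Ln (1 + t * complex_of_real x) - Ln (1 + t * complex_of_real y)
        - t / (1 + t * complex_of_real y) * complex_of_real (x - y)) \<le> (cmod t / c)\<^sup>2 * (x - y)\<^sup>2"
proof -
  have c: "c > 0" "\<And>x. 0 \<le> x \<Longrightarrow> x \<le> \<rho> \<Longrightarrow> c \<le> cmod (1 + t * complex_of_real x)"
    using away unfolding bounded_away_def by auto
  define S where "S = complex_of_real ` {0..\<rho>}"
  have cS: "convex S" unfolding S_def
    by (intro convex_linear_image bounded_linear.linear bounded_linear_of_real) auto
  define f where "f = (\<lambda>i z. if i = (0::nat) then Ln (1 + t * z) else if i = 1 then t / (1 + t * z)
      else - (t / (1 + t * z))\<^sup>2)"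
  have dom: "1 + t * z \<notin> \<real>\<^sub>\<le>\<^sub>0" "1 + t * z \<noteq> 0" and low: "c \<le> cmod (1 + t * z)" if "z \<in> S" for z
    using slit_Ln_domain[OF assms(1,2)] c(2) that unfolding S_def by (force, force, force)
  have der: "(f i has_field_derivative f (Suc i) z) (at z within S)" if "z \<in> S" "i \<le> 1" for i z
  proof -
    have "((\<lambda>z. Ln (1 + t * z)) has_field_derivative t / (1 + t * z)) (at z within S)"
      using dom[OF that(1)] by (auto intro!: derivative_eq_intros simp: field_simps)
    moreover have "((\<lambda>z. t / (1 + t * z)) has_field_derivative - (t / (1 + t * z))\<^sup>2) (at z within S)"
      using dom[OF that(1)] by (auto intro!: derivative_eq_intros simp: field_simps power2_eq_square)
    ultimately show ?thesis using that(2) unfolding f_def by (cases "i = 0") auto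
  qed
  have b1: "cmod (t / (1 + t * z)) \<le> cmod t / c" if "z \<in> S" for z
    using low[OF that] c(1) by (simp add: norm_divide frac_le)
  then have b2: "cmod (f 2 z) \<le> (cmod t / c)\<^sup>2" if "z \<in> S" for z
    using that unfolding f_def by (simp add: norm_power power_mono)
  have b1': "cmod (f (Suc 0) z) \<le> cmod t / c" if "z \<in> S" for z
    using b1[OF that] by (simp add: f_def)
  have xS: "complex_of_real x \<in> S" "complex_of_real y \<in> S" "0 \<in> S"
    unfolding S_def using xy assms(1) by (auto simp: image_iff intro: bexI[of _ 0])
  show "cmod (Ln (1 + t * complex_of_real x)) \<le> cmod t / c * x"
  proof -
    have "cmod (f 0 (complex_of_real x) - (\<Sum>i\<le>0. f i 0 * (complex_of_real x - 0) ^ i / fact i))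
        \<le> cmod t / c * cmod (complex_of_real x - 0) ^ Suc 0 / fact 0"
      by (rule complex_Taylor[where f = f and n = 0 and S = S, OF cS]) (use der b1' xS in auto)
    then show ?thesis using xy by (simp add: f_def)
  qed
  have "cmod (f 0 (complex_of_real x) - (\<Sum>i\<le>1. f i (complex_of_real y) * (complex_of_real x - complex_of_real y) ^ i / fact i))
     \<le> (cmod t / c)\<^sup>2 * cmod (complex_of_real x - complex_of_real y) ^ Suc 1 / fact 1"
    by (rule complex_Taylor[where f = f and n = 1 and S = S, OF cS]) (use der b2 xS in \<open>auto simp: numeral_2_eq_2\<close>)
  moreover have "cmod (complex_of_real x - complex_of_real y) = \<bar>x - y\<bar>"
    by (metis norm_of_real of_real_diff)
  ultimately show "cmod (Ln (1 + t * complex_of_real x) - Ln (1 + t * complex_of_real y)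
        - t / (1 + t * complex_of_real y) * complex_of_real (x - y)) \<le> (cmod t / c)\<^sup>2 * (x - y)\<^sup>2"
    by (simp add: f_def atMost_Suc diff_diff_eq power2_eq_square[of "x - y"] algebra_simps flip: abs_mult)
qed

lemma Ln_real_on_slit:
  assumes "0 < \<rho>" "- (1 / \<rho>) < y" "0 \<le> x" "x \<le> \<rho>"
  shows "Ln (1 + complex_of_real y * complex_of_real x) = complex_of_real (ln (1 + y * x))" "0 < 1 + y * x"
proof -
  have "1 + complex_of_real y * complex_of_real x \<notin> \<real>\<^sub>\<le>\<^sub>0"
    using assms by (intro slit_Ln_domain[OF assms(1)]) (auto simp: slit_iff)
  then show p: "0 < 1 + y * x" by (auto simp: complex_nonpos_Reals_iff)
  then show "Ln (1 + complex_of_real y * complex_of_real x) = complex_of_real (ln (1 + y * x))"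
    by (metis Ln_of_real of_real_1 of_real_add of_real_mult)
qed

section \<open>Riemann sums on the half-line\<close>

definition mesh :: "nat \<Rightarrow> real" where "mesh k = 1 / (real k + 1)"
text \<open>
With this number of points the nodes reach up to $k+1$, so that they exhaust the half-line while the mesh tends
to $0$.
\<close>

definition npts :: "nat \<Rightarrow> nat" where "npts k = (k + 1)\<^sup>2"
text \<open>
Numbering from $1$ keeps the nodes positive, and it makes the Riemann sum of a decreasing function a lower sum,
so that an exponential bound on the summand dominates the step functions as well.
\<close>

definition node :: "nat \<Rightarrow> nat \<Rightarrow> real" where "node k j = (real j + 1) * mesh k"

lemma mesh_pos: "0 < mesh k" unfolding mesh_def by simp
lemma node_pos: "0 < node k j" unfolding node_def using mesh_pos by simp

lemma integrable_exp_Ioi: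
  assumes "a > 0"
  shows "integrable lborel (\<lambda>x::real. indicator {0<..} x * exp (- a * x))"
proof -
  have "(\<integral>\<^sup>+x\<in>{0..}. ennreal (exp (- a * x)) \<partial>lborel) = ennreal (0 - (- exp (- a * 0) / a))"
  proof (rule nn_integral_FTC_atLeast)
    show "((\<lambda>x. - exp (- a * x) / a) \<longlongrightarrow> 0) at_top"
      using assms by real_asymp
    fix x :: real
    show "((\<lambda>x. - exp (- a * x) / a) has_field_derivative exp (- a * x)) (at x)"
      using assms by (auto intro!: derivative_eq_intros simp: field_simps)
  qed (use assms in auto)
  then have "integrable lborel (\<lambda>x::real. indicator {0..} x * exp (- a * x))"
    by (intro integrableI_nonneg) (auto simp: nn_integral_set_ennreal mult.commute ennreal_indicator[symmetric] ennreal_mult' less_top[symmetric] split: split_indicator)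
  moreover have "AE x in lborel. indicator {0..} x * exp (- a * x) = indicator {0<..} x * exp (- a * (x::real))"
    using AE_lborel_singleton[of 0] by eventually_elim (auto split: split_indicator)
  ultimately show ?thesis by (subst integrable_cong_AE[symmetric]) auto
qed

text \<open>
The Riemann sum is the integral of a step function that takes at $x$ the value of \<open>f\<close> at the node to the right of
$x$; the step functions obey the exponential bound of \<open>f\<close>, and dominated convergence applies.
\<close>

theorem riemann_sum_tendsto:
  fixes f :: "real \<Rightarrow> complex"
  assumes cont: "\<And>x. 0 < x \<Longrightarrow> isCont f x" and a: "a > 0" 
    and bound: "\<And>x. 0 < x \<Longrightarrow> cmod (f x) \<le> C * exp (- a * x)"
  shows "(\<lambda>k. complex_of_real (mesh k) * (\<Sum>j<npts k. f (node k j))) \<longlonglongrightarrow> (LINT x:{0<..}|lborel. f x)"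
proof -
  define g where "g = (\<lambda>k x. \<Sum>j<npts k. indicator {real j * mesh k<..node k j} x *\<^sub>R f (node k j))"
  have ceil_ge: "x \<le> mesh k * of_int \<lceil>x / mesh k\<rceil>" for x k
  proof -
    have "mesh k * (x / mesh k) \<le> mesh k * of_int \<lceil>x / mesh k\<rceil>"
      by (intro mult_left_mono le_of_int_ceiling less_imp_le mesh_pos)
    then show ?thesis using mesh_pos[of k] by simp
  qed
  have mem: "x \<in> {real j * mesh k<..node k j} \<longleftrightarrow> \<lceil>x / mesh k\<rceil> = int j + 1" for x k j
    unfolding node_def using mesh_pos[of k] by (simp add: ceiling_eq_iff field_simps)
  have g_eq: "g k x = (if 0 < x \<and> x \<le> real k + 1 then f (mesh k * of_int \<lceil>x / mesh k\<rceil>) else 0)" for k x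
  proof (cases "0 < x \<and> x \<le> real k + 1")
    case True
    define j where "j = nat (\<lceil>x / mesh k\<rceil> - 1)"
    have pos: "\<lceil>x / mesh k\<rceil> \<ge> 1" using True mesh_pos[of k] by (simp add: le_ceiling_iff)
    have j: "int j = \<lceil>x / mesh k\<rceil> - 1" unfolding j_def using pos by simp
    then have c1: "\<lceil>x / mesh k\<rceil> = int j + 1" by simp
    have "x / mesh k \<le> (real k + 1) * (real k + 1)"
      using True unfolding mesh_def by (simp add: mult_right_mono)
    then have "\<lceil>x / mesh k\<rceil> \<le> (int k + 1) * (int k + 1)" by (simp add: ceiling_le_iff)
    then have "int j < int ((k + 1)\<^sup>2)" using j by (simp add: power2_eq_square algebra_simps)
    then have jn: "j < npts k" unfolding npts_def by (simp only: of_nat_less_iff)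
    have "g k x = (\<Sum>i<npts k. if i = j then f (node k j) else 0)"
    proof -
      have eqi: "x \<in> {real i * mesh k<..node k i} \<longleftrightarrow> i = j" for i
        unfolding mem using j by auto
      show ?thesis unfolding g_def
        by (intro sum.cong refl) (simp only: indicator_def eqi, simp)
    qed
    also have "\<dots> = f (node k j)" using jn by simp
    also have "node k j = mesh k * of_int \<lceil>x / mesh k\<rceil>"
      unfolding c1 node_def by (simp add: mult.commute)
    finally show ?thesis using True by simp
  next
    case False
    have "indicator {real j * mesh k<..node k j} x = (0::real)" if "j < npts k" for j
    proof -
      have "0 \<le> real j * mesh k" using mesh_pos[of k] by simp
      moreover have "node k j \<le> real k + 1"
      proof -
        have "j + 1 \<le> (k + 1)\<^sup>2" using that unfolding npts_def by simp
        then have "real (j + 1) \<le> real ((k + 1)\<^sup>2)" by (simp only: of_nat_le_iff)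
        then have "real j + 1 \<le> (real k + 1)\<^sup>2" by (simp only: of_nat_power of_nat_add of_nat_1)
        then show ?thesis unfolding node_def mesh_def by (simp add: divide_le_eq power2_eq_square)
      qed
      ultimately show ?thesis using False by (auto simp: indicator_def)
    qed
    then have "g k x = 0" unfolding g_def by simp
    then show ?thesis using False by auto
  qed
  have int_g: "integral\<^sup>L lborel (g k) = complex_of_real (mesh k) * (\<Sum>j<npts k. f (node k j))" for k
  proof -
    have le: "real j * mesh k \<le> node k j" for j unfolding node_def using mesh_pos[of k] by simp
    have "integral\<^sup>L lborel (g k) = (\<Sum>j<npts k. \<integral>x. indicator {real j * mesh k<..node k j} x *\<^sub>R f (node k j) \<partial>lborel)"
      unfolding g_def using le by (intro Bochner_Integration.integral_sum) auto
    also have "\<dots> = (\<Sum>j<npts k. complex_of_real (mesh k) * f (node k j))"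
      using le by (intro sum.cong refl) (simp add: node_def algebra_simps scaleR_conv_of_real)
    finally show ?thesis by (simp add: sum_distrib_left)
  qed
  have "C \<ge> 0" using bound[of 1] norm_ge_zero[of "f 1"] by (smt (verit) exp_gt_zero mult_neg_pos)
  have bnd: "norm (g k x) \<le> C * (indicator {0<..} x * exp (- a * x))" for k x
  proof (cases "0 < x \<and> x \<le> real k + 1")
    case True
    note le = ceil_ge[of x k]
    then have "norm (f (mesh k * of_int \<lceil>x / mesh k\<rceil>)) \<le> C * exp (- a * (mesh k * of_int \<lceil>x / mesh k\<rceil>))"
      using True by (intro bound) linarith
    also have "\<dots> \<le> C * exp (- a * x)" using le a \<open>C \<ge> 0\<close> by (intro mult_left_mono) auto
    finally show ?thesis using True by (simp add: g_eq)
  qed (use \<open>C \<ge> 0\<close> in \<open>auto simp: g_eq indicator_def\<close>)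
  have mesh0: "mesh \<longlonglongrightarrow> 0" unfolding mesh_def by real_asymp
  have ptw: "(\<lambda>k. g k x) \<longlonglongrightarrow> indicator {0<..} x *\<^sub>R f x" for x
  proof (cases "0 < x")
    case True
    have c: "(\<lambda>k. mesh k * of_int \<lceil>x / mesh k\<rceil>) \<longlonglongrightarrow> x"
    proof (rule tendsto_sandwich[where f = "\<lambda>_. x" and h = "\<lambda>k. x + mesh k"])
      show "(\<lambda>k. x + mesh k) \<longlonglongrightarrow> x" using tendsto_add[OF tendsto_const mesh0, of x] by simp
      show "\<forall>\<^sub>F k in sequentially. x \<le> mesh k * of_int \<lceil>x / mesh k\<rceil>"
      proof (intro always_eventually allI)
        fix k show "x \<le> mesh k * of_int \<lceil>x / mesh k\<rceil>" by (rule ceil_ge)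
      qed
      show "\<forall>\<^sub>F k in sequentially. mesh k * of_int \<lceil>x / mesh k\<rceil> \<le> x + mesh k"
      proof (intro always_eventually allI)
        fix k
        have "of_int \<lceil>x / mesh k\<rceil> \<le> x / mesh k + 1" by linarith
        then have "mesh k * of_int \<lceil>x / mesh k\<rceil> \<le> mesh k * (x / mesh k + 1)"
          using mesh_pos[of k] by (intro mult_left_mono) auto
        then show "mesh k * of_int \<lceil>x / mesh k\<rceil> \<le> x + mesh k"
          using mesh_pos[of k] by (simp add: distrib_left)
      qed
    qed simp
    have "(\<lambda>k. f (mesh k * of_int \<lceil>x / mesh k\<rceil>)) \<longlonglongrightarrow> f x"
      by (rule isCont_tendsto_compose[OF cont[OF True] c])
    moreover have "\<forall>\<^sub>F k in sequentially. f (mesh k * of_int \<lceil>x / mesh k\<rceil>) = g k x"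
      using eventually_ge_at_top[of "nat \<lceil>x\<rceil>"]
    proof eventually_elim
      case (elim k)
      then have "x \<le> real k + 1" by linarith
      then show ?case using True by (simp add: g_eq)
    qed
    ultimately show ?thesis using True by (auto intro: Lim_transform_eventually)
  next
    case False
    then show ?thesis by (simp add: g_eq)
  qed
  have mg: "g k \<in> borel_measurable lborel" for k unfolding g_def by measurable
  have "(\<lambda>k. integral\<^sup>L lborel (g k)) \<longlonglongrightarrow> (\<integral>x. indicator {0<..} x *\<^sub>R f x \<partial>lborel)"
    by (rule integral_dominated_convergence[where w = "\<lambda>x. C * (indicator {0<..} x * exp (- a * x))"])
       (use mg bnd ptw integrable_exp_Ioi[OF a] in \<open>auto intro: borel_measurable_LIMSEQ_metric[of g]\<close>)
  then show ?thesis unfolding int_g set_lebesgue_integral_def .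
qed

section \<open>Gram matrices of plane waves\<close>

text \<open>
The value of $\int_a^b e^{i\theta x}\,dx$. The closed form makes additivity in the interval, translation
covariance and vanishing over full periods algebraic identities.
\<close>

definition osc :: "real \<Rightarrow> real \<Rightarrow> real \<Rightarrow> complex" where
  "osc a b \<theta> = (if \<theta> = 0 then complex_of_real (b - a) else (cis (\<theta> * b) - cis (\<theta> * a)) / (\<i> * complex_of_real \<theta>))"

text \<open>
The value of $\int_\alpha^\beta e^{-sy}\,dy$.
\<close>

definition damp :: "real \<Rightarrow> real \<Rightarrow> real \<Rightarrow> real" where
  "damp \<alpha> \<beta> s = (exp (- \<alpha> * s) - exp (- \<beta> * s)) / s"

definition strip :: "real \<Rightarrow> real \<Rightarrow> real \<Rightarrow> real \<Rightarrow> complex set" where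
  "strip \<alpha> \<beta> a b = {z. a \<le> Re z \<and> Re z \<le> b \<and> \<alpha> \<le> Im z \<and> Im z \<le> \<beta>}"

text \<open>
Normalized so that $\sum_j\mathit{wave}_j(z)\overline{\mathit{wave}_j(w)}$ is the Riemann sum of
$\frac1\pi\int_0^\infty\xi e^{i\xi(z-\overline w)}\,d\xi$.
\<close>

definition wave :: "nat \<Rightarrow> nat \<Rightarrow> complex \<Rightarrow> complex" where
  "wave k j z = complex_of_real (sqrt (mesh k * node k j / pi)) * exp (\<i> * complex_of_real (node k j) * z)"

text \<open>
The inner products of the waves on the rectangle $[a,b]\times[\alpha,\beta]$ (\<open>has_integral_gram\<close>).
\<close>

definition gram :: "real \<Rightarrow> real \<Rightarrow> nat \<Rightarrow> real \<Rightarrow> real \<Rightarrow> nat \<Rightarrow> nat \<Rightarrow> complex" where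
  "gram \<alpha> \<beta> k a b i j =
     complex_of_real (sqrt (mesh k * node k i / pi) * sqrt (mesh k * node k j / pi) * damp \<alpha> \<beta> (node k i + node k j))
       * osc a b (node k j - node k i)"

lemma has_integral_osc:
  assumes "a \<le> b"
  shows "has_bochner_integral lborel (\<lambda>x. indicator {a..b} x *\<^sub>R cis (\<theta> * x)) (osc a b \<theta>)"
proof (cases "\<theta> = 0")
  case True
  then show ?thesis
    using has_bochner_integral_scaleR_left[OF has_bochner_integral_real_indicator[of "{a..b}" lborel], of "1 :: complex"] assms
    by (simp add: osc_def of_real_def algebra_simps)
next
  case False
  have "has_bochner_integral lborel (\<lambda>x. indicator {a..b} x *\<^sub>R cis (\<theta> * x))
      (cis (\<theta> * b) / (\<i> * complex_of_real \<theta>) - cis (\<theta> * a) / (\<i> * complex_of_real \<theta>))"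
  proof (rule has_bochner_integral_FTC_Icc[OF assms])
    fix x
    show "((\<lambda>x. cis (\<theta> * x) / (\<i> * complex_of_real \<theta>)) has_vector_derivative cis (\<theta> * x)) (at x within {a..b})"
    proof -
      have "((\<lambda>z. exp (\<i> * complex_of_real \<theta> * z) / (\<i> * complex_of_real \<theta>)) has_field_derivative
          exp (\<i> * complex_of_real \<theta> * complex_of_real x)) (at (complex_of_real x))"
        using False by (auto intro!: derivative_eq_intros)
      from has_vector_derivative_real_field[OF this, of "{a..b}"] show ?thesis
        by (simp add: cis_conv_exp mult.assoc)
    qed
  qed (intro continuous_intros)
  then show ?thesis using False by (simp add: osc_def diff_divide_distrib)
qed

lemma has_integral_damp:
  assumes "\<alpha> \<le> \<beta>" "s > 0"
  shows "has_bochner_integral lborel (\<lambda>y. indicator {\<alpha>..\<beta>} y *\<^sub>R exp (- s * y)) (damp \<alpha> \<beta> s)"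
proof -
  have "has_bochner_integral lborel (\<lambda>y. indicator {\<alpha>..\<beta>} y *\<^sub>R exp (- s * y)) (- exp (- s * \<beta>) / s - (- exp (- s * \<alpha>) / s))"
  proof (rule has_bochner_integral_FTC_Icc[OF assms(1)])
    fix x
    show "((\<lambda>y. - exp (- s * y) / s) has_vector_derivative exp (- s * x)) (at x within {\<alpha>..\<beta>})"
      unfolding has_real_derivative_iff_has_vector_derivative[symmetric]
      using assms(2) by (auto intro!: derivative_eq_intros simp: field_simps)
  qed (intro continuous_intros)
  then show ?thesis by (simp add: damp_def diff_divide_distrib mult.commute)
qed

text \<open>
Lebesgue measure on the complex plane is by construction the image of a product over the basis $\{1,i\}$.
\<close>

lemma has_integral_complex_product:
  fixes f g :: "real \<Rightarrow> 'a :: {real_normed_field, banach, second_countable_topology}"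
  assumes "has_bochner_integral lborel f F" "has_bochner_integral lborel g G"
  shows "has_bochner_integral lborel (\<lambda>z. f (Re z) * g (Im z)) (F * G)"
proof -
  interpret P: product_sigma_finite "\<lambda>_::complex. lborel :: real measure" by standard
  define h where "h = (\<lambda>b::complex. if b = 1 then f else g)"
  have hi: "integrable lborel (h b)" for b using assms unfolding h_def has_bochner_integral_iff by auto
  let ?P = "Pi\<^sub>M Basis (\<lambda>_::complex. lborel :: real measure)"
  let ?T = "\<lambda>x. \<Sum>b\<in>(Basis::complex set). x b *\<^sub>R b"
  have i1: "(\<i>::complex) \<noteq> 1" by (simp add: complex_eq_iff)
  have e: "(\<Prod>b\<in>(Basis::complex set). h b (x b)) = f (Re (?T x)) * g (Im (?T x))" for x
    unfolding Basis_complex_def h_def using i1 by simp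
  have "(\<Prod>b\<in>(Basis::complex set). integral\<^sup>L lborel (h b)) = F * G"
    using assms i1 unfolding Basis_complex_def h_def has_bochner_integral_iff by simp
  then have *: "has_bochner_integral ?P (\<lambda>x. f (Re (?T x)) * g (Im (?T x))) (F * G)"
    using P.product_integrable_prod[of Basis h] P.product_integral_prod[of Basis h] hi
    unfolding e[symmetric] has_bochner_integral_iff by simp
  have m: "?T \<in> measurable ?P borel" by measurable
  have mf: "(\<lambda>z. f (Re z) * g (Im z)) \<in> borel_measurable borel"
    using assms unfolding has_bochner_integral_iff by (auto dest!: borel_measurable_integrable)
  have l: "(lborel :: complex measure) = distr ?P borel ?T"
    unfolding lborel_def[where 'a = complex] lborel_eq_real ..
  show ?thesis using * unfolding l has_bochner_integral_iff integrable_distr_eq[OF m mf] integral_distr[OF m mf] by simp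
qed

lemma cnj_wave_wave:
  "cnj (wave k i z) * wave k j z = complex_of_real (sqrt (mesh k * node k i / pi) * sqrt (mesh k * node k j / pi))
     * (cis ((node k j - node k i) * Re z) * complex_of_real (exp (- (node k i + node k j) * Im z)))"
proof -
  have "cnj (exp (\<i> * complex_of_real s * z)) * exp (\<i> * complex_of_real t * z)
      = cis ((t - s) * Re z) * complex_of_real (exp (- (s + t) * Im z))" for s t
    unfolding exp_cnj cis_conv_exp exp_of_real[symmetric] mult_exp_exp
    by (rule arg_cong[where f = exp]) (simp add: complex_eq_iff algebra_simps)
  then show ?thesis unfolding wave_def by (simp add: mult_ac)
qed

lemma has_integral_gram:
  assumes "a \<le> b" "\<alpha> \<le> \<beta>"
  shows "has_bochner_integral lborel (\<lambda>z. indicator (strip \<alpha> \<beta> a b) z *\<^sub>R (cnj (wave k i z) * wave k j z)) (gram \<alpha> \<beta> k a b i j)"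
proof -
  let ?\<theta> = "node k j - node k i" and ?s = "node k i + node k j"
  let ?c = "complex_of_real (sqrt (mesh k * node k i / pi) * sqrt (mesh k * node k j / pi))"
  have s: "?s > 0" using node_pos[of k i] node_pos[of k j] by simp
  have "has_bochner_integral lborel (\<lambda>z. ?c * ((indicator {a..b} (Re z) *\<^sub>R cis (?\<theta> * Re z)) *
      complex_of_real (indicator {\<alpha>..\<beta>} (Im z) *\<^sub>R exp (- ?s * Im z)))) (?c * (osc a b ?\<theta> * complex_of_real (damp \<alpha> \<beta> ?s)))"
    by (intro has_bochner_integral_mult_right has_integral_complex_product has_integral_osc[OF assms(1)]
         has_bochner_integral_of_real has_integral_damp[OF assms(2) s])
  moreover have "?c * ((indicator {a..b} (Re z) *\<^sub>R cis (?\<theta> * Re z)) * complex_of_real (indicator {\<alpha>..\<beta>} (Im z) *\<^sub>R exp (- ?s * Im z)))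
     = indicator (strip \<alpha> \<beta> a b) z *\<^sub>R (cnj (wave k i z) * wave k j z)" for z
    unfolding cnj_wave_wave strip_def by (auto simp: indicator_def)
  ultimately show ?thesis by (simp add: gram_def mult_ac)
qed

lemma cnj_osc: "cnj (osc a b \<theta>) = osc a b (- \<theta>)"
  unfolding osc_def by (simp add: cis_cnj)

lemma hermitian_gram: "hermitian_on n (gram \<alpha> \<beta> k a b)"
  unfolding hermitian_on_def gram_def by (simp add: cnj_osc add.commute mult_ac)

lemma osc_add: "osc a b \<theta> + osc b c \<theta> = osc a c \<theta>"
  unfolding osc_def by (simp add: diff_divide_distrib)

lemma gram_add: "gram \<alpha> \<beta> k a b i j + gram \<alpha> \<beta> k b c i j = gram \<alpha> \<beta> k a c i j"
  unfolding gram_def by (simp add: osc_add flip: distrib_left)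

lemma osc_shift: "osc (a + h) (b + h) \<theta> = cis (\<theta> * h) * osc a b \<theta>"
  unfolding osc_def by (simp add: distrib_left cis_mult[symmetric] algebra_simps diff_divide_distrib)

text \<open>
Translation of the rectangle multiplies each wave by a phase.
\<close>

lemma gram_shift:
  "gram \<alpha> \<beta> k (a + h) (b + h) i j = cnj (cis (node k i * h)) * gram \<alpha> \<beta> k a b i j * cis (node k j * h)"
  unfolding gram_def osc_shift by (simp add: cis_cnj cis_mult algebra_simps)

lemma gram_quadratic_form:
  assumes "a \<le> b" "\<alpha> \<le> \<beta>"
  shows "herm_ip n (mat_vec n (gram \<alpha> \<beta> k a b) x) x
    = complex_of_real (\<integral>z. indicator (strip \<alpha> \<beta> a b) z * (cmod (\<Sum>j<n. x j * wave k j z))\<^sup>2 \<partial>lborel)"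
proof -
  have "herm_ip n (mat_vec n (gram \<alpha> \<beta> k a b) x) x = (\<Sum>i<n. \<Sum>j<n. (x j * cnj (x i)) * gram \<alpha> \<beta> k a b i j)"
    unfolding herm_ip_def mat_vec_def by (simp add: sum_distrib_left sum_distrib_right mult_ac)
  also have "has_bochner_integral lborel (\<lambda>z. \<Sum>i<n. \<Sum>j<n. (x j * cnj (x i)) * (indicator (strip \<alpha> \<beta> a b) z *\<^sub>R (cnj (wave k i z) * wave k j z))) \<dots>"
    by (intro has_bochner_integral_sum has_bochner_integral_mult_right has_integral_gram assms)
  also have "(\<lambda>z. \<Sum>i<n. \<Sum>j<n. (x j * cnj (x i)) * (indicator (strip \<alpha> \<beta> a b) z *\<^sub>R (cnj (wave k i z) * wave k j z)))
    = (\<lambda>z. complex_of_real (indicator (strip \<alpha> \<beta> a b) z * (cmod (\<Sum>j<n. x j * wave k j z))\<^sup>2))"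
  proof
    fix z
    let ?S = "\<Sum>j<n. x j * wave k j z"
    have "complex_of_real ((cmod ?S)\<^sup>2) = cnj ?S * ?S" by (subst complex_norm_square) (rule mult.commute)
    also have "\<dots> = (\<Sum>i<n. \<Sum>j<n. (x j * cnj (x i)) * (cnj (wave k i z) * wave k j z))"
      by (simp add: sum_distrib_left sum_distrib_right mult_ac)
    finally show "(\<Sum>i<n. \<Sum>j<n. (x j * cnj (x i)) * (indicator (strip \<alpha> \<beta> a b) z *\<^sub>R (cnj (wave k i z) * wave k j z)))
      = complex_of_real (indicator (strip \<alpha> \<beta> a b) z * (cmod ?S)\<^sup>2)"
      by (cases "z \<in> strip \<alpha> \<beta> a b") simp_all
  qed
  finally have "(\<integral>z. complex_of_real (indicator (strip \<alpha> \<beta> a b) z * (cmod (\<Sum>j<n. x j * wave k j z))\<^sup>2) \<partial>lborel)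
      = herm_ip n (mat_vec n (gram \<alpha> \<beta> k a b) x) x" by (rule has_bochner_integral_integral_eq)
  then show ?thesis by (simp only: integral_complex_of_real)
qed

lemma psd_gram: 
  assumes "a \<le> b" "\<alpha> \<le> \<beta>" shows "psd_on n (gram \<alpha> \<beta> k a b)"
  unfolding psd_on_def gram_quadratic_form[OF assms]
  using hermitian_gram by (auto intro!: integral_nonneg_AE)

lemma gram_diag: "a \<le> b \<Longrightarrow> gram \<alpha> \<beta> k a b i i = complex_of_real ((b - a) * mesh k / (2 * pi) * q_I \<alpha> \<beta> (node k i))"
proof -
  have "sqrt (mesh k * node k i / pi) * sqrt (mesh k * node k i / pi) = mesh k * node k i / pi"
    using mesh_pos[of k] node_pos[of k i] by simp
  then show ?thesis using node_pos[of k i]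
    unfolding gram_def osc_def damp_def q_I_def by (simp add: field_simps flip: of_real_mult)
qed

text \<open>
The difference of two distinct nodes is a nonzero multiple of the mesh, so the horizontal factor is the integral of
an exponential over whole periods.
\<close>

lemma gram_period:
  assumes "i \<noteq> j" shows "gram \<alpha> \<beta> k a (a + 2 * pi / mesh k) i j = 0"
proof -
  have t: "node k j - node k i = (real j - real i) * mesh k" unfolding node_def by (simp add: algebra_simps)
  have "cis ((real j - real i) * mesh k * (2 * pi / mesh k)) = cis (2 * pi * of_int (int j - int i))"
    using mesh_pos[of k] by (simp add: mult_ac)
  also have "\<dots> = 1" by (rule cis_multiple_2pi) simp
  finally have "cis ((node k j - node k i) * (a + 2 * pi / mesh k)) = cis ((node k j - node k i) * a)"
    unfolding t distrib_left cis_mult[symmetric] by simp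
  then show ?thesis using assms mesh_pos[of k] unfolding gram_def osc_def t by simp
qed

text \<open>
The box lies in one period of the waves, over which the Gram matrix is diagonal; the rest of the period
contributes a positive form.
\<close>

lemma gram_contraction:
  assumes "0 \<le> L" "L \<le> 2 * pi / mesh k" "\<alpha> \<le> \<beta>"
  shows "Re (herm_ip n (mat_vec n (gram \<alpha> \<beta> k 0 L) x) x) \<le> (\<Sum>i<n. q_I \<alpha> \<beta> (node k i) * (cmod (x i))\<^sup>2)"
proof -
  let ?\<tau> = "2 * pi / mesh k"
  have eq: "gram \<alpha> \<beta> k 0 ?\<tau> i j = (if i = j then complex_of_real (q_I \<alpha> \<beta> (node k i)) else 0)" for i j
    using gram_diag[of 0 ?\<tau> \<alpha> \<beta> k i] gram_period[of i j \<alpha> \<beta> k 0] mesh_pos[of k] by auto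
  have "herm_ip n (mat_vec n (gram \<alpha> \<beta> k 0 ?\<tau>) x) x = (\<Sum>i<n. complex_of_real (q_I \<alpha> \<beta> (node k i)) * x i * cnj (x i))"
    unfolding herm_ip_def mat_vec_def eq by (intro sum.cong refl) (simp add: if_distrib[of "\<lambda>x. x * _"] cong: if_cong)
  also have "\<dots> = complex_of_real (\<Sum>i<n. q_I \<alpha> \<beta> (node k i) * (cmod (x i))\<^sup>2)"
    by (simp add: complex_norm_square mult.assoc flip: of_real_power)
  finally have full: "herm_ip n (mat_vec n (gram \<alpha> \<beta> k 0 ?\<tau>) x) x = complex_of_real (\<Sum>i<n. q_I \<alpha> \<beta> (node k i) * (cmod (x i))\<^sup>2)" .
  have "gram \<alpha> \<beta> k 0 ?\<tau> = (\<lambda>i j. gram \<alpha> \<beta> k 0 L i j + gram \<alpha> \<beta> k L ?\<tau> i j)"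
    by (intro ext gram_add[symmetric])
  then have "herm_ip n (mat_vec n (gram \<alpha> \<beta> k 0 ?\<tau>) x) x = herm_ip n (mat_vec n (gram \<alpha> \<beta> k 0 L) x) x + herm_ip n (mat_vec n (gram \<alpha> \<beta> k L ?\<tau>) x) x"
    by (simp add: mat_vec_add herm_ip_add_left)
  moreover have "0 \<le> Re (herm_ip n (mat_vec n (gram \<alpha> \<beta> k L ?\<tau>) x) x)"
    using psd_gram[OF assms(2,3), of n k] unfolding psd_on_def by blast
  ultimately have "Re (herm_ip n (mat_vec n (gram \<alpha> \<beta> k 0 L) x) x) \<le> Re (herm_ip n (mat_vec n (gram \<alpha> \<beta> k 0 ?\<tau>) x) x)"
    by simp
  then show ?thesis unfolding full Re_complex_of_real .
qed

definition fredholm_det :: "real \<Rightarrow> real \<Rightarrow> nat \<Rightarrow> real \<Rightarrow> real \<Rightarrow> real \<Rightarrow> real" where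
  "fredholm_det \<alpha> \<beta> k t a b = Re (fdet (npts k) (\<lambda>i j. (if i = j then 1 else 0) + complex_of_real t * gram \<alpha> \<beta> k a b i j))"

lemma fredholm_det_eigenbasis:
  assumes "eigenbasis (npts k) (gram \<alpha> \<beta> k a b) u l"
  shows "fredholm_det \<alpha> \<beta> k t a b = (\<Prod>j<npts k. 1 + t * l j)"
proof -
  let ?n = "npts k"
  have mat_vec: "mat_vec ?n (\<lambda>i j. (if i = j then 1 else 0) + complex_of_real t * gram \<alpha> \<beta> k a b i j) x i
      = x i + complex_of_real t * mat_vec ?n (gram \<alpha> \<beta> k a b) x i" if "i < ?n" for x i
  proof -
    have "mat_vec ?n (\<lambda>i j. (if i = j then 1 else 0) + complex_of_real t * gram \<alpha> \<beta> k a b i j) x i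
       = (\<Sum>j<?n. (if i = j then x j else 0) + complex_of_real t * (gram \<alpha> \<beta> k a b i j * x j))"
      unfolding mat_vec_def by (intro sum.cong) (auto simp: algebra_simps)
    then show ?thesis using that unfolding mat_vec_def by (simp add: sum.distrib sum_distrib_left)
  qed
  have "eigenbasis ?n (\<lambda>i j. (if i = j then 1 else 0) + complex_of_real t * gram \<alpha> \<beta> k a b i j) u (\<lambda>j. 1 + t * l j)"
    using assms unfolding eigenbasis_def by (auto simp: mat_vec algebra_simps)
  from fdet_eigenbasis[OF this] show ?thesis unfolding fredholm_det_def by (simp del: of_real_add of_real_mult flip: of_real_prod)
qed

lemma fredholm_det_shift: "fredholm_det \<alpha> \<beta> k t (a + h) (b + h) = fredholm_det \<alpha> \<beta> k t a b"
proof -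
  let ?n = "npts k"
  let ?M = "\<lambda>a b i j. (if i = j then 1 else 0) + complex_of_real t * gram \<alpha> \<beta> k a b i j"
  define w where "w = (\<lambda>a j. if a = j then cis (node k a * h) else 0)"
  have "fdet ?n (congruence ?n w (?M a b)) = fdet ?n (?M (a + h) (b + h))"
  proof (intro arg_cong[of _ _ Determinant.det] to_mat_cong)
    fix i j assume ij: "i < ?n" "j < ?n"
    have "congruence ?n w (?M a b) i j = cnj (cis (node k i * h)) * ?M a b i j * cis (node k j * h)"
      unfolding congruence_def herm_ip_def mat_vec_def w_def using ij
      by (simp add: if_distrib[of "\<lambda>x. _ * x"] if_distrib[of cnj] cong: if_cong)
    then show "congruence ?n w (?M a b) i j = ?M (a + h) (b + h) i j"
      unfolding gram_shift by (auto simp: algebra_simps cis_cnj cis_mult)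
  qed
  moreover have "fdet ?n (\<lambda>a j. cnj (w a j)) * fdet ?n (\<lambda>j b. w b j) = 1"
  proof -
    have 1: "(\<lambda>a j. cnj (w a j)) = (\<lambda>i j. if i = j then cnj (cis (node k i * h)) else 0)"
      and 2: "(\<lambda>j b. w b j) = (\<lambda>i j. if i = j then cis (node k i * h) else 0)"
      by (auto simp: w_def fun_eq_iff)
    show ?thesis unfolding 1 2 fdet_diagonal prod.distrib[symmetric] by (simp add: cis_cnj cis_mult)
  qed
  ultimately have "fdet ?n (?M (a + h) (b + h)) = fdet ?n (?M a b)"
    unfolding fdet_congruence by simp
  then show ?thesis unfolding fredholm_det_def by simp
qed

lemma psd_scale: 
  assumes "psd_on n A" "0 \<le> t" shows "psd_on n (\<lambda>i j. complex_of_real t * A i j)"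
proof -
  have "mat_vec n (\<lambda>i j. complex_of_real t * A i j) x = (\<lambda>i. complex_of_real t * mat_vec n A x i)" for x
    unfolding mat_vec_def by (simp add: sum_distrib_left mult.assoc)
  moreover have "hermitian_on n (\<lambda>i j. complex_of_real t * A i j)"
    unfolding hermitian_on_def
    using hermitian_onD[of n A] assms(1) unfolding psd_on_def by simp
  ultimately show ?thesis using assms unfolding psd_on_def
    by (simp add: herm_ip_scale_left)
qed

text \<open>
The three intervals $[0,c]$, $[c,c+L]$ and $[c+L,c+L+h]$ contribute positive matrices that add up, and only the
lengths of intervals matter for the determinants.
\<close>

lemma fredholm_det_submodular:
  assumes "0 \<le> t" "\<alpha> \<le> \<beta>" "0 \<le> c" "0 \<le> L" "0 \<le> h"
  shows "fredholm_det \<alpha> \<beta> k t 0 (c + L + h) * fredholm_det \<alpha> \<beta> k t 0 L \<le> fredholm_det \<alpha> \<beta> k t 0 (c + L) * fredholm_det \<alpha> \<beta> k t 0 (L + h)"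
proof -
  let ?G = "\<lambda>a b i j. complex_of_real t * gram \<alpha> \<beta> k a b i j"
  let ?M = "\<lambda>a b i j. (if i = j then 1 else 0) + ?G a b i j"
  have psd: "psd_on (npts k) (?G a b)" if "a \<le> b" for a b
    using psd_scale[OF psd_gram[OF that assms(2)] assms(1)] .
  have e1: "(\<lambda>i j. ?M c (c + L) i j + ?G 0 c i j) = ?M 0 (c + L)"
   and e2: "(\<lambda>i j. ?M c (c + L) i j + ?G (c + L) (c + L + h) i j) = ?M c (c + L + h)"
   and e3: "(\<lambda>i j. ?M c (c + L) i j + ?G 0 c i j + ?G (c + L) (c + L + h) i j) = ?M 0 (c + L + h)"
    using gram_add[of \<alpha> \<beta> k 0 c _ _ "c + L"] gram_add[of \<alpha> \<beta> k c "c + L" _ _ "c + L + h"]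
      gram_add[of \<alpha> \<beta> k 0 "c + L" _ _ "c + L + h"]
    by (auto simp: fun_eq_iff algebra_simps simp flip: distrib_left)
  have "ge_id (npts k) (?M c (c + L))"
    using assms by (intro ge_id_add[OF ge_id_identity psd]) auto
  from det_log_submodular[OF this psd[of 0 c] psd[of "c + L" "c + L + h"]]
  have "fredholm_det \<alpha> \<beta> k t 0 (c + L + h) * fredholm_det \<alpha> \<beta> k t c (c + L) \<le> fredholm_det \<alpha> \<beta> k t 0 (c + L) * fredholm_det \<alpha> \<beta> k t c (c + L + h)"
    using assms unfolding fredholm_det_def e1 e2 e3 by simp
  then show ?thesis
    using fredholm_det_shift[of \<alpha> \<beta> k t 0 c L] fredholm_det_shift[of \<alpha> \<beta> k t 0 c "L + h"] by (simp add: add_ac)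
qed

section \<open>The plane-wave representation of the kernel\<close>

lemma set_integrable_exp_bound:
  fixes f :: "real \<Rightarrow> complex"
  assumes "f \<in> borel_measurable borel" "a > 0" "\<And>x. 0 < x \<Longrightarrow> cmod (f x) \<le> C * exp (- a * x)"
  shows "set_integrable lborel {0<..} f"
  unfolding set_integrable_def
proof (rule Bochner_Integration.integrable_bound)
  show "integrable lborel (\<lambda>x. C * (indicator {0<..} x * exp (- a * x)))"
    using integrable_exp_Ioi[OF assms(2)] by simp
  show "AE x in lborel. norm (indicator {0<..} x *\<^sub>R f x) \<le> norm (C * (indicator {0<..} x * exp (- a * x)))"
    using assms(3) by (intro AE_I2) (auto split: split_indicator intro: order_trans[OF _ abs_ge_self])
qed (use assms(1) in measurable)

lemma integral_Ioi_FTC: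
  fixes F f :: "real \<Rightarrow> complex"
  assumes F: "\<And>x. (F has_vector_derivative f x) (at x)" and f: "continuous_on UNIV f"
    and b: "a > 0" "\<And>x. 0 < x \<Longrightarrow> cmod (f x) \<le> C * exp (- a * x)" and lim: "(F \<longlongrightarrow> 0) at_top"
  shows "(LINT x:{0<..}|lborel. f x) = - F 0"
proof -
  have int: "set_integrable lborel (einterval 0 \<infinity>) f"
    using set_integrable_exp_bound[OF borel_measurable_continuous_onI[OF f] b] by (simp add: zero_ereal_def)
  have "isCont F 0" using F[of 0] by (rule has_vector_derivative_continuous)
  then have l0: "(F \<longlongrightarrow> F 0) (at_right 0)"
    unfolding isCont_def by (rule filterlim_mono) (auto simp: at_le)
  have "(LBINT x=0..\<infinity>. f x) = 0 - F 0"
    using int F f lim l0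
    by (intro interval_integral_FTC_integrable)
       (auto simp: zero_ereal_def ereal_tendsto_simps continuous_on_eq_continuous_at)
  then show ?thesis by (simp add: interval_lebesgue_integral_0_infty)
qed

lemma le_exp_div: 
  fixes a x :: real assumes "a > 0" shows "x \<le> exp (a * x) / a"
proof -
  have "x * a \<le> exp (a * x)" using exp_ge_add_one_self[of "a * x"] unfolding mult.commute[of x a] by linarith
  then show ?thesis using assms by (simp add: pos_le_divide_eq)
qed

lemma mult_exp_bound:
  fixes a x :: real assumes "a > 0" "0 < x"
  shows "x * exp (- (2 * a) * x) \<le> 1 / a * exp (- a * x)"
proof -
  have "x * exp (- (2 * a) * x) \<le> exp (a * x) / a * exp (- (2 * a) * x)"
    by (intro mult_right_mono le_exp_div assms) auto
  also have "\<dots> = 1 / a * exp (- a * x)" by (simp add: exp_add[symmetric] algebra_simps)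
  finally show ?thesis .
qed

lemma square_exp_bound:
  fixes a x :: real assumes "a > 0" "0 < x"
  shows "x\<^sup>2 * exp (- (4 * a) * x) \<le> 1 / a\<^sup>2 * exp (- a * x)"
proof -
  have "x\<^sup>2 * exp (- (4 * a) * x) = (x * exp (- (2 * a) * x))\<^sup>2"
    by (simp add: power_mult_distrib exp_double[symmetric])
  also have "\<dots> \<le> (1 / a * exp (- a * x))\<^sup>2"
    using assms by (intro power_mono mult_exp_bound) auto
  also have "\<dots> = 1 / a\<^sup>2 * (exp (- a * x) * exp (- a * x))"
    by (simp add: power_mult_distrib power_divide power2_eq_square)
  also have "\<dots> \<le> 1 / a\<^sup>2 * (1 * exp (- a * x))"
    using assms by (intro mult_left_mono mult_right_mono) auto
  finally show ?thesis by simp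
qed

lemma integral_xi_exp:
  fixes s :: complex
  assumes s: "Re s > 0"
  shows "(LINT x:{0<..}|lborel. complex_of_real x * exp (- s * complex_of_real x)) = 1 / s\<^sup>2"
proof -
  have s0: "s \<noteq> 0" using s by auto
  define F where "F = (\<lambda>z. - (z / s + 1 / s\<^sup>2) * exp (- s * z))"
  have b: "cmod (complex_of_real x * exp (- s * complex_of_real x)) \<le> 1 / (Re s / 2) * exp (- (Re s / 2) * x)" if "0 < x" for x
    using mult_exp_bound[of "Re s / 2" x] s that by (simp add: norm_mult)
  have "(LINT x:{0<..}|lborel. complex_of_real x * exp (- s * complex_of_real x)) = - F (complex_of_real 0)"
  proof (rule integral_Ioi_FTC[where F = "\<lambda>x. F (complex_of_real x)", OF _ _ _ b])
    fix x
    have "(F has_field_derivative complex_of_real x * exp (- s * complex_of_real x)) (at (complex_of_real x))"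
      unfolding F_def using s0 by (auto intro!: derivative_eq_intros simp: field_simps power2_eq_square)
    then show "((\<lambda>x. F (complex_of_real x)) has_vector_derivative complex_of_real x * exp (- s * complex_of_real x)) (at x)"
      by (rule has_vector_derivative_real_field)
  next
    show "((\<lambda>x. F (complex_of_real x)) \<longlongrightarrow> 0) at_top"
    proof (rule Lim_null_comparison)
      show "\<forall>\<^sub>F x in at_top. norm (F (complex_of_real x)) \<le> (x / cmod s + 1 / (cmod s)\<^sup>2) * exp (- Re s * x)"
        using eventually_ge_at_top[of 0]
      proof eventually_elim
        case (elim x)
        have "cmod (complex_of_real x / s + 1 / s\<^sup>2) \<le> x / cmod s + 1 / (cmod s)\<^sup>2"
          using elim by (intro order_trans[OF norm_triangle_ineq]) (simp add: norm_divide norm_power)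
        then show ?case unfolding F_def norm_mult norm_minus_cancel
          using elim by (intro mult_mono) auto
      qed
      show "((\<lambda>x. (x / cmod s + 1 / (cmod s)\<^sup>2) * exp (- Re s * x)) \<longlongrightarrow> 0) at_top"
      proof -
        define m r where "m = cmod s" and "r = Re s"
        have "m > 0" "r > 0" using s s0 unfolding m_def r_def by auto
        then have "((\<lambda>x. (x / m + 1 / m\<^sup>2) * exp (- r * x)) \<longlongrightarrow> 0) at_top" by real_asymp
        then show ?thesis unfolding m_def r_def .
      qed
    qed
  qed (use s in \<open>auto intro!: continuous_intros\<close>)
  then show ?thesis by (simp add: F_def)
qed

lemma integral_xi2_exp:
  fixes s :: real
  assumes s: "s > 0"
  shows "(LINT x:{0<..}|lborel. complex_of_real (x\<^sup>2 * exp (- s * x))) = complex_of_real (2 / s ^ 3)"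
proof -
  define F where "F = (\<lambda>x. - (x\<^sup>2 / s + 2 * x / s\<^sup>2 + 2 / s ^ 3) * exp (- s * x))"
  have b: "cmod (complex_of_real (x\<^sup>2 * exp (- s * x))) \<le> 1 / (s / 4)\<^sup>2 * exp (- (s / 4) * x)" if "0 < x" for x
    using square_exp_bound[of "s / 4" x] s that by (simp del: of_real_mult)
  have "(LINT x:{0<..}|lborel. complex_of_real (x\<^sup>2 * exp (- s * x))) = - complex_of_real (F 0)"
  proof (rule integral_Ioi_FTC[where F = "\<lambda>x. complex_of_real (F x)", OF _ _ _ b])
    fix x
    have "(F has_field_derivative x\<^sup>2 * exp (- s * x)) (at x)"
      unfolding F_def using s by (auto intro!: derivative_eq_intros simp: field_simps power2_eq_square power3_eq_cube)
    then show "((\<lambda>x. complex_of_real (F x)) has_vector_derivative complex_of_real (x\<^sup>2 * exp (- s * x))) (at x)"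
      unfolding has_real_derivative_iff_has_vector_derivative by (rule bounded_linear.has_vector_derivative[OF bounded_linear_of_real])
  next
    have "(F \<longlongrightarrow> 0) at_top" unfolding F_def using s by real_asymp
    from tendsto_of_real[OF this] show "((\<lambda>x. complex_of_real (F x)) \<longlongrightarrow> 0) at_top" by simp
  qed (use s in \<open>auto intro!: continuous_intros\<close>)
  then show ?thesis by (simp add: F_def)
qed

text \<open>
The Riemann sum of $\int_0^\infty\xi e^{-s\xi}\,d\xi=s^{-2}$. At $s=(y+y')-i(x-x')$ it is $\pi$ times the
discretized kernel at $x+iy$, $x'+iy'$.
\<close>

definition phi :: "nat \<Rightarrow> complex \<Rightarrow> complex" where
  "phi k s = complex_of_real (mesh k) * (\<Sum>j<npts k. complex_of_real (node k j) * exp (- s * complex_of_real (node k j)))"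

lemma phi_tendsto:
  assumes "Re s > 0" shows "(\<lambda>k. phi k s) \<longlonglongrightarrow> 1 / s\<^sup>2"
  unfolding phi_def integral_xi_exp[OF assms, symmetric]
proof (rule riemann_sum_tendsto[where a = "Re s / 2" and C = "1 / (Re s / 2)"])
  show "cmod (complex_of_real x * exp (- s * complex_of_real x)) \<le> 1 / (Re s / 2) * exp (- (Re s / 2) * x)" if "0 < x" for x
    using mult_exp_bound[of "Re s / 2" x] assms that by (simp add: norm_mult)
qed (use assms in \<open>auto intro!: continuous_intros\<close>)

text \<open>
The modulus is largest on the real axis at the left end, where the sums converge and hence are bounded.
\<close>

lemma phi_bound:
  assumes "a > 0"
  obtains B where "0 \<le> B" "\<And>k s. a \<le> Re s \<Longrightarrow> cmod (phi k s) \<le> B"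
proof -
  have "Bseq (\<lambda>k. phi k (complex_of_real a))"
    using phi_tendsto[of "complex_of_real a"] assms by (intro convergent_imp_Bseq convergentI) auto
  then obtain B where B: "B > 0" "\<And>k. cmod (phi k (complex_of_real a)) \<le> B" by (auto elim: BseqE)
  have "cmod (phi k s) \<le> B" if "a \<le> Re s" for k s
  proof -
    have "cmod (phi k s) \<le> mesh k * (\<Sum>j<npts k. node k j * exp (- a * node k j))"
      unfolding phi_def norm_mult
    proof (intro mult_mono)
      show "cmod (\<Sum>j<npts k. complex_of_real (node k j) * exp (- s * complex_of_real (node k j))) \<le> (\<Sum>j<npts k. node k j * exp (- a * node k j))"
      proof (rule sum_norm_le)
        fix j
        show "cmod (complex_of_real (node k j) * exp (- s * complex_of_real (node k j))) \<le> node k j * exp (- a * node k j)"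
          using that node_pos[of k j] by (simp add: norm_mult)
      qed
    qed (use mesh_pos[of k] in auto)
    also have "\<dots> = cmod (phi k (complex_of_real a))"
    proof -
      have "phi k (complex_of_real a) = complex_of_real (mesh k * (\<Sum>j<npts k. node k j * exp (- a * node k j)))"
        unfolding phi_def by (simp flip: exp_of_real)
      moreover have "0 \<le> mesh k * (\<Sum>j<npts k. node k j * exp (- a * node k j))"
        using mesh_pos[of k] node_pos[of k] by (intro mult_nonneg_nonneg sum_nonneg) (auto intro: less_imp_le)
      ultimately show ?thesis by (simp del: of_real_mult)
    qed
    finally show ?thesis using B(2)[of k] by simp
  qed
  then show ?thesis using that[of B] B(1) by auto
qed

definition disc_kernel :: "nat \<Rightarrow> complex \<Rightarrow> complex \<Rightarrow> complex" where
  "disc_kernel k z w = (\<Sum>j<npts k. wave k j z * cnj (wave k j w))"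

lemma disc_kernel_phi: "disc_kernel k z w = phi k (- \<i> * (z - cnj w)) / complex_of_real pi"
proof -
  have "wave k j z * cnj (wave k j w) = complex_of_real (mesh k * node k j / pi) * exp (- (- \<i> * (z - cnj w)) * complex_of_real (node k j))" for j
  proof -
    have "complex_of_real (sqrt (mesh k * node k j / pi)) * complex_of_real (sqrt (mesh k * node k j / pi)) = complex_of_real (mesh k * node k j / pi)"
      using mesh_pos[of k] node_pos[of k j] by (simp flip: of_real_mult)
    moreover have "exp (\<i> * complex_of_real (node k j) * z) * cnj (exp (\<i> * complex_of_real (node k j) * w))
       = exp (- (- \<i> * (z - cnj w)) * complex_of_real (node k j))"
      unfolding exp_cnj mult_exp_exp by (rule arg_cong[where f = exp]) (simp add: algebra_simps)
    moreover have "wave k j z * cnj (wave k j w) = (complex_of_real (sqrt (mesh k * node k j / pi)) * complex_of_real (sqrt (mesh k * node k j / pi)))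
       * (exp (\<i> * complex_of_real (node k j) * z) * cnj (exp (\<i> * complex_of_real (node k j) * w)))"
      unfolding wave_def by (simp add: mult_ac del: of_real_mult)
    ultimately show ?thesis by (simp only:)
  qed
  then show ?thesis unfolding disc_kernel_def phi_def by (simp add: sum_distrib_left sum_divide_distrib mult_ac)
qed

lemma disc_kernel_tendsto:
  assumes "0 < Im z" "0 < Im w"
  shows "(\<lambda>k. disc_kernel k z w) \<longlonglongrightarrow> K_H z w"
proof -
  have "(\<lambda>k. phi k (- \<i> * (z - cnj w)) / complex_of_real pi) \<longlonglongrightarrow> 1 / (- \<i> * (z - cnj w))\<^sup>2 / complex_of_real pi"
    using assms by (intro tendsto_intros phi_tendsto) auto
  moreover have "1 / (- \<i> * (z - cnj w))\<^sup>2 / complex_of_real pi = K_H z w"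
    unfolding K_H_def by (simp add: power_mult_distrib mult.commute)
  ultimately show ?thesis unfolding disc_kernel_phi by simp
qed

lemma disc_kernel_bound:
  assumes "\<alpha> > 0"
  obtains B where "0 \<le> B" "\<And>k z w. \<alpha> \<le> Im z \<Longrightarrow> \<alpha> \<le> Im w \<Longrightarrow> cmod (disc_kernel k z w) \<le> B"
proof -
  obtain B where B: "0 \<le> B" "\<And>k s. 2 * \<alpha> \<le> Re s \<Longrightarrow> cmod (phi k s) \<le> B"
    using phi_bound[of "2 * \<alpha>"] assms by auto
  show ?thesis
  proof (rule that[of "B / pi"])
    fix k z w assume "\<alpha> \<le> Im z" "\<alpha> \<le> Im w"
    then show "cmod (disc_kernel k z w) \<le> B / pi"
      unfolding disc_kernel_phi using B(2)[of "- \<i> * (z - cnj w)" k] by (simp add: norm_divide divide_right_mono)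
  qed (use B in auto)
qed

section \<open>The variance in a long box\<close>

text \<open>
The double integral of $e^{i\theta(x-x')}$ over $[0,L]^2$, written as an integral over the distance
$u=|x-x'|$.
\<close>

lemma has_integral_osc_square:
  assumes "0 \<le> L"
  shows "has_bochner_integral lborel (\<lambda>u. indicator {0..L} u *\<^sub>R (2 * (L - u) * cos (\<theta> * u))) ((cmod (osc 0 L \<theta>))\<^sup>2)"
proof (cases "\<theta> = 0")
  case True
  have "has_bochner_integral lborel (\<lambda>u. indicator {0..L} u *\<^sub>R (2 * (L - u))) ((2 * L * L - L\<^sup>2) - (2 * L * 0 - 0\<^sup>2))"
    by (rule has_bochner_integral_FTC_Icc[OF assms])
       (auto intro!: derivative_eq_intros continuous_intros simp: has_real_derivative_iff_has_vector_derivative[symmetric])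
  then show ?thesis using True assms by (simp add: osc_def power2_eq_square)
next
  case False
  define F where "F = (\<lambda>u. 2 * ((L - u) * sin (\<theta> * u) / \<theta> - cos (\<theta> * u) / \<theta>\<^sup>2))"
  have "has_bochner_integral lborel (\<lambda>u. indicator {0..L} u *\<^sub>R (2 * (L - u) * cos (\<theta> * u))) (F L - F 0)"
  proof (rule has_bochner_integral_FTC_Icc[OF assms])
    fix x
    show "(F has_vector_derivative 2 * (L - x) * cos (\<theta> * x)) (at x within {0..L})"
      unfolding has_real_derivative_iff_has_vector_derivative[symmetric] F_def using False
      by (auto intro!: derivative_eq_intros simp: field_simps power2_eq_square)
  qed (intro continuous_intros)
  moreover have "F L - F 0 = (cmod (osc 0 L \<theta>))\<^sup>2"
  proof -
    have "(cmod (cis (\<theta> * L) - 1))\<^sup>2 = (cos (\<theta> * L) - 1)\<^sup>2 + (sin (\<theta> * L))\<^sup>2"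
      by (simp add: cmod_power2)
    also have "\<dots> = 2 - 2 * cos (\<theta> * L)"
      using sin_cos_squared_add[of "\<theta> * L"] by (simp add: power2_diff)
    finally show ?thesis using False
      unfolding osc_def F_def by (simp add: norm_divide norm_mult power_divide field_simps)
  qed
  ultimately show ?thesis by simp
qed

text \<open>
For $c=y+y'$ this is the double integral over $x,x'\in[0,L]$ of the squared modulus of the discretized kernel at
$x+iy$, $x'+iy'$.
\<close>

definition Wsum :: "real \<Rightarrow> nat \<Rightarrow> real \<Rightarrow> real" where
  "Wsum L k c = (\<Sum>i<npts k. \<Sum>j<npts k. (mesh k)\<^sup>2 * node k i * node k j / pi\<^sup>2 * exp (- (node k i + node k j) * c)
      * (cmod (osc 0 L (node k j - node k i)))\<^sup>2)"

text \<open>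
The same integral with $x'$ ranging over a full period of the waves, where the off-diagonal terms vanish.
\<close>

definition Usum :: "real \<Rightarrow> nat \<Rightarrow> real \<Rightarrow> real" where
  "Usum L k c = 2 * L / pi * (mesh k * (\<Sum>j<npts k. (node k j)\<^sup>2 * exp (- (2 * c) * node k j)))"

lemma norm_phi_square:
  "(cmod (phi k (complex_of_real c - \<i> * complex_of_real u)))\<^sup>2
    = (\<Sum>i<npts k. \<Sum>j<npts k. (mesh k)\<^sup>2 * node k i * node k j * exp (- (node k i + node k j) * c) * cos ((node k j - node k i) * u))"
proof -
  define b where "b = (\<lambda>j. node k j * exp (- c * node k j))"
  have ph: "phi k (complex_of_real c - \<i> * complex_of_real u) = complex_of_real (mesh k) * (\<Sum>j<npts k. complex_of_real (b j) * cis (node k j * u))"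
  proof -
    have "exp (- (complex_of_real c - \<i> * complex_of_real u) * complex_of_real n) = complex_of_real (exp (- c * n)) * cis (n * u)" for n
      unfolding cis_conv_exp exp_of_real[symmetric] mult_exp_exp by (rule arg_cong[where f = exp]) (simp add: algebra_simps)
    then show ?thesis unfolding phi_def b_def by (simp add: mult.assoc)
  qed
  let ?S = "\<Sum>j<npts k. complex_of_real (b j) * cis (node k j * u)"
  have "complex_of_real ((cmod ?S)\<^sup>2) = cnj ?S * ?S" by (subst complex_norm_square) (rule mult.commute)
  also have "\<dots> = (\<Sum>i<npts k. \<Sum>j<npts k. complex_of_real (b i * b j) * cis ((node k j - node k i) * u))"
    unfolding cnj_sum sum_product
    by (intro sum.cong refl) (simp add: cis_cnj cis_mult algebra_simps)
  finally have "Re (complex_of_real ((cmod ?S)\<^sup>2)) = (\<Sum>i<npts k. \<Sum>j<npts k. b i * b j * cos ((node k j - node k i) * u))"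
    by (simp only: Re_sum) (simp add: Re_complex_of_real)
  then have S: "(cmod ?S)\<^sup>2 = (\<Sum>i<npts k. \<Sum>j<npts k. b i * b j * cos ((node k j - node k i) * u))"
    by (simp only: Re_complex_of_real)
  have "b i * b j = node k i * node k j * exp (- (node k i + node k j) * c)" for i j
    unfolding b_def by (simp add: exp_add[symmetric] algebra_simps)
  then show ?thesis unfolding ph norm_mult power_mult_distrib S
    by (simp add: sum_distrib_left mult.assoc)
qed

lemma Wsum_integral:
  assumes "0 \<le> L"
  shows "has_bochner_integral lborel (\<lambda>u. indicator {0..L} u *\<^sub>R (2 * (L - u) / pi\<^sup>2 * (cmod (phi k (complex_of_real c - \<i> * complex_of_real u)))\<^sup>2)) (Wsum L k c)"
proof -
  have "has_bochner_integral lborel (\<lambda>u. \<Sum>i<npts k. \<Sum>j<npts k. (mesh k)\<^sup>2 * node k i * node k j / pi\<^sup>2 * exp (- (node k i + node k j) * c)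
      * (indicator {0..L} u *\<^sub>R (2 * (L - u) * cos ((node k j - node k i) * u)))) (Wsum L k c)"
    unfolding Wsum_def by (intro has_bochner_integral_sum has_bochner_integral_mult_right has_integral_osc_square assms)
  also have "(\<lambda>u. \<Sum>i<npts k. \<Sum>j<npts k. (mesh k)\<^sup>2 * node k i * node k j / pi\<^sup>2 * exp (- (node k i + node k j) * c)
      * (indicator {0..L} u *\<^sub>R (2 * (L - u) * cos ((node k j - node k i) * u))))
    = (\<lambda>u. indicator {0..L} u *\<^sub>R (2 * (L - u) / pi\<^sup>2 * (cmod (phi k (complex_of_real c - \<i> * complex_of_real u)))\<^sup>2))"
    unfolding norm_phi_square by (simp add: sum_distrib_left mult_ac)
  finally show ?thesis .
qed

lemma Usum_tendsto:
  assumes "0 < c" shows "(\<lambda>k. Usum L k c) \<longlonglongrightarrow> L / (2 * pi * c ^ 3)"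
proof -
  have "(\<lambda>k. complex_of_real (mesh k) * (\<Sum>j<npts k. complex_of_real ((node k j)\<^sup>2 * exp (- (2 * c) * node k j))))
     \<longlonglongrightarrow> (LINT x:{0<..}|lborel. complex_of_real (x\<^sup>2 * exp (- (2 * c) * x)))"
  proof (rule riemann_sum_tendsto[where a = "c / 2" and C = "1 / (c / 2)\<^sup>2"])
    show "cmod (complex_of_real (x\<^sup>2 * exp (- (2 * c) * x))) \<le> 1 / (c / 2)\<^sup>2 * exp (- (c / 2) * x)" if "0 < x" for x
      using square_exp_bound[of "c / 2" x] assms that by (simp del: of_real_mult)
  qed (use assms in \<open>auto intro!: continuous_intros\<close>)
  then have "(\<lambda>k. Re (complex_of_real (mesh k * (\<Sum>j<npts k. (node k j)\<^sup>2 * exp (- (2 * c) * node k j)))))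
     \<longlonglongrightarrow> Re (complex_of_real (2 / (2 * c) ^ 3))"
    using assms by (intro tendsto_Re) (subst (asm) integral_xi2_exp, auto)
  then have "(\<lambda>k. 2 * L / pi * (mesh k * (\<Sum>j<npts k. (node k j)\<^sup>2 * exp (- (2 * c) * node k j))))
     \<longlonglongrightarrow> 2 * L / pi * (2 / (2 * c) ^ 3)"
    unfolding Re_complex_of_real by (intro tendsto_mult tendsto_const)
  moreover have "2 * L / pi * (2 / (2 * c) ^ 3) = L / (2 * pi * c ^ 3)"
    using assms by (simp add: field_simps power3_eq_cube)
  ultimately show ?thesis unfolding Usum_def by (simp only:)
qed

text \<open>
In the limit the squared modulus of the kernel is $\pi^{-2}(u^2+c^2)^{-2}$ with $u=|x-x'|$. The primitive \<open>F\<close> of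
$(L-u)/(u^2+c^2)^2$ comes from integrating by parts with the antiderivative
$\frac{u}{2c^2(u^2+c^2)}+\frac{\arctan(u/c)}{2c^3}$ of $(u^2+c^2)^{-2}$, which in turn is the derivative of
$\frac{u\arctan(u/c)}{2c^3}$.
\<close>

lemma Wsum_tendsto:
  assumes "0 < c" "0 < L" shows "(\<lambda>k. Wsum L k c) \<longlonglongrightarrow> L * arctan (L / c) / (pi\<^sup>2 * c ^ 3)"
proof -
  define F where "F = (\<lambda>u. (L - u) * (u / (2 * c\<^sup>2 * (u\<^sup>2 + c\<^sup>2)) + arctan (u / c) / (2 * c ^ 3)) + u * arctan (u / c) / (2 * c ^ 3))"
  have pos: "u\<^sup>2 + c\<^sup>2 > 0" for u using assms by (intro add_nonneg_pos) auto
  have dF: "(F has_real_derivative (L - x) / (x\<^sup>2 + c\<^sup>2)\<^sup>2) (at x within {0..L})" for x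
  proof -
    define A B where "A = (\<lambda>u. u / (2 * c\<^sup>2 * (u\<^sup>2 + c\<^sup>2)))" and "B = (\<lambda>u. arctan (u / c))"
    have "1 + (x / c)\<^sup>2 = (x\<^sup>2 + c\<^sup>2) / c\<^sup>2" using assms by (simp add: field_simps)
    then have d: "(B has_real_derivative c / (x\<^sup>2 + c\<^sup>2)) (at x within {0..L})"
      unfolding B_def using assms by (auto intro!: derivative_eq_intros simp: inverse_eq_divide power2_eq_square)
    have d2: "(A has_real_derivative (c\<^sup>2 - x\<^sup>2) / (2 * c\<^sup>2 * (x\<^sup>2 + c\<^sup>2)\<^sup>2)) (at x within {0..L})"
    proof -
      have "(A has_real_derivative (1 * (2 * c\<^sup>2 * (x\<^sup>2 + c\<^sup>2)) - x * (2 * c\<^sup>2 * (2 * x))) / ((2 * c\<^sup>2 * (x\<^sup>2 + c\<^sup>2)) * (2 * c\<^sup>2 * (x\<^sup>2 + c\<^sup>2)))) (at x within {0..L})"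
        unfolding A_def using assms pos[of x] by (auto intro!: derivative_eq_intros)
      moreover have "(1 * (2 * c\<^sup>2 * (x\<^sup>2 + c\<^sup>2)) - x * (2 * c\<^sup>2 * (2 * x))) / ((2 * c\<^sup>2 * (x\<^sup>2 + c\<^sup>2)) * (2 * c\<^sup>2 * (x\<^sup>2 + c\<^sup>2)))
         = (2 * c\<^sup>2 * (c\<^sup>2 - x\<^sup>2)) / (2 * c\<^sup>2 * (2 * c\<^sup>2 * (x\<^sup>2 + c\<^sup>2)\<^sup>2))"
        by (rule arg_cong2[where f = "(/)"]) (simp_all add: power2_eq_square algebra_simps)
      moreover have "(2 * c\<^sup>2 * (c\<^sup>2 - x\<^sup>2)) / (2 * c\<^sup>2 * (2 * c\<^sup>2 * (x\<^sup>2 + c\<^sup>2)\<^sup>2)) = (c\<^sup>2 - x\<^sup>2) / (2 * c\<^sup>2 * (x\<^sup>2 + c\<^sup>2)\<^sup>2)"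
        by (rule nonzero_mult_divide_mult_cancel_left) (use assms in simp)
      ultimately show ?thesis by (simp only:)
    qed
    define E where "E = (\<lambda>u. B u / (2 * c ^ 3))"
    define dA dE where "dA = (c\<^sup>2 - x\<^sup>2) / (2 * c\<^sup>2 * (x\<^sup>2 + c\<^sup>2)\<^sup>2)" and "dE = c / (x\<^sup>2 + c\<^sup>2) / (2 * c ^ 3)"
    have d3: "(E has_real_derivative dE) (at x within {0..L})"
      unfolding E_def dE_def by (rule DERIV_cdivide[OF d])
    have "F = (\<lambda>u. (L - u) * (A u + E u) + u * E u)"
      unfolding F_def A_def B_def E_def by simp
    then have "(F has_real_derivative ((L - x) * (dA + dE) - A x + x * dE)) (at x within {0..L})"
      using d2 d3 unfolding dA_def[symmetric] by (auto intro!: derivative_eq_intros simp: algebra_simps)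
    moreover have "(L - x) * (dA + dE) - A x + x * dE = (L - x) / (x\<^sup>2 + c\<^sup>2)\<^sup>2"
    proof -
      define y where "y = x\<^sup>2 + c\<^sup>2"
      have y: "y > 0" "c\<^sup>2 - x\<^sup>2 = 2 * c\<^sup>2 - y" unfolding y_def using pos by auto
      have "dA + dE = 1 / y\<^sup>2"
        unfolding dA_def dE_def y(2) y_def[symmetric] using assms y(1) by (simp add: field_simps power2_eq_square power3_eq_cube)
      moreover have "x * dE = A x"
        unfolding dE_def A_def y_def[symmetric] using assms y(1) by (simp add: field_simps power2_eq_square power3_eq_cube)
      ultimately show ?thesis unfolding y_def[symmetric] by simp
    qed
    ultimately show ?thesis by simp
  qed
  have hi: "has_bochner_integral lborel (\<lambda>u. indicator {0..L} u *\<^sub>R ((L - u) / (u\<^sup>2 + c\<^sup>2)\<^sup>2)) (F L - F 0)"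
  proof (rule has_bochner_integral_FTC_Icc)
    show "(F has_vector_derivative (L - x) / (x\<^sup>2 + c\<^sup>2)\<^sup>2) (at x within {0..L})" for x
      using dF unfolding has_real_derivative_iff_has_vector_derivative .
    show "continuous_on {0..L} (\<lambda>x. (L - x) / (x\<^sup>2 + c\<^sup>2)\<^sup>2)"
      using pos by (intro continuous_intros) (metis less_irrefl power_eq_0_iff)
  qed (use assms in auto)
  obtain B where B: "0 \<le> B" "\<And>k s. c \<le> Re s \<Longrightarrow> cmod (phi k s) \<le> B" using phi_bound[OF assms(1)] by metis
  have "(\<lambda>k. integral\<^sup>L lborel (\<lambda>u. indicator {0..L} u *\<^sub>R (2 * (L - u) / pi\<^sup>2 * (cmod (phi k (complex_of_real c - \<i> * complex_of_real u)))\<^sup>2)))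
     \<longlonglongrightarrow> integral\<^sup>L lborel (\<lambda>u. 2 / pi\<^sup>2 * (indicator {0..L} u *\<^sub>R ((L - u) / (u\<^sup>2 + c\<^sup>2)\<^sup>2)))"
  proof (rule integral_dominated_convergence[where w = "\<lambda>u. indicator {0..L} u *\<^sub>R (2 * L / pi\<^sup>2 * B\<^sup>2)"])
    show "(\<lambda>u. 2 / pi\<^sup>2 * (indicator {0..L} u *\<^sub>R ((L - u) / (u\<^sup>2 + c\<^sup>2)\<^sup>2))) \<in> borel_measurable lborel" by measurable
    show "(\<lambda>u. indicator {0..L} u *\<^sub>R (2 * (L - u) / pi\<^sup>2 * (cmod (phi k (complex_of_real c - \<i> * complex_of_real u)))\<^sup>2)) \<in> borel_measurable lborel" for k
      using Wsum_integral[of L k c] assms unfolding has_bochner_integral_iff by auto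
    show "integrable lborel (\<lambda>u. indicator {0..L} u *\<^sub>R (2 * L / pi\<^sup>2 * B\<^sup>2))" using assms by simp
    show "AE u in lborel. (\<lambda>k. indicator {0..L} u *\<^sub>R (2 * (L - u) / pi\<^sup>2 * (cmod (phi k (complex_of_real c - \<i> * complex_of_real u)))\<^sup>2))
       \<longlonglongrightarrow> 2 / pi\<^sup>2 * (indicator {0..L} u *\<^sub>R ((L - u) / (u\<^sup>2 + c\<^sup>2)\<^sup>2))"
    proof (rule AE_I2)
      fix u
      let ?s = "complex_of_real c - \<i> * complex_of_real u"
      have "(\<lambda>k. indicator {0..L} u *\<^sub>R (2 * (L - u) / pi\<^sup>2 * (cmod (phi k ?s))\<^sup>2)) \<longlonglongrightarrow> indicator {0..L} u *\<^sub>R (2 * (L - u) / pi\<^sup>2 * (cmod (1 / ?s\<^sup>2))\<^sup>2)"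
        using assms by (intro tendsto_intros phi_tendsto) auto
      moreover have "(cmod (1 / ?s\<^sup>2))\<^sup>2 = 1 / (u\<^sup>2 + c\<^sup>2)\<^sup>2"
      proof -
        have "(cmod ?s)\<^sup>2 = u\<^sup>2 + c\<^sup>2" by (simp add: cmod_power2)
        then show ?thesis by (simp add: norm_divide norm_power power_divide)
      qed
      moreover have "indicator {0..L} u *\<^sub>R (2 * (L - u) / pi\<^sup>2 * (1 / (u\<^sup>2 + c\<^sup>2)\<^sup>2)) = 2 / pi\<^sup>2 * (indicator {0..L} u *\<^sub>R ((L - u) / (u\<^sup>2 + c\<^sup>2)\<^sup>2))"
        by (auto split: split_indicator)
      ultimately show "(\<lambda>k. indicator {0..L} u *\<^sub>R (2 * (L - u) / pi\<^sup>2 * (cmod (phi k ?s))\<^sup>2))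
       \<longlonglongrightarrow> 2 / pi\<^sup>2 * (indicator {0..L} u *\<^sub>R ((L - u) / (u\<^sup>2 + c\<^sup>2)\<^sup>2))" by (simp only:)
    qed
    show "AE u in lborel. norm (indicator {0..L} u *\<^sub>R (2 * (L - u) / pi\<^sup>2 * (cmod (phi k (complex_of_real c - \<i> * complex_of_real u)))\<^sup>2))
       \<le> indicator {0..L} u *\<^sub>R (2 * L / pi\<^sup>2 * B\<^sup>2)" for k
    proof (rule AE_I2)
      fix u
      let ?s = "complex_of_real c - \<i> * complex_of_real u"
      have "2 * (L - u) / pi\<^sup>2 * (cmod (phi k ?s))\<^sup>2 \<le> 2 * L / pi\<^sup>2 * B\<^sup>2" "0 \<le> 2 * (L - u) / pi\<^sup>2 * (cmod (phi k ?s))\<^sup>2" if "u \<in> {0..L}"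
        using that B(1) B(2)[of ?s k] by (auto intro!: mult_mono divide_right_mono power_mono)
      then show "norm (indicator {0..L} u *\<^sub>R (2 * (L - u) / pi\<^sup>2 * (cmod (phi k ?s))\<^sup>2)) \<le> indicator {0..L} u *\<^sub>R (2 * L / pi\<^sup>2 * B\<^sup>2)"
        by (auto split: split_indicator)
    qed
  qed
  moreover have "integral\<^sup>L lborel (\<lambda>u. indicator {0..L} u *\<^sub>R (2 * (L - u) / pi\<^sup>2 * (cmod (phi k (complex_of_real c - \<i> * complex_of_real u)))\<^sup>2)) = Wsum L k c" for k
    using Wsum_integral[of L k c] assms by (intro has_bochner_integral_integral_eq) auto
  moreover have "integral\<^sup>L lborel (\<lambda>u. 2 / pi\<^sup>2 * (indicator {0..L} u *\<^sub>R ((L - u) / (u\<^sup>2 + c\<^sup>2)\<^sup>2))) = L * arctan (L / c) / (pi\<^sup>2 * c ^ 3)"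
  proof -
    have "F L - F 0 = L * arctan (L / c) / (2 * c ^ 3)" unfolding F_def by simp
    then show ?thesis using hi by (subst Bochner_Integration.integral_mult_right) (auto simp: has_bochner_integral_iff)
  qed
  ultimately show ?thesis by simp
qed

text \<open>
The linear growth in $L$ cancels: the difference is $\frac{L}{\pi^2c^3}\arctan(c/L)$, and
$\arctan(c/L)\le c/L$.
\<close>

lemma variance_density_le:
  assumes "0 < c" "0 < L"
  shows "L / (2 * pi * c ^ 3) - L * arctan (L / c) / (pi\<^sup>2 * c ^ 3) \<le> 1 / (pi\<^sup>2 * c\<^sup>2)"
proof -
  have "arctan (c / L) = pi / 2 - arctan (L / c)"
    using arctan_inverse[of "L / c"] assms by (simp add: inverse_eq_divide)
  moreover have "arctan (c / L) \<le> c / L" using assms by (intro arctan_le_self) auto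
  ultimately have "pi / 2 - arctan (L / c) \<le> c / L" by linarith
  then have "L / (pi\<^sup>2 * c ^ 3) * (pi / 2 - arctan (L / c)) \<le> L / (pi\<^sup>2 * c ^ 3) * (c / L)"
    using assms by (intro mult_left_mono) auto
  moreover have "L / (pi\<^sup>2 * c ^ 3) * (c / L) = 1 / (pi\<^sup>2 * c\<^sup>2)"
    using assms by (simp add: field_simps power2_eq_square power3_eq_cube)
  moreover have "L / (pi\<^sup>2 * c ^ 3) * (pi / 2 - arctan (L / c)) = L / (2 * pi * c ^ 3) - L * arctan (L / c) / (pi\<^sup>2 * c ^ 3)"
    using assms by (simp add: field_simps power2_eq_square)
  ultimately show ?thesis by simp
qed

text \<open>
The right-hand side of Berezin's comparison, $s\sum_jq_I(\xi_j)^2-\mathrm{tr}\,G^2$.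
\<close>

definition variance :: "real \<Rightarrow> real \<Rightarrow> real \<Rightarrow> nat \<Rightarrow> real" where
  "variance \<alpha> \<beta> L k = L * mesh k / (2 * pi) * (\<Sum>j<npts k. (q_I \<alpha> \<beta> (node k j))\<^sup>2)
     - (\<Sum>i<npts k. \<Sum>j<npts k. (cmod (gram \<alpha> \<beta> k 0 L i j))\<^sup>2)"

lemma has_integral_damp_square:
  assumes "\<alpha> \<le> \<beta>" "0 < s"
  shows "has_bochner_integral lborel (\<lambda>p. indicator (strip \<alpha> \<beta> \<alpha> \<beta>) p * exp (- s * (Re p + Im p))) ((damp \<alpha> \<beta> s)\<^sup>2)"
proof -
  have "has_bochner_integral lborel (\<lambda>p. (indicator {\<alpha>..\<beta>} (Re p) *\<^sub>R exp (- s * Re p)) * (indicator {\<alpha>..\<beta>} (Im p) *\<^sub>R exp (- s * Im p)))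
     (damp \<alpha> \<beta> s * damp \<alpha> \<beta> s)"
    by (intro has_integral_complex_product has_integral_damp assms)
  moreover have "(indicator {\<alpha>..\<beta>} (Re p) *\<^sub>R exp (- s * Re p)) * (indicator {\<alpha>..\<beta>} (Im p) *\<^sub>R exp (- s * Im p))
     = indicator (strip \<alpha> \<beta> \<alpha> \<beta>) p * exp (- s * (Re p + Im p))" for p
    unfolding strip_def by (auto simp: indicator_def exp_add[symmetric] algebra_simps)
  ultimately show ?thesis by (simp add: power2_eq_square)
qed

text \<open>
The squares of the vertical factors of the Gram matrix are integrals over pairs $(y,y')\in I^2$. The pair is
encoded as the complex number $p=y+iy'$, and \<open>strip \<alpha> \<beta> \<alpha> \<beta>\<close> is the square $I^2$.
\<close>

lemma variance_integral:
  assumes "\<alpha> \<le> \<beta>"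
  shows "has_bochner_integral lborel (\<lambda>p. indicator (strip \<alpha> \<beta> \<alpha> \<beta>) p * (Usum L k (Re p + Im p) - Wsum L k (Re p + Im p)))
     (variance \<alpha> \<beta> L k)"
proof -
  let ?I = "indicator (strip \<alpha> \<beta> \<alpha> \<beta>) :: complex \<Rightarrow> real"
  have U: "has_bochner_integral lborel (\<lambda>p. \<Sum>j<npts k. 2 * L / pi * mesh k * (node k j)\<^sup>2 * (?I p * exp (- (2 * node k j) * (Re p + Im p))))
      (\<Sum>j<npts k. 2 * L / pi * mesh k * (node k j)\<^sup>2 * (damp \<alpha> \<beta> (2 * node k j))\<^sup>2)"
    using node_pos by (intro has_bochner_integral_sum has_bochner_integral_mult_right has_integral_damp_square assms) auto
  have "(\<Sum>j<npts k. 2 * L / pi * mesh k * (node k j)\<^sup>2 * (damp \<alpha> \<beta> (2 * node k j))\<^sup>2)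
     = L * mesh k / (2 * pi) * (\<Sum>j<npts k. (q_I \<alpha> \<beta> (node k j))\<^sup>2)"
    unfolding sum_distrib_left
  proof (intro sum.cong refl)
    fix j
    have "q_I \<alpha> \<beta> (node k j) = 2 * node k j * damp \<alpha> \<beta> (2 * node k j)"
      unfolding q_I_def damp_def using node_pos[of k j] by (simp add: mult_ac)
    then show "2 * L / pi * mesh k * (node k j)\<^sup>2 * (damp \<alpha> \<beta> (2 * node k j))\<^sup>2 = L * mesh k / (2 * pi) * (q_I \<alpha> \<beta> (node k j))\<^sup>2"
      by (simp add: power_mult_distrib)
  qed
  moreover have "(\<Sum>j<npts k. 2 * L / pi * mesh k * (node k j)\<^sup>2 * (?I p * exp (- (2 * node k j) * (Re p + Im p)))) = ?I p * Usum L k (Re p + Im p)" for p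
    unfolding Usum_def sum_distrib_left by (intro sum.cong refl) (simp add: algebra_simps)
  ultimately have U': "has_bochner_integral lborel (\<lambda>p. ?I p * Usum L k (Re p + Im p)) (L * mesh k / (2 * pi) * (\<Sum>j<npts k. (q_I \<alpha> \<beta> (node k j))\<^sup>2))"
    using U by simp
  let ?w = "\<lambda>i j. (mesh k)\<^sup>2 * node k i * node k j / pi\<^sup>2 * (cmod (osc 0 L (node k j - node k i)))\<^sup>2"
  have W: "has_bochner_integral lborel (\<lambda>p. \<Sum>i<npts k. \<Sum>j<npts k. ?w i j * (?I p * exp (- (node k i + node k j) * (Re p + Im p))))
      (\<Sum>i<npts k. \<Sum>j<npts k. ?w i j * (damp \<alpha> \<beta> (node k i + node k j))\<^sup>2)"
    using node_pos by (intro has_bochner_integral_sum has_bochner_integral_mult_right has_integral_damp_square assms) (auto intro: add_pos_pos)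
  have "?w i j * (damp \<alpha> \<beta> (node k i + node k j))\<^sup>2 = (cmod (gram \<alpha> \<beta> k 0 L i j))\<^sup>2" for i j
  proof -
    have "(sqrt (mesh k * node k i / pi))\<^sup>2 = mesh k * node k i / pi" for i
      using mesh_pos[of k] node_pos[of k i] by simp
    then show ?thesis unfolding gram_def norm_mult norm_of_real power_mult_distrib power2_abs
      by (simp add: power2_eq_square)
  qed
  moreover have "(\<Sum>i<npts k. \<Sum>j<npts k. ?w i j * (?I p * exp (- (node k i + node k j) * (Re p + Im p)))) = ?I p * Wsum L k (Re p + Im p)" for p
    unfolding Wsum_def sum_distrib_left by (intro sum.cong refl) (simp add: mult_ac)
  ultimately have W': "has_bochner_integral lborel (\<lambda>p. ?I p * Wsum L k (Re p + Im p)) (\<Sum>i<npts k. \<Sum>j<npts k. (cmod (gram \<alpha> \<beta> k 0 L i j))\<^sup>2)"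
    using W by simp
  from has_bochner_integral_diff[OF U' W'] show ?thesis unfolding variance_def by (simp add: right_diff_distrib)
qed

lemma Usum_antimono: "0 \<le> L \<Longrightarrow> c \<le> c' \<Longrightarrow> Usum L k c' \<le> Usum L k c"
  unfolding Usum_def using node_pos[of k] mesh_pos[of k]
  by (intro mult_left_mono sum_mono) (auto intro: mult_right_mono less_imp_le)

lemma Wsum_antimono:
  assumes "c \<le> c'" shows "Wsum L k c' \<le> Wsum L k c"
  unfolding Wsum_def
proof (intro sum_mono mult_right_mono mult_left_mono)
  fix i j
  have n: "0 < node k i" "0 < node k j" by (rule node_pos)+
  then have "(node k i + node k j) * c \<le> (node k i + node k j) * c'"
    using assms by (intro mult_left_mono) auto
  then show "exp (- (node k i + node k j) * c') \<le> exp (- (node k i + node k j) * c)"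
    unfolding exp_le_cancel_iff mult_minus_left by linarith
  show "0 \<le> (mesh k)\<^sup>2 * node k i * node k j / pi\<^sup>2" using n by simp
qed auto

lemma Usum_nonneg: "0 \<le> L \<Longrightarrow> 0 \<le> Usum L k c"
  unfolding Usum_def using mesh_pos[of k] by (intro mult_nonneg_nonneg sum_nonneg) auto

lemma Wsum_nonneg: "0 \<le> Wsum L k c"
  unfolding Wsum_def using node_pos[of k] mesh_pos[of k]
  by (intro sum_nonneg mult_nonneg_nonneg divide_nonneg_pos) (auto intro: less_imp_le)

text \<open>
The integral over $(y,y')\in I^2$ of the bound $\pi^{-2}(2\alpha)^{-2}$ for $\pi^{-2}(y+y')^{-2}$.
\<close>

definition var_const :: "real \<Rightarrow> real \<Rightarrow> real" where
  "var_const \<alpha> \<beta> = (\<beta> - \<alpha>)\<^sup>2 / (4 * pi\<^sup>2 * \<alpha>\<^sup>2)"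

text \<open>
The mesh tends to $0$ with the box fixed; the point is that the bound on the limit does not depend on $L$.
\<close>

theorem variance_limit:
  assumes "0 < \<alpha>" "\<alpha> < \<beta>" "0 < L"
  obtains V where "variance \<alpha> \<beta> L \<longlonglongrightarrow> V" "V \<le> var_const \<alpha> \<beta>"
proof -
  let ?I = "indicator (strip \<alpha> \<beta> \<alpha> \<beta>) :: complex \<Rightarrow> real"
  define v where "v = (\<lambda>c. L / (2 * pi * c ^ 3) - L * arctan (L / c) / (pi\<^sup>2 * c ^ 3))"
  let ?g = "\<lambda>k p. ?I p * (Usum L k (Re p + Im p) - Wsum L k (Re p + Im p))"
  have area: "has_bochner_integral lborel ?I ((\<beta> - \<alpha>) * (\<beta> - \<alpha>))"
  proof -
    have "has_bochner_integral lborel (indicator {\<alpha>..\<beta>} :: real \<Rightarrow> real) (\<beta> - \<alpha>)"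
      using has_bochner_integral_real_indicator[of "{\<alpha>..\<beta>}" lborel] assms by simp
    from has_integral_complex_product[OF this this]
    have "has_bochner_integral lborel (\<lambda>p. indicator {\<alpha>..\<beta>} (Re p) * indicator {\<alpha>..\<beta>} (Im p)) ((\<beta> - \<alpha>) * (\<beta> - \<alpha>))" .
    moreover have "indicator {\<alpha>..\<beta>} (Re p) * indicator {\<alpha>..\<beta>} (Im p) = ?I p" for p
      unfolding strip_def by (auto simp: indicator_def)
    ultimately show ?thesis by simp
  qed
  have "Bseq (\<lambda>k. Usum L k (2 * \<alpha>))" "Bseq (\<lambda>k. Wsum L k (2 * \<alpha>))"
    using Usum_tendsto[of "2 * \<alpha>" L] Wsum_tendsto[of "2 * \<alpha>" L] assms
    by (auto intro!: convergent_imp_Bseq convergentI)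
  then obtain A B where A: "\<And>k. \<bar>Usum L k (2 * \<alpha>)\<bar> \<le> A" and B: "\<And>k. \<bar>Wsum L k (2 * \<alpha>)\<bar> \<le> B"
    unfolding Bseq_def by auto
  have mem: "2 * \<alpha> \<le> Re p + Im p" if "p \<in> strip \<alpha> \<beta> \<alpha> \<beta>" for p
    using that unfolding strip_def by auto
  have mg: "?g k \<in> borel_measurable lborel" for k
    using variance_integral[of \<alpha> \<beta> L k] assms unfolding has_bochner_integral_iff by auto
  have ptw: "(\<lambda>k. ?g k p) \<longlonglongrightarrow> ?I p * v (Re p + Im p)" for p
  proof (cases "p \<in> strip \<alpha> \<beta> \<alpha> \<beta>")
    case True
    then have "0 < Re p + Im p" using mem[OF True] assms by linarith
    then show ?thesis unfolding v_def using assms by (intro tendsto_intros Usum_tendsto Wsum_tendsto) auto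
  qed simp
  have bnd: "norm (?g k p) \<le> ?I p * (A + B)" for k p
  proof (cases "p \<in> strip \<alpha> \<beta> \<alpha> \<beta>")
    case True
    have "Usum L k (Re p + Im p) \<le> A" "Wsum L k (Re p + Im p) \<le> B"
      using Usum_antimono[OF _ mem[OF True], of L k] Wsum_antimono[OF mem[OF True], of L k] A[of k] B[of k] assms by auto
    then show ?thesis using True Usum_nonneg[of L k "Re p + Im p"] Wsum_nonneg[of L k "Re p + Im p"] assms by simp
  qed simp
  have wi: "integrable lborel (\<lambda>p. ?I p * (A + B))" using area unfolding has_bochner_integral_iff by simp
  have mat_vec: "(\<lambda>p. ?I p * v (Re p + Im p)) \<in> borel_measurable lborel"
    by (rule borel_measurable_LIMSEQ_metric[OF mg ptw])
  have ptwAE: "AE p in lborel. (\<lambda>k. ?g k p) \<longlonglongrightarrow> ?I p * v (Re p + Im p)" using ptw by (intro AE_I2)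
  have bndAE: "AE p in lborel. norm (?g k p) \<le> ?I p * (A + B)" for k using bnd by (intro AE_I2)
  have lim: "(\<lambda>k. integral\<^sup>L lborel (?g k)) \<longlonglongrightarrow> (\<integral>p. ?I p * v (Re p + Im p) \<partial>lborel)"
    by (rule integral_dominated_convergence[OF mat_vec mg wi ptwAE bndAE])
  have vi: "integrable lborel (\<lambda>p. ?I p * v (Re p + Im p))"
    by (rule integrable_dominated_convergence[OF mat_vec mg wi ptwAE bndAE])
  have "(\<integral>p. ?I p * v (Re p + Im p) \<partial>lborel) \<le> (\<integral>p. ?I p * (1 / (pi\<^sup>2 * (2 * \<alpha>)\<^sup>2)) \<partial>lborel)"
  proof (rule integral_mono[OF vi])
    show "integrable lborel (\<lambda>p. ?I p * (1 / (pi\<^sup>2 * (2 * \<alpha>)\<^sup>2)))" using area unfolding has_bochner_integral_iff by simp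
    fix p
    show "?I p * v (Re p + Im p) \<le> ?I p * (1 / (pi\<^sup>2 * (2 * \<alpha>)\<^sup>2))"
    proof (cases "p \<in> strip \<alpha> \<beta> \<alpha> \<beta>")
      case True
      then have c: "2 * \<alpha> \<le> Re p + Im p" "0 < Re p + Im p" using mem[OF True] assms by linarith+
      have "v (Re p + Im p) \<le> 1 / (pi\<^sup>2 * (Re p + Im p)\<^sup>2)" unfolding v_def by (rule variance_density_le[OF c(2) assms(3)])
      also have "\<dots> \<le> 1 / (pi\<^sup>2 * (2 * \<alpha>)\<^sup>2)"
        using c assms by (intro divide_left_mono mult_left_mono power_mono) auto
      finally show ?thesis using True by simp
    qed simp
  qed
  also have "\<dots> = var_const \<alpha> \<beta>"
    using area unfolding has_bochner_integral_iff var_const_def by (simp add: power2_eq_square)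
  finally have le: "(\<integral>p. ?I p * v (Re p + Im p) \<partial>lborel) \<le> var_const \<alpha> \<beta>" .
  have "integral\<^sup>L lborel (?g k) = variance \<alpha> \<beta> L k" for k
    by (rule has_bochner_integral_integral_eq[OF variance_integral]) (use assms in simp)
  then have "variance \<alpha> \<beta> L \<longlonglongrightarrow> (\<integral>p. ?I p * v (Re p + Im p) \<partial>lborel)" using lim by simp
  then show ?thesis using le that by blast
qed

section \<open>Diagonalizing the discretized kernel\<close>

text \<open>
If the coefficient vectors are orthonormal eigenvectors of the Gram matrix, these combinations of waves are
orthogonal on the box and their squared norms are the eigenvalues.
\<close>

definition eigenfunction :: "real \<Rightarrow> real \<Rightarrow> real \<Rightarrow> nat \<Rightarrow> (nat \<Rightarrow> nat \<Rightarrow> complex) \<Rightarrow> nat \<Rightarrow> complex \<Rightarrow> complex" where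
  "eigenfunction \<alpha> \<beta> L k u a z = indicator (strip \<alpha> \<beta> 0 L) z *\<^sub>R (\<Sum>j<npts k. u a j * wave k j z)"

lemma orthogonal_eigenfunctions:
  assumes eb: "eigenbasis (npts k) (gram \<alpha> \<beta> k 0 L) u l" and "0 \<le> L" "\<alpha> \<le> \<beta>"
  shows "orthogonal_kernel lborel (npts k) (eigenfunction \<alpha> \<beta> L k u) l"
proof -
  let ?e = "eigenfunction \<alpha> \<beta> L k u" and ?n = "npts k"
  have hb: "has_bochner_integral lborel (\<lambda>z. ?e a z * cnj (?e b z)) (if a = b then complex_of_real (l a) else 0)"
    if ab: "a < ?n" "b < ?n" for a b
  proof -
    have "has_bochner_integral lborel (\<lambda>z. \<Sum>i<?n. \<Sum>j<?n. (u a j * cnj (u b i)) * (indicator (strip \<alpha> \<beta> 0 L) z *\<^sub>R (cnj (wave k i z) * wave k j z)))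
       (\<Sum>i<?n. \<Sum>j<?n. (u a j * cnj (u b i)) * gram \<alpha> \<beta> k 0 L i j)"
      by (intro has_bochner_integral_sum has_bochner_integral_mult_right has_integral_gram assms)
    moreover have "(\<Sum>i<?n. \<Sum>j<?n. (u a j * cnj (u b i)) * (indicator (strip \<alpha> \<beta> 0 L) z *\<^sub>R (cnj (wave k i z) * wave k j z)))
       = ?e a z * cnj (?e b z)" for z
      unfolding eigenfunction_def by (cases "z \<in> strip \<alpha> \<beta> 0 L") (simp_all add: sum_distrib_left sum_distrib_right mult_ac)
    moreover have "(\<Sum>i<?n. \<Sum>j<?n. (u a j * cnj (u b i)) * gram \<alpha> \<beta> k 0 L i j) = herm_ip ?n (mat_vec ?n (gram \<alpha> \<beta> k 0 L) (u a)) (u b)"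
      unfolding herm_ip_def mat_vec_def by (simp add: sum_distrib_left sum_distrib_right mult_ac)
    ultimately show ?thesis using eigenbasis_mat_vec[OF eb ab(1), of "u b"] eigenbasis_herm_ip[OF eb ab] by auto
  qed
  show ?thesis
    by unfold_locales (use hb in \<open>auto simp: has_bochner_integral_iff\<close>)
qed

lemma eigenfunction_kernel:
  assumes eb: "eigenbasis (npts k) (gram \<alpha> \<beta> k 0 L) u l"
  shows "(\<Sum>a<npts k. eigenfunction \<alpha> \<beta> L k u a z * cnj (eigenfunction \<alpha> \<beta> L k u a w))
     = restrict_kernel (strip \<alpha> \<beta> 0 L) (disc_kernel k) z w"
proof (cases "z \<in> strip \<alpha> \<beta> 0 L \<and> w \<in> strip \<alpha> \<beta> 0 L")
  case True
  let ?n = "npts k"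
  have "(\<Sum>a<?n. eigenfunction \<alpha> \<beta> L k u a z * cnj (eigenfunction \<alpha> \<beta> L k u a w))
     = (\<Sum>a<?n. \<Sum>i<?n. \<Sum>j<?n. (wave k i z * cnj (wave k j w)) * (u a i * cnj (u a j)))"
    using True unfolding eigenfunction_def by (simp add: sum_product mult_ac)
  also have "\<dots> = (\<Sum>i<?n. \<Sum>a<?n. \<Sum>j<?n. (wave k i z * cnj (wave k j w)) * (u a i * cnj (u a j)))"
    by (rule sum.swap)
  also have "\<dots> = (\<Sum>i<?n. \<Sum>j<?n. \<Sum>a<?n. (wave k i z * cnj (wave k j w)) * (u a i * cnj (u a j)))"
    by (intro sum.cong refl sum.swap)
  also have "\<dots> = (\<Sum>i<?n. \<Sum>j<?n. if i = j then wave k i z * cnj (wave k j w) else 0)"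
    by (intro sum.cong refl) (simp add: eigenbasis_columns[OF eb] flip: sum_distrib_left)
  also have "\<dots> = disc_kernel k z w" unfolding disc_kernel_def by simp
  finally show ?thesis using True by (simp add: restrict_kernel_def)
qed (auto simp: eigenfunction_def restrict_kernel_def)

text \<open>
The diagonal of the Gram matrix is proportional to the width of the box, and over a full period it consists of the
values of $q_I$; so $s=L\delta/2\pi$ is the ratio of \<open>L\<close> to the period.
\<close>

lemma compressed_symbol_gram:
  assumes eb: "eigenbasis (npts k) (gram \<alpha> \<beta> k 0 L) u l"
    and "0 < \<alpha>" "\<alpha> < \<beta>" "0 < L" "L \<le> 2 * pi / mesh k"
  shows "compressed_symbol (npts k) (gram \<alpha> \<beta> k 0 L) u l (\<lambda>j. q_I \<alpha> \<beta> (node k j)) (L * mesh k / (2 * pi)) (rho_I \<alpha> \<beta>)"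
proof
  show "hermitian_on (npts k) (gram \<alpha> \<beta> k 0 L)" by (rule hermitian_gram)
  show "eigenbasis (npts k) (gram \<alpha> \<beta> k 0 L) u l" by (rule eb)
  show "0 < q_I \<alpha> \<beta> (node k j)" for j using q_I_pos node_pos assms by auto
  show "q_I \<alpha> \<beta> (node k j) \<le> rho_I \<alpha> \<beta>" for j using q_I_le_rho node_pos assms by auto
  show "0 \<le> rho_I \<alpha> \<beta>" using rho_I_pos assms by (simp add: less_imp_le)
  show "gram \<alpha> \<beta> k 0 L j j = complex_of_real (L * mesh k / (2 * pi) * q_I \<alpha> \<beta> (node k j))" for j
    using gram_diag[of 0 L] assms by simp
  show "0 \<le> Re (herm_ip (npts k) (mat_vec (npts k) (gram \<alpha> \<beta> k 0 L) x) x)" for x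
    using psd_gram[of 0 L \<alpha> \<beta> "npts k" k] assms unfolding psd_on_def by auto
  show "Re (herm_ip (npts k) (mat_vec (npts k) (gram \<alpha> \<beta> k 0 L) x) x) \<le> (\<Sum>j<npts k. q_I \<alpha> \<beta> (node k j) * (cmod (x j))\<^sup>2)" for x
    using assms by (intro gram_contraction) auto
qed

section \<open>The logarithmic integral of the symbol\<close>

text \<open>
The chosen branch is the principal one, since \<open>t\<close> ranges over a region where $1+tq$ stays off the cut.
\<close>

lemma log_branch_symbol:
  assumes "0 < \<alpha>" "\<alpha> < \<beta>" "0 < \<xi>" "t \<in> Omega_I \<alpha> \<beta>"
  shows "log_branch (Omega_I \<alpha> \<beta>) (\<lambda>s. 1 + s * complex_of_real (q_I \<alpha> \<beta> \<xi>)) t = Ln (1 + t * complex_of_real (q_I \<alpha> \<beta> \<xi>))"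
proof -
  let ?f = "\<lambda>s. 1 + s * complex_of_real (q_I \<alpha> \<beta> \<xi>)"
  have b: "is_log_branch (Omega_I \<alpha> \<beta>) ?f (\<lambda>s. Ln (?f s))"
    using assms by (intro is_log_branch_Ln q_I_pos q_I_le_rho)
  have "is_log_branch (Omega_I \<alpha> \<beta>) ?f (log_branch (Omega_I \<alpha> \<beta>) ?f)"
    unfolding log_branch_def by (rule someI[of "is_log_branch (Omega_I \<alpha> \<beta>) ?f", OF b])
  from is_log_branch_unique[OF _ _ _ this b assms(4)] show ?thesis
    using open_slit connected_slit zero_in_slit rho_I_pos[OF assms(1,2)] by (simp add: Omega_slit)
qed

text \<open>
The Riemann sums of $\mathcal L_I$. Up to the factor \<open>L\<close> they are the main term in Berezin's comparison.
\<close>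

definition L_sum :: "real \<Rightarrow> real \<Rightarrow> nat \<Rightarrow> complex \<Rightarrow> complex" where
  "L_sum \<alpha> \<beta> k t = complex_of_real (mesh k / (2 * pi)) * (\<Sum>j<npts k. Ln (1 + t * complex_of_real (q_I \<alpha> \<beta> (node k j))))"

lemma L_sum_tendsto:
  assumes ab: "0 < \<alpha>" "\<alpha> < \<beta>" and t: "t \<in> Omega_I \<alpha> \<beta>"
  shows "(\<lambda>k. L_sum \<alpha> \<beta> k t) \<longlonglongrightarrow> L_I \<alpha> \<beta> t"
proof -
  have rho: "0 < rho_I \<alpha> \<beta>" by (rule rho_I_pos[OF ab])
  have ts: "t \<in> slit (rho_I \<alpha> \<beta>)" using t by (simp add: Omega_slit)
  obtain c where c: "0 < c" "bounded_away (rho_I \<alpha> \<beta>) t c"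
    using slit_uniform_lower_bound[OF rho, of "{t}"] ts by auto
  have qb: "0 \<le> q_I \<alpha> \<beta> x" "q_I \<alpha> \<beta> x \<le> rho_I \<alpha> \<beta>" if "0 < x" for x
    using q_I_pos[OF ab(2) that] q_I_le_rho[OF ab(1) that] by auto
  have "(\<lambda>k. complex_of_real (mesh k) * (\<Sum>j<npts k. Ln (1 + t * complex_of_real (q_I \<alpha> \<beta> (node k j)))))
     \<longlonglongrightarrow> (LINT x:{0<..}|lborel. Ln (1 + t * complex_of_real (q_I \<alpha> \<beta> x)))"
  proof (rule riemann_sum_tendsto[where a = "2 * \<alpha>" and C = "cmod t / c"])
    fix x :: real assume x: "0 < x"
    have "cmod (Ln (1 + t * complex_of_real (q_I \<alpha> \<beta> x))) \<le> cmod t / c * q_I \<alpha> \<beta> x"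
      by (rule Ln_taylor_bounds(1)[OF rho ts c(2) qb[OF x] qb[OF x]])
    also have "\<dots> \<le> cmod t / c * exp (- (2 * \<alpha>) * x)"
      using q_I_le_exp[of \<alpha> \<beta> x] c(1) by (intro mult_left_mono) auto
    finally show "cmod (Ln (1 + t * complex_of_real (q_I \<alpha> \<beta> x))) \<le> cmod t / c * exp (- (2 * \<alpha>) * x)" .
    show "isCont (\<lambda>x. Ln (1 + t * complex_of_real (q_I \<alpha> \<beta> x))) x"
      using slit_Ln_domain[OF rho ts qb[OF x]] unfolding q_I_def by (intro continuous_intros) auto
  qed (use ab in auto)
  then have "(\<lambda>k. 1 / (2 * complex_of_real pi) * (complex_of_real (mesh k) * (\<Sum>j<npts k. Ln (1 + t * complex_of_real (q_I \<alpha> \<beta> (node k j))))))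
     \<longlonglongrightarrow> 1 / (2 * complex_of_real pi) * (LINT x:{0<..}|lborel. Ln (1 + t * complex_of_real (q_I \<alpha> \<beta> x)))"
    by (intro tendsto_intros)
  moreover have "(LINT x:{0<..}|lborel. Ln (1 + t * complex_of_real (q_I \<alpha> \<beta> x)))
     = (LINT x:{0<..}|lborel. log_branch (Omega_I \<alpha> \<beta>) (\<lambda>s. 1 + s * complex_of_real (q_I \<alpha> \<beta> x)) t)"
    using log_branch_symbol[OF ab _ t] unfolding set_lebesgue_integral_def
    by (intro Bochner_Integration.integral_cong) (auto simp: indicator_def)
  ultimately show ?thesis unfolding L_I_def L_sum_def by (simp add: mult.assoc)
qed

lemma mesh_q_sum_bounded:
  assumes ab: "0 < \<alpha>" "\<alpha> < \<beta>"
  obtains T where "0 \<le> T" "\<And>k. mesh k * (\<Sum>j<npts k. q_I \<alpha> \<beta> (node k j)) \<le> T"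
proof -
  have qb: "0 \<le> q_I \<alpha> \<beta> x" if "0 < x" for x using q_I_pos[OF ab(2) that] by simp
  have "(\<lambda>k. complex_of_real (mesh k) * (\<Sum>j<npts k. complex_of_real (q_I \<alpha> \<beta> (node k j))))
     \<longlonglongrightarrow> (LINT x:{0<..}|lborel. complex_of_real (q_I \<alpha> \<beta> x))"
  proof (rule riemann_sum_tendsto[where a = "2 * \<alpha>" and C = 1])
    show "cmod (complex_of_real (q_I \<alpha> \<beta> x)) \<le> 1 * exp (- (2 * \<alpha>) * x)" if "0 < x" for x
      using q_I_le_exp[of \<alpha> \<beta> x] qb[OF that] by simp
    show "isCont (\<lambda>x. complex_of_real (q_I \<alpha> \<beta> x)) x" for x
      unfolding q_I_def by (intro continuous_intros)
  qed (use ab in auto)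
  then have "Bseq (\<lambda>k. complex_of_real (mesh k * (\<Sum>j<npts k. q_I \<alpha> \<beta> (node k j))))"
    by (intro convergent_imp_Bseq convergentI) auto
  then obtain T where T: "T > 0" "\<And>k. cmod (complex_of_real (mesh k * (\<Sum>j<npts k. q_I \<alpha> \<beta> (node k j)))) \<le> T"
    by (auto elim: BseqE)
  have "mesh k * (\<Sum>j<npts k. q_I \<alpha> \<beta> (node k j)) \<le> T" for k
    using T(2)[of k] unfolding norm_of_real by linarith
  then show ?thesis using that[of T] T(1) by auto
qed

lemma L_sum_real:
  assumes ab: "0 < \<alpha>" "\<alpha> < \<beta>" and x: "- (1 / rho_I \<alpha> \<beta>) < x"
  shows "L_sum \<alpha> \<beta> k (complex_of_real x) \<in> \<real>"
  unfolding L_sum_def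
proof (intro Reals_mult Reals_of_real sum_in_Reals)
  fix j
  show "Ln (1 + complex_of_real x * complex_of_real (q_I \<alpha> \<beta> (node k j))) \<in> \<real>"
    using Ln_real_on_slit(1)[OF rho_I_pos[OF ab] x, of "q_I \<alpha> \<beta> (node k j)"]
      q_I_pos[OF ab(2) node_pos[of k j]] q_I_le_rho[OF ab(1) node_pos[of k j], of \<beta>] by simp
qed

text \<open>
As $|\log(1+tx)|$ is at most a multiple of $x$ that is locally bounded in $t$, bounding the weighted sum of the
\<open>l k a\<close> is enough.
\<close>

lemma log_sums_locally_bounded:
  fixes w :: "nat \<Rightarrow> real" and n :: "nat \<Rightarrow> nat" and l :: "nat \<Rightarrow> nat \<Rightarrow> real"
  assumes rho: "0 < \<rho>" and l: "\<And>k a. a < n k \<Longrightarrow> 0 \<le> l k a \<and> l k a \<le> \<rho>"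
    and w: "\<And>k. 0 \<le> w k" and T: "\<And>k. w k * (\<Sum>a<n k. l k a) \<le> T" "0 \<le> T"
  shows "locally_bounded_family UNIV (slit \<rho>) (\<lambda>k t. complex_of_real (w k) * (\<Sum>a<n k. Ln (1 + t * complex_of_real (l k a))))"
  unfolding locally_bounded_family_def
proof (intro conjI ballI allI impI)
  fix k
  show "(\<lambda>t. complex_of_real (w k) * (\<Sum>a<n k. Ln (1 + t * complex_of_real (l k a)))) holomorphic_on slit \<rho>"
    using slit_Ln_domain[OF rho] l by (auto intro!: holomorphic_intros)
next
  fix K assume "compact K \<and> K \<subseteq> slit \<rho>"
  then have K: "compact K" "K \<subseteq> slit \<rho>" by auto
  obtain c where c: "0 < c" "\<And>t. t \<in> K \<Longrightarrow> bounded_away \<rho> t c"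
    using slit_uniform_lower_bound[OF rho K] by metis
  obtain b where b: "\<And>t. t \<in> K \<Longrightarrow> cmod t \<le> b" using compact_imp_bounded[OF K(1)] unfolding bounded_iff by blast
  have "cmod (complex_of_real (w k) * (\<Sum>a<n k. Ln (1 + t * complex_of_real (l k a)))) \<le> b / c * T" if t: "t \<in> K" for k t
  proof -
    have "cmod (\<Sum>a<n k. Ln (1 + t * complex_of_real (l k a))) \<le> (\<Sum>a<n k. b / c * l k a)"
    proof (rule sum_norm_le)
      fix a assume "a \<in> {..<n k}"
      then have la: "0 \<le> l k a" "l k a \<le> \<rho>" using l by auto
      have "cmod (Ln (1 + t * complex_of_real (l k a))) \<le> cmod t / c * l k a"
        using Ln_taylor_bounds(1)[OF rho _ c(2)[OF t] la la] K t by auto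
      also have "\<dots> \<le> b / c * l k a" using b[OF t] c(1) la by (intro mult_right_mono divide_right_mono) auto
      finally show "cmod (Ln (1 + t * complex_of_real (l k a))) \<le> b / c * l k a" .
    qed
    note le = this
    have "cmod (complex_of_real (w k) * (\<Sum>a<n k. Ln (1 + t * complex_of_real (l k a))))
        = w k * cmod (\<Sum>a<n k. Ln (1 + t * complex_of_real (l k a)))"
      using w[of k] by (simp only: norm_mult norm_of_real abs_of_nonneg)
    also have "\<dots> \<le> w k * (\<Sum>a<n k. b / c * l k a)" by (rule mult_left_mono[OF le w])
    also have "\<dots> = b / c * (w k * (\<Sum>a<n k. l k a))" by (simp add: sum_distrib_left mult_ac)
    also have "\<dots> \<le> b / c * T" using T(1)[of k] b[OF t] c(1) norm_ge_zero[of t]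
      by (intro mult_left_mono divide_nonneg_pos) linarith+
    finally show ?thesis .
  qed
  then show "\<exists>B. \<forall>k\<in>UNIV. \<forall>t\<in>K. cmod (complex_of_real (w k) * (\<Sum>a<n k. Ln (1 + t * complex_of_real (l k a)))) \<le> B" by blast
qed

text \<open>
A locally bounded pointwise limit of holomorphic functions is holomorphic.
\<close>

lemma L_I_holomorphic:
  assumes ab: "0 < \<alpha>" "\<alpha> < \<beta>"
  shows "L_I \<alpha> \<beta> holomorphic_on Omega_I \<alpha> \<beta>"
proof -
  obtain T where T: "0 \<le> T" "\<And>k. mesh k * (\<Sum>j<npts k. q_I \<alpha> \<beta> (node k j)) \<le> T"
    using mesh_q_sum_bounded[OF ab] by metis
  have "locally_bounded_family UNIV (slit (rho_I \<alpha> \<beta>)) (\<lambda>k t. complex_of_real (mesh k / (2 * pi)) * (\<Sum>a<npts k. Ln (1 + t * complex_of_real (q_I \<alpha> \<beta> (node k a)))))"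
  proof (rule log_sums_locally_bounded[OF rho_I_pos[OF ab], where T = "T / (2 * pi)"])
    show "0 \<le> q_I \<alpha> \<beta> (node k j) \<and> q_I \<alpha> \<beta> (node k j) \<le> rho_I \<alpha> \<beta>" for k j
      using q_I_pos[OF ab(2) node_pos[of k j]] q_I_le_rho[OF ab(1) node_pos[of k j], of \<beta>] by simp
    show "mesh k / (2 * pi) * (\<Sum>a<npts k. q_I \<alpha> \<beta> (node k a)) \<le> T / (2 * pi)" for k
      using divide_right_mono[OF T(2)[of k], of "2 * pi"] by simp
  qed (use T mesh_pos in \<open>auto intro: less_imp_le\<close>)
  then show ?thesis unfolding Omega_slit
    by (rule holomorphic_pointwise_limit[OF open_slit]) (use L_sum_tendsto[OF ab] in \<open>auto simp: L_sum_def Omega_slit\<close>)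
qed

definition eig :: "real \<Rightarrow> real \<Rightarrow> real \<Rightarrow> nat \<Rightarrow> (nat \<Rightarrow> nat \<Rightarrow> complex) \<times> (nat \<Rightarrow> real)" where
  "eig \<alpha> \<beta> L k = (SOME (u, l). eigenbasis (npts k) (gram \<alpha> \<beta> k 0 L) u l)"

abbreviation eigval :: "real \<Rightarrow> real \<Rightarrow> real \<Rightarrow> nat \<Rightarrow> nat \<Rightarrow> real" where
  "eigval \<alpha> \<beta> L k \<equiv> snd (eig \<alpha> \<beta> L k)"

lemma eigenbasis_eig: "eigenbasis (npts k) (gram \<alpha> \<beta> k 0 L) (fst (eig \<alpha> \<beta> L k)) (eigval \<alpha> \<beta> L k)"
proof -
  obtain u l where "eigenbasis (npts k) (gram \<alpha> \<beta> k 0 L) u l"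
    using hermitian_spectral[OF hermitian_gram] by blast
  then have "case (u, l) of (u, l) \<Rightarrow> eigenbasis (npts k) (gram \<alpha> \<beta> k 0 L) u l" by simp
  then have "case eig \<alpha> \<beta> L k of (u, l) \<Rightarrow> eigenbasis (npts k) (gram \<alpha> \<beta> k 0 L) u l"
    unfolding eig_def by (rule someI)
  then show ?thesis by (simp add: case_prod_unfold)
qed

text \<open>
If some increment were negative, all later increments over steps of the same length would be at least as negative,
and the function would tend to $-\infty$ along an arithmetic progression. So the function is nondecreasing, and
it converges to its supremum.
\<close>

lemma bounded_decreasing_increments_convergent:
  fixes g :: "real \<Rightarrow> real"
  assumes bound: "\<And>L. 0 < L \<Longrightarrow> \<bar>g L\<bar> \<le> B"
    and inc: "\<And>L c h. 0 < L \<Longrightarrow> 0 \<le> c \<Longrightarrow> 0 \<le> h \<Longrightarrow> g (c + L + h) + g L \<le> g (c + L) + g (L + h)"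
  obtains s where "(g \<longlongrightarrow> s) at_top"
proof -
  have mono: "g L \<le> g (L + h)" if "0 < L" "0 \<le> h" for L h
  proof (rule ccontr)
    assume neg: "\<not> g L \<le> g (L + h)"
    define d where "d = g L - g (L + h)"
    have d: "d > 0" using neg unfolding d_def by simp
    have "g (real n * h + L) \<le> g L - real n * d" for n
    proof (induction n)
      case (Suc n)
      have "g (real n * h + L + h) + g L \<le> g (real n * h + L) + g (L + h)" using inc[of L "real n * h" h] that by simp
      then show ?case using Suc unfolding d_def by (simp add: algebra_simps)
    qed simp
    moreover obtain n :: nat where "2 * B + 1 < real n * d"
      using reals_Archimedean3[OF d] by blast
    ultimately have "g (real n * h + L) < - B - 1 + (g L - B)" by (smt (verit))
    moreover have "g L \<le> B" "- B \<le> g (real n * h + L)" using bound[of L] bound[of "real n * h + L"] that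
      by (auto simp: abs_le_iff add_nonneg_pos)
    ultimately show False by simp
  qed
  define s where "s = (SUP L\<in>{0<..}. g L)"
  have bdd: "bdd_above (g ` {0<..})" using bound by (intro bdd_aboveI[of _ B]) (auto simp: abs_le_iff)
  have "(g \<longlongrightarrow> s) at_top"
  proof (rule order_tendstoI)
    fix a assume "a < s"
    then obtain L0 where L0: "0 < L0" "a < g L0" unfolding s_def using less_cSUP_iff[OF _ bdd] by auto
    show "\<forall>\<^sub>F L in at_top. a < g L"
      using eventually_ge_at_top[of L0]
    proof eventually_elim
      case (elim L)
      then show ?case using mono[of L0 "L - L0"] L0 by simp
    qed
  next
    fix a assume a: "s < a"
    show "\<forall>\<^sub>F L in at_top. g L < a"
      using eventually_gt_at_top[of 0]
    proof eventually_elim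
      case (elim L)
      then have "g L \<le> s" unfolding s_def by (intro cSUP_upper bdd) auto
      then show ?case using a by simp
    qed
  qed
  then show ?thesis by (rule that)
qed

section \<open>The generating function in a fixed box\<close>

locale half_plane_process =
  fixes M :: "'a measure" and Z :: "'a \<Rightarrow> complex set" and \<alpha> \<beta> :: real
  assumes process: "determinantal_process upper_half_plane K_H M Z" and ab: "0 < \<alpha>" "\<alpha> < \<beta>"
begin

definition branch :: "real \<Rightarrow> complex \<Rightarrow> complex" where
  "branch L = log_branch (Omega_I \<alpha> \<beta>) (gen_fun M Z \<alpha> \<beta> L)"

definition remainder :: "real \<Rightarrow> complex \<Rightarrow> complex" where
  "remainder L t = branch L t - complex_of_real L * L_I \<alpha> \<beta> t"

lemma rho_pos: "0 < rho_I \<alpha> \<beta>" by (rule rho_I_pos[OF ab])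

lemma open_Omega: "open (Omega_I \<alpha> \<beta>)" and connected_Omega: "connected (Omega_I \<alpha> \<beta>)" and zero_in_Omega: "0 \<in> Omega_I \<alpha> \<beta>"
  using open_slit connected_slit[OF rho_pos] zero_in_slit[OF rho_pos] by (auto simp: Omega_slit)

lemma real_mem: "- (1 / rho_I \<alpha> \<beta>) < x \<Longrightarrow> complex_of_real x \<in> Omega_I \<alpha> \<beta>"
  by (simp add: Omega_slit slit_iff)

lemma pos_mem: "0 < x \<Longrightarrow> - (1 / rho_I \<alpha> \<beta>) < x"
  using rho_pos by (smt (verit) divide_pos_pos)

lemma large_index:
  assumes "0 < L" "nat \<lceil>L\<rceil> \<le> k" shows "L \<le> 2 * pi / mesh k"
proof -
  have "L \<le> real k" using assms by linarith
  also have "\<dots> \<le> 1 * (real k + 1)" by simp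
  also have "\<dots> \<le> 2 * pi * (real k + 1)" using pi_gt3 by (intro mult_right_mono) auto
  finally show ?thesis by (simp add: mesh_def)
qed

lemmas compressed = compressed_symbol_gram[OF eigenbasis_eig ab]

text \<open>
The bounds on the Gram matrix hold only once the period of the waves exceeds the box, that is from some index
\<open>k0\<close> on; the sequence is shifted accordingly.
\<close>

lemma product_tendsto_gen_fun:
  assumes L: "0 < L"
  shows "(\<lambda>k. \<Prod>a<npts k. 1 + t * complex_of_real (eigval \<alpha> \<beta> L k a)) \<longlonglongrightarrow> gen_fun M Z \<alpha> \<beta> L t"
proof -
  define k0 where "k0 = nat \<lceil>L\<rceil>"
  let ?R = "strip \<alpha> \<beta> 0 L"
  have R: "compact ?R" "?R \<subseteq> upper_half_plane"
  proof -
    have "?R = cbox (Complex 0 \<alpha>) (Complex L \<beta>)"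
      unfolding strip_def by (auto simp: in_cbox_complex_iff)
    then show "compact ?R" by simp
    show "?R \<subseteq> upper_half_plane" using ab unfolding strip_def upper_half_plane_def by auto
  qed
  obtain B where B: "0 \<le> B" "\<And>k z w. \<alpha> \<le> Im z \<Longrightarrow> \<alpha> \<le> Im w \<Longrightarrow> cmod (disc_kernel k z w) \<le> B"
    using disc_kernel_bound[OF ab(1)] by metis
  obtain T where T: "0 \<le> T" "\<And>k. mesh k * (\<Sum>j<npts k. q_I \<alpha> \<beta> (node k j)) \<le> T"
    using mesh_q_sum_bounded[OF ab] by metis
  have cs: "compressed_symbol (npts (k + k0)) (gram \<alpha> \<beta> (k + k0) 0 L) (fst (eig \<alpha> \<beta> L (k + k0))) (eigval \<alpha> \<beta> L (k + k0))
      (\<lambda>j. q_I \<alpha> \<beta> (node (k + k0) j)) (L * mesh (k + k0) / (2 * pi)) (rho_I \<alpha> \<beta>)" for k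
    using L by (intro compressed large_index) (auto simp: k0_def)
  have "(\<lambda>k. \<Prod>a<npts (k + k0). 1 + t * complex_of_real (eigval \<alpha> \<beta> L (k + k0) a)) \<longlonglongrightarrow> (\<integral>\<omega>. (1 + t) ^ card (Z \<omega> \<inter> ?R) \<partial>M)"
  proof (rule product_tendsto_generating_function[OF process R B(1),
        where Km = "\<lambda>k. disc_kernel (k + k0)" and \<psi> = "\<lambda>k. eigenfunction \<alpha> \<beta> L (k + k0) (fst (eig \<alpha> \<beta> L (k + k0)))" and T = "L / (2 * pi) * T"])
    show "cmod (disc_kernel (k + k0) z w) \<le> B" if "z \<in> ?R" "w \<in> ?R" for k z w
      using B(2) that unfolding strip_def by auto
    show "(\<lambda>k. disc_kernel (k + k0) z w) \<longlonglongrightarrow> K_H z w" if "z \<in> ?R" "w \<in> ?R" for z w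
      using that ab unfolding strip_def by (intro LIMSEQ_ignore_initial_segment disc_kernel_tendsto) auto
    show "orthogonal_kernel lborel (npts (k + k0)) (eigenfunction \<alpha> \<beta> L (k + k0) (fst (eig \<alpha> \<beta> L (k + k0)))) (eigval \<alpha> \<beta> L (k + k0))" for k
      using L ab by (intro orthogonal_eigenfunctions eigenbasis_eig) auto
    show "(\<Sum>a<npts (k + k0). eigenfunction \<alpha> \<beta> L (k + k0) (fst (eig \<alpha> \<beta> L (k + k0))) a z *
          cnj (eigenfunction \<alpha> \<beta> L (k + k0) (fst (eig \<alpha> \<beta> L (k + k0))) a w)) = restrict_kernel ?R (disc_kernel (k + k0)) z w" for k z w
      by (rule eigenfunction_kernel[OF eigenbasis_eig])
    show "0 \<le> eigval \<alpha> \<beta> L (k + k0) a" if "a < npts (k + k0)" for k a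
      by (rule compressed_symbol.eigenvalue_nonneg[OF cs that])
    show "(\<Sum>a<npts (k + k0). eigval \<alpha> \<beta> L (k + k0) a) \<le> L / (2 * pi) * T" for k
      unfolding compressed_symbol.trace[OF cs] using T(2)[of "k + k0"] L
      by (simp add: field_simps mult_left_mono)
  qed
  then have "(\<lambda>k. \<Prod>a<npts k. 1 + t * complex_of_real (eigval \<alpha> \<beta> L k a)) \<longlonglongrightarrow> (\<integral>\<omega>. (1 + t) ^ card (Z \<omega> \<inter> ?R) \<partial>M)"
    by (rule LIMSEQ_offset)
  then show ?thesis unfolding gen_fun_def N_I_def strip_def .
qed

text \<open>
A limit of the functions $\sum_a\log(1+t\lambda_a)$ along a subsequence of meshes. It is a logarithm of the
generating function, and it inherits from Berezin's comparison a bound that is uniform in $L$.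
\<close>

theorem finite_volume_branch:
  assumes L: "0 < L"
  shows "is_log_branch (Omega_I \<alpha> \<beta>) (gen_fun M Z \<alpha> \<beta> L) (branch L)"
    and "- (1 / rho_I \<alpha> \<beta>) < x \<Longrightarrow> branch L (complex_of_real x) \<in> \<real>"
    and "t \<in> Omega_I \<alpha> \<beta> \<Longrightarrow> bounded_away (rho_I \<alpha> \<beta>) t c \<Longrightarrow>
        cmod (remainder L t) \<le> (cmod t / c)\<^sup>2 * var_const \<alpha> \<beta>"
proof -
  define k0 where "k0 = nat \<lceil>L\<rceil>"
  define n where "n = (\<lambda>k. npts (k + k0))"
  define l where "l = (\<lambda>k. eigval \<alpha> \<beta> L (k + k0))"
  define hk where "hk = (\<lambda>k t. complex_of_real 1 * (\<Sum>a<n k. Ln (1 + t * complex_of_real (l k a))))"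
  obtain T where T: "0 \<le> T" "\<And>k. mesh k * (\<Sum>j<npts k. q_I \<alpha> \<beta> (node k j)) \<le> T"
    using mesh_q_sum_bounded[OF ab] by metis
  have cs: "compressed_symbol (n k) (gram \<alpha> \<beta> (k + k0) 0 L) (fst (eig \<alpha> \<beta> L (k + k0))) (l k)
      (\<lambda>j. q_I \<alpha> \<beta> (node (k + k0) j)) (L * mesh (k + k0) / (2 * pi)) (rho_I \<alpha> \<beta>)" for k
    unfolding n_def l_def using L by (intro compressed large_index) (auto simp: k0_def)
  have l: "0 \<le> l k a \<and> l k a \<le> rho_I \<alpha> \<beta>" if "a < n k" for k a
    using compressed_symbol.eigenvalue_nonneg[OF cs that] compressed_symbol.eigenvalue_le[OF cs that] by simp
  have "locally_bounded_family UNIV (slit (rho_I \<alpha> \<beta>)) hk"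
    unfolding hk_def
  proof (rule log_sums_locally_bounded[OF rho_pos l])
    show "1 * (\<Sum>a<n k. l k a) \<le> L / (2 * pi) * T" for k
      unfolding compressed_symbol.trace[OF cs] using T(2)[of "k + k0"] L
      unfolding n_def by (simp add: field_simps mult_left_mono)
  qed (use T L in auto)
  then have lb: "locally_bounded_family UNIV (Omega_I \<alpha> \<beta>) hk" by (simp add: Omega_slit)
  obtain h r where h: "h holomorphic_on Omega_I \<alpha> \<beta>" and r: "strict_mono (r :: nat \<Rightarrow> nat)"
    and lim: "\<And>t. t \<in> Omega_I \<alpha> \<beta> \<Longrightarrow> (\<lambda>k. hk (r k) t) \<longlonglongrightarrow> h t"
    by (rule montel_sequence[OF open_Omega lb], rule that)
  have sub: "(\<lambda>k. X (r k + k0)) \<longlonglongrightarrow> x" if "X \<longlonglongrightarrow> x" for X :: "nat \<Rightarrow> 'b :: topological_space" and x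
    using LIMSEQ_subseq_LIMSEQ[OF LIMSEQ_ignore_initial_segment[OF that, of k0] r] by (simp add: o_def)
  have nz: "1 + t * complex_of_real (l k a) \<noteq> 0" if "t \<in> Omega_I \<alpha> \<beta>" "a < n k" for t k a
    using slit_Ln_domain[OF rho_pos, of t "l k a"] l[OF that(2)] that(1) by (auto simp: Omega_slit)
  have exp_hk: "exp (hk k t) = (\<Prod>a<npts (k + k0). 1 + t * complex_of_real (eigval \<alpha> \<beta> L (k + k0) a))" if "t \<in> Omega_I \<alpha> \<beta>" for k t
    unfolding hk_def using nz[OF that] by (simp add: exp_sum n_def l_def)
  have h_branch: "is_log_branch (Omega_I \<alpha> \<beta>) (gen_fun M Z \<alpha> \<beta> L) h"
    unfolding is_log_branch_def
  proof (intro conjI ballI h)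
    from lim[OF zero_in_Omega] have "(\<lambda>k. 0) \<longlonglongrightarrow> h 0" by (simp add: hk_def)
    then show "h 0 = 0" by (simp add: LIMSEQ_const_iff)
    fix t assume t: "t \<in> Omega_I \<alpha> \<beta>"
    have "(\<lambda>k. exp (hk (r k) t)) \<longlonglongrightarrow> exp (h t)" by (intro tendsto_exp lim t)
    moreover have "(\<lambda>k. exp (hk (r k) t)) \<longlonglongrightarrow> gen_fun M Z \<alpha> \<beta> L t"
      unfolding exp_hk[OF t] by (rule sub[OF product_tendsto_gen_fun[OF L]])
    ultimately show "exp (h t) = gen_fun M Z \<alpha> \<beta> L t" by (rule LIMSEQ_unique)
  qed
  show branch: "is_log_branch (Omega_I \<alpha> \<beta>) (gen_fun M Z \<alpha> \<beta> L) (branch L)"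
    unfolding branch_def log_branch_def
    by (rule someI[of "is_log_branch (Omega_I \<alpha> \<beta>) (gen_fun M Z \<alpha> \<beta> L)", OF h_branch])
  have branch_eq: "branch L t = h t" if "t \<in> Omega_I \<alpha> \<beta>" for t
    by (rule is_log_branch_unique[OF open_Omega connected_Omega zero_in_Omega branch h_branch that])
  show "branch L (complex_of_real x) \<in> \<real>" if x: "- (1 / rho_I \<alpha> \<beta>) < x"
  proof -
    have "hk k (complex_of_real x) \<in> \<real>" for k
      unfolding hk_def using Ln_real_on_slit(1)[OF rho_pos x] l by (intro Reals_mult sum_in_Reals) auto
    then have "h (complex_of_real x) \<in> \<real>"
      using closed_sequentially[OF closed_complex_Reals _ lim[OF real_mem[OF x]]] by blast
    then show ?thesis using branch_eq[OF real_mem[OF x]] by simp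
  qed
  show "cmod (remainder L t) \<le> (cmod t / c)\<^sup>2 * var_const \<alpha> \<beta>"
    if t: "t \<in> Omega_I \<alpha> \<beta>" and c: "bounded_away (rho_I \<alpha> \<beta>) t c"
  proof -
    have ts: "t \<in> slit (rho_I \<alpha> \<beta>)" using t by (simp add: Omega_slit)
    have per_k: "cmod (hk k t - complex_of_real L * L_sum \<alpha> \<beta> (k + k0) t) \<le> (cmod t / c)\<^sup>2 * variance \<alpha> \<beta> L (k + k0)" for k
    proof -
      have "cmod ((\<Sum>a<n k. Ln (1 + t * complex_of_real (l k a))) - complex_of_real (L * mesh (k + k0) / (2 * pi)) *
            (\<Sum>j<n k. Ln (1 + t * complex_of_real (q_I \<alpha> \<beta> (node (k + k0) j)))))
          \<le> (cmod t / c)\<^sup>2 * (L * mesh (k + k0) / (2 * pi) * (\<Sum>j<n k. (q_I \<alpha> \<beta> (node (k + k0) j))\<^sup>2) - (\<Sum>a<n k. (l k a)\<^sup>2))"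
        by (rule compressed_symbol.berezin[OF cs, where f' = "\<lambda>y. t / (1 + t * complex_of_real y)"])
           (use Ln_taylor_bounds(2)[OF rho_pos ts c] in auto)
      moreover have "(\<Sum>a<n k. (l k a)\<^sup>2) = (\<Sum>i<n k. \<Sum>j<n k. (cmod (gram \<alpha> \<beta> (k + k0) 0 L i j))\<^sup>2)"
        unfolding n_def l_def by (rule sum_eigenvalues_squared[OF eigenbasis_eig, symmetric])
      moreover have "complex_of_real (L * mesh (k + k0) / (2 * pi)) * (\<Sum>j<n k. Ln (1 + t * complex_of_real (q_I \<alpha> \<beta> (node (k + k0) j))))
         = complex_of_real L * L_sum \<alpha> \<beta> (k + k0) t" unfolding L_sum_def n_def by simp
      ultimately show ?thesis unfolding hk_def variance_def n_def by simp
    qed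
    obtain V where V: "variance \<alpha> \<beta> L \<longlonglongrightarrow> V" "V \<le> var_const \<alpha> \<beta>" using variance_limit[OF ab L] by metis
    have "(\<lambda>k. cmod (hk (r k) t - complex_of_real L * L_sum \<alpha> \<beta> (r k + k0) t)) \<longlonglongrightarrow> cmod (h t - complex_of_real L * L_I \<alpha> \<beta> t)"
      by (intro tendsto_intros lim t sub[OF L_sum_tendsto[OF ab t]])
    moreover have "(\<lambda>k. (cmod t / c)\<^sup>2 * variance \<alpha> \<beta> L (r k + k0)) \<longlonglongrightarrow> (cmod t / c)\<^sup>2 * V"
      by (intro tendsto_intros sub[OF V(1)])
    ultimately have "cmod (h t - complex_of_real L * L_I \<alpha> \<beta> t) \<le> (cmod t / c)\<^sup>2 * V"
      by (rule LIMSEQ_le) (use per_k in blast)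
    also have "\<dots> \<le> (cmod t / c)\<^sup>2 * var_const \<alpha> \<beta>" using V(2) by (intro mult_left_mono) auto
    finally show ?thesis unfolding remainder_def branch_eq[OF t] .
  qed
qed

text \<open>
For $t\ge0$ the determinants are real, and at least $1$ for fine meshes, so the generating function is positive.
\<close>

lemma fredholm_det_tendsto_gen_fun:
  assumes "0 < L" "0 \<le> t"
  shows "(\<lambda>k. fredholm_det \<alpha> \<beta> k t 0 L) \<longlonglongrightarrow> Re (gen_fun M Z \<alpha> \<beta> L (complex_of_real t))"
    "gen_fun M Z \<alpha> \<beta> L (complex_of_real t) = complex_of_real (Re (gen_fun M Z \<alpha> \<beta> L (complex_of_real t)))"
    "0 < Re (gen_fun M Z \<alpha> \<beta> L (complex_of_real t))"
proof -
  have eq: "(\<Prod>a<npts k. 1 + complex_of_real t * complex_of_real (eigval \<alpha> \<beta> L k a)) = complex_of_real (fredholm_det \<alpha> \<beta> k t 0 L)" for k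
    unfolding fredholm_det_eigenbasis[OF eigenbasis_eig] by simp
  have lim: "(\<lambda>k. complex_of_real (fredholm_det \<alpha> \<beta> k t 0 L)) \<longlonglongrightarrow> gen_fun M Z \<alpha> \<beta> L (complex_of_real t)"
    using product_tendsto_gen_fun[OF assms(1), of "complex_of_real t"] unfolding eq .
  from tendsto_Re[OF lim] show lim': "(\<lambda>k. fredholm_det \<alpha> \<beta> k t 0 L) \<longlonglongrightarrow> Re (gen_fun M Z \<alpha> \<beta> L (complex_of_real t))" by simp
  show "gen_fun M Z \<alpha> \<beta> L (complex_of_real t) = complex_of_real (Re (gen_fun M Z \<alpha> \<beta> L (complex_of_real t)))"
    by (rule LIMSEQ_unique[OF lim tendsto_of_real[OF lim']])
  have "1 \<le> fredholm_det \<alpha> \<beta> k t 0 L" if "nat \<lceil>L\<rceil> \<le> k" for k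
    unfolding fredholm_det_eigenbasis[OF eigenbasis_eig]
    using compressed_symbol.eigenvalue_nonneg[OF compressed[OF assms(1) large_index[OF assms(1) that]]] assms(2)
    by (intro prod_ge_1) auto
  then have "1 \<le> Re (gen_fun M Z \<alpha> \<beta> L (complex_of_real t))"
    by (intro LIMSEQ_le_const[OF lim']) blast
  then show "0 < Re (gen_fun M Z \<alpha> \<beta> L (complex_of_real t))" by simp
qed

lemma gen_fun_submodular:
  assumes "0 < L" "0 \<le> c" "0 \<le> h" "0 \<le> t"
  defines "F \<equiv> \<lambda>L. Re (gen_fun M Z \<alpha> \<beta> L (complex_of_real t))"
  shows "F (c + L + h) * F L \<le> F (c + L) * F (L + h)"
proof (rule LIMSEQ_le)
  show "(\<lambda>k. fredholm_det \<alpha> \<beta> k t 0 (c + L + h) * fredholm_det \<alpha> \<beta> k t 0 L) \<longlonglongrightarrow> F (c + L + h) * F L"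
    "(\<lambda>k. fredholm_det \<alpha> \<beta> k t 0 (c + L) * fredholm_det \<alpha> \<beta> k t 0 (L + h)) \<longlonglongrightarrow> F (c + L) * F (L + h)"
    unfolding F_def using assms by (intro tendsto_mult fredholm_det_tendsto_gen_fun; simp)+
  show "\<exists>N. \<forall>k\<ge>N. fredholm_det \<alpha> \<beta> k t 0 (c + L + h) * fredholm_det \<alpha> \<beta> k t 0 L \<le> fredholm_det \<alpha> \<beta> k t 0 (c + L) * fredholm_det \<alpha> \<beta> k t 0 (L + h)"
    using fredholm_det_submodular[of t \<alpha> \<beta> c L h] assms ab by (intro exI[of _ 0]) auto
qed

section \<open>Long boxes\<close>

lemma L_I_real: "- (1 / rho_I \<alpha> \<beta>) < x \<Longrightarrow> L_I \<alpha> \<beta> (complex_of_real x) \<in> \<real>"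
  by (rule closed_sequentially[OF closed_complex_Reals L_sum_real[OF ab] L_sum_tendsto[OF ab real_mem]])

lemma remainder_real:
  "0 < L \<Longrightarrow> - (1 / rho_I \<alpha> \<beta>) < x \<Longrightarrow> remainder L (complex_of_real x) \<in> \<real>"
  unfolding remainder_def by (intro Reals_diff Reals_mult Reals_of_real finite_volume_branch(2) L_I_real)

lemma remainder_zero: "0 < L \<Longrightarrow> remainder L 0 = 0"
  using LIMSEQ_unique[OF L_sum_tendsto[OF ab zero_in_Omega], of 0] finite_volume_branch(1)[of L]
  by (simp add: L_sum_def remainder_def is_log_branch_def)

lemma remainder_locally_bounded: "locally_bounded_family {0<..} (Omega_I \<alpha> \<beta>) remainder"
  unfolding locally_bounded_family_def
proof (intro conjI ballI allI impI)
  fix L :: real assume "L \<in> {0<..}"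
  then show "remainder L holomorphic_on Omega_I \<alpha> \<beta>"
    unfolding remainder_def using finite_volume_branch(1)[of L] L_I_holomorphic[OF ab]
    unfolding is_log_branch_def by (auto intro!: holomorphic_intros)
next
  fix K assume "compact K \<and> K \<subseteq> Omega_I \<alpha> \<beta>"
  then have K: "compact K" "K \<subseteq> Omega_I \<alpha> \<beta>" by auto
  obtain c where c: "c > 0" "\<And>t. t \<in> K \<Longrightarrow> bounded_away (rho_I \<alpha> \<beta>) t c"
    using slit_uniform_lower_bound[OF rho_pos K(1)] K(2) unfolding Omega_slit by metis
  obtain b where b: "\<And>t. t \<in> K \<Longrightarrow> cmod t \<le> b" using compact_imp_bounded[OF K(1)] unfolding bounded_iff by blast
  have "cmod (remainder L t) \<le> (b / c)\<^sup>2 * var_const \<alpha> \<beta>" if "0 < L" "t \<in> K" for L t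
  proof -
    have "cmod (remainder L t) \<le> (cmod t / c)\<^sup>2 * var_const \<alpha> \<beta>"
      using that K c by (intro finite_volume_branch(3)) auto
    also have "\<dots> \<le> (b / c)\<^sup>2 * var_const \<alpha> \<beta>"
      using b[OF that(2)] c(1) unfolding var_const_def
      by (intro mult_right_mono power_mono divide_right_mono) auto
    finally show ?thesis .
  qed
  then show "\<exists>B. \<forall>L\<in>{0<..}. \<forall>t\<in>K. cmod (remainder L t) \<le> B"
    by (intro exI[of _ "(b / c)\<^sup>2 * var_const \<alpha> \<beta>"]) auto
qed

text \<open>
On the positive half-line the remainder is $\log\mathbb E(1+t)^{N_I(L)}$, a real function of $L$ with nonincreasing
increments by \<open>gen_fun_submodular\<close>, minus a linear function.
\<close>

lemma remainder_converges_on_positive_reals: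
  assumes x: "0 < x"
  obtains l where "((\<lambda>L. remainder L (complex_of_real x)) \<longlongrightarrow> l) at_top"
proof -
  let ?t = "complex_of_real x"
  have t: "?t \<in> Omega_I \<alpha> \<beta>" by (rule real_mem[OF pos_mem[OF x]])
  define F where "F = (\<lambda>L. Re (gen_fun M Z \<alpha> \<beta> L ?t))"
  have F: "gen_fun M Z \<alpha> \<beta> L ?t = complex_of_real (F L)" "0 < F L" if "0 < L" for L
    using fredholm_det_tendsto_gen_fun[OF that, of x] x unfolding F_def by auto
  define a where "a = Re (L_I \<alpha> \<beta> ?t)"
  have f_eq: "remainder L ?t = complex_of_real (ln (F L) - L * a)" if L: "0 < L" for L
  proof -
    obtain y where y: "branch L ?t = complex_of_real y"
      using finite_volume_branch(2)[OF L pos_mem[OF x]] by (auto elim: Reals_cases)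
    have "exp (branch L ?t) = complex_of_real (F L)"
      using finite_volume_branch(1)[OF L] t F(1)[OF L] unfolding is_log_branch_def by auto
    then have "complex_of_real (exp y) = complex_of_real (F L)" unfolding y by (simp add: exp_of_real)
    then have "y = ln (F L)" by (metis ln_exp of_real_eq_iff)
    moreover have "L_I \<alpha> \<beta> ?t = complex_of_real a"
      using L_I_real[OF pos_mem[OF x]] unfolding a_def by (simp add: of_real_Re)
    ultimately show ?thesis unfolding remainder_def y by simp
  qed
  have "compact {?t} \<and> {?t} \<subseteq> Omega_I \<alpha> \<beta>" using t by simp
  then obtain B where "\<forall>L\<in>{0<..}. \<forall>z\<in>{?t}. cmod (remainder L z) \<le> B"
    using remainder_locally_bounded unfolding locally_bounded_family_def by blast
  then have B: "\<And>L. 0 < L \<Longrightarrow> cmod (remainder L ?t) \<le> B" by simp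
  obtain s where "((\<lambda>L. ln (F L) - L * a) \<longlongrightarrow> s) at_top"
  proof (rule bounded_decreasing_increments_convergent[of "\<lambda>L. ln (F L) - L * a" B])
    show "\<bar>ln (F L) - L * a\<bar> \<le> B" if "0 < L" for L
      using B[OF that] unfolding f_eq[OF that] norm_of_real .
    fix L c h :: real assume L: "0 < L" "0 \<le> c" "0 \<le> h"
    then have p: "0 < F L" "0 < F (c + L)" "0 < F (L + h)" "0 < F (c + L + h)" using F(2) by auto
    have "F (c + L + h) * F L \<le> F (c + L) * F (L + h)"
      using gen_fun_submodular[OF L, of x] x unfolding F_def by simp
    then have "ln (F (c + L + h) * F L) \<le> ln (F (c + L) * F (L + h))" using p by simp
    then have "ln (F (c + L + h)) + ln (F L) \<le> ln (F (c + L)) + ln (F (L + h))" using p by (simp add: ln_mult)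
    then show "ln (F (c + L + h)) - (c + L + h) * a + (ln (F L) - L * a)
        \<le> ln (F (c + L)) - (c + L) * a + (ln (F (L + h)) - (L + h) * a)"
      by (simp add: algebra_simps)
  qed auto
  then have "((\<lambda>L. complex_of_real (ln (F L) - L * a)) \<longlongrightarrow> complex_of_real s) at_top"
    by (rule tendsto_of_real)
  moreover have "\<forall>\<^sub>F L in at_top. complex_of_real (ln (F L) - L * a) = remainder L ?t"
    using eventually_gt_at_top[of 0] by eventually_elim (simp add: f_eq)
  ultimately show ?thesis using that by (blast intro: Lim_transform_eventually)
qed

lemma remainder_limit:
  obtains D where "D holomorphic_on Omega_I \<alpha> \<beta>"
    "\<And>K. compact K \<Longrightarrow> K \<subseteq> Omega_I \<alpha> \<beta> \<Longrightarrow> uniform_limit K remainder D at_top"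
proof -
  let ?E = "complex_of_real ` {0<..}"
  have sub: "?E \<subseteq> Omega_I \<alpha> \<beta>" using real_mem pos_mem by auto
  have one: "1 \<in> Omega_I \<alpha> \<beta>" using real_mem[OF pos_mem[of 1]] by simp
  have lp: "1 islimpt ?E"
    unfolding islimpt_approachable
  proof (intro allI impI)
    fix e :: real assume "0 < e"
    then show "\<exists>x'\<in>?E. x' \<noteq> 1 \<and> dist x' 1 < e"
      by (intro bexI[of _ "complex_of_real (1 + e / 2)"]) (auto simp: dist_norm complex_eq_iff)
  qed
  have conv: "\<exists>l. ((\<lambda>L. remainder L t) \<longlongrightarrow> l) at_top" if "t \<in> ?E" for t
    using that remainder_converges_on_positive_reals by (metis greaterThan_iff imageE)
  show ?thesis
    using vitali_at_top[OF open_Omega connected_Omega remainder_locally_bounded sub one lp conv] that by blast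
qed

end

theorem theorem1p1:
  fixes M :: "'a measure" and Z :: "'a \<Rightarrow> complex set" and \<alpha> \<beta> :: real
  assumes "determinantal_process upper_half_plane K_H M Z"
    and "0 < \<alpha>" and "\<alpha> < \<beta>"
  shows "(\<forall>L>0. \<forall>t\<in>Omega_I \<alpha> \<beta>. gen_fun M Z \<alpha> \<beta> L t \<noteq> 0) \<and>
    (\<forall>L>0. is_log_branch (Omega_I \<alpha> \<beta>) (gen_fun M Z \<alpha> \<beta> L)
              (log_branch (Omega_I \<alpha> \<beta>) (gen_fun M Z \<alpha> \<beta> L))) \<and>
    (\<exists>D. (D holomorphic_on Omega_I \<alpha> \<beta> \<and> D 0 = 0 \<and> asymptotic_remainder M Z \<alpha> \<beta> D) \<and>
         (\<forall>D'. D' holomorphic_on Omega_I \<alpha> \<beta> \<and> D' 0 = 0 \<and> asymptotic_remainder M Z \<alpha> \<beta> D' \<longrightarrow>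
               (\<forall>t\<in>Omega_I \<alpha> \<beta>. D' t = D t)) \<and>
         (\<forall>x::real. - (1 / rho_I \<alpha> \<beta>) < x \<longrightarrow> D (complex_of_real x) \<in> \<real>))"
proof -
  interpret half_plane_process M Z \<alpha> \<beta> by unfold_locales (use assms in auto)
  let ?\<Omega> = "Omega_I \<alpha> \<beta>"
  obtain D where D: "D holomorphic_on ?\<Omega>"
    and uni: "\<And>K. compact K \<Longrightarrow> K \<subseteq> ?\<Omega> \<Longrightarrow> uniform_limit K remainder D at_top"
    using remainder_limit by blast
  have ptD: "((\<lambda>L. remainder L t) \<longlongrightarrow> D t) at_top" if "t \<in> ?\<Omega>" for t
    using tendsto_uniform_limitI[OF uni[of "{t}"]] that by simp
  have rem: "asymptotic_remainder M Z \<alpha> \<beta> D"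
    unfolding asymptotic_remainder_def
  proof
    fix t assume "t \<in> ?\<Omega>"
    then obtain e where e: "e > 0" "cball t e \<subseteq> ?\<Omega>" using open_Omega open_contains_cball by blast
    have "uniform_limit (cball t e) remainder D at_top" by (rule uni) (use e in auto)
    then have u: "uniform_limit (ball t e) remainder D at_top"
      by (rule uniform_limit_on_subset) (rule ball_subset_cball)
    have "uniform_limit (ball t e) (\<lambda>L s. log_branch ?\<Omega> (gen_fun M Z \<alpha> \<beta> L) s - (complex_of_real L * L_I \<alpha> \<beta> s + D s)) (\<lambda>_. 0) at_top"
      unfolding uniform_limit_iff
    proof (intro allI impI)
      fix \<epsilon> :: real assume "\<epsilon> > 0"
      from uniform_limitD[OF u this]
      show "\<forall>\<^sub>F L in at_top. \<forall>s\<in>ball t e. dist (log_branch ?\<Omega> (gen_fun M Z \<alpha> \<beta> L) s - (complex_of_real L * L_I \<alpha> \<beta> s + D s)) 0 < \<epsilon>"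
        by eventually_elim (simp add: remainder_def branch_def dist_norm diff_diff_eq)
    qed
    then show "\<exists>U. open U \<and> t \<in> U \<and> U \<subseteq> ?\<Omega> \<and> uniform_limit U
          (\<lambda>L s. log_branch ?\<Omega> (gen_fun M Z \<alpha> \<beta> L) s - (complex_of_real L * L_I \<alpha> \<beta> s + D s)) (\<lambda>_. 0) at_top"
      using e ball_subset_cball[of t e] by (intro exI[of _ "ball t e"]) auto
  qed
  have uniq: "D' t = D t" if ar: "asymptotic_remainder M Z \<alpha> \<beta> D'" and t: "t \<in> ?\<Omega>" for D' t
  proof -
    obtain U where U: "t \<in> U"
      "uniform_limit U (\<lambda>L s. branch L s - (complex_of_real L * L_I \<alpha> \<beta> s + D' s)) (\<lambda>_. 0) at_top"
      using bspec[OF ar[unfolded asymptotic_remainder_def] t] unfolding branch_def by (elim exE conjE)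
    have "((\<lambda>L. branch L t - (complex_of_real L * L_I \<alpha> \<beta> t + D' t) + D' t) \<longlongrightarrow> 0 + D' t) at_top"
      by (intro tendsto_add tendsto_uniform_limitI[OF U(2,1)] tendsto_const)
    then have "((\<lambda>L. remainder L t) \<longlongrightarrow> D' t) at_top" unfolding remainder_def by (simp add: algebra_simps)
    then show ?thesis using tendsto_unique[OF _ _ ptD[OF t]] by (simp add: trivial_limit_at_top_linorder)
  qed
  have D0: "D 0 = 0"
  proof -
    have "\<forall>\<^sub>F L in at_top. remainder L 0 = 0"
      using eventually_gt_at_top[of 0] by eventually_elim (rule remainder_zero)
    then have "((\<lambda>L. remainder L 0) \<longlongrightarrow> 0) at_top" by (rule tendsto_eventually)
    then show ?thesis using tendsto_unique[OF _ ptD[OF zero_in_Omega]] by (simp add: trivial_limit_at_top_linorder)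
  qed
  have D_real: "D (complex_of_real x) \<in> \<real>" if "- (1 / rho_I \<alpha> \<beta>) < x" for x
  proof (rule Lim_in_closed_set[OF closed_complex_Reals _ _ ptD[OF real_mem[OF that]]])
    show "\<forall>\<^sub>F L in at_top. remainder L (complex_of_real x) \<in> \<real>"
      using eventually_gt_at_top[of 0] by eventually_elim (rule remainder_real[OF _ that])
  qed simp
  note branch = finite_volume_branch(1)
  have nonzero: "gen_fun M Z \<alpha> \<beta> L t \<noteq> 0" if "0 < L" "t \<in> ?\<Omega>" for L t
    using branch[OF that(1)] that(2) unfolding is_log_branch_def by (metis exp_not_eq_zero)
  show ?thesis
  proof (intro conjI exI[of _ D])
    show "\<forall>L>0. \<forall>t\<in>?\<Omega>. gen_fun M Z \<alpha> \<beta> L t \<noteq> 0" using nonzero by blast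
    show "\<forall>L>0. is_log_branch ?\<Omega> (gen_fun M Z \<alpha> \<beta> L) (log_branch ?\<Omega> (gen_fun M Z \<alpha> \<beta> L))"
      using branch unfolding branch_def by blast
    show "\<forall>D'. D' holomorphic_on ?\<Omega> \<and> D' 0 = 0 \<and> asymptotic_remainder M Z \<alpha> \<beta> D' \<longrightarrow> (\<forall>t\<in>?\<Omega>. D' t = D t)"
      using uniq by blast
    show "\<forall>x::real. - (1 / rho_I \<alpha> \<beta>) < x \<longrightarrow> D (complex_of_real x) \<in> \<real>" using D_real by blast
  qed (rule D D0 rem)+
qed

end
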